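(* (a) There exists a unique *-automorphism $\widehat\Theta$ of $\widehat{\mathfrak A}$ satisfying $\widehat\Theta\circ\psi=\psi\circ\Theta$ and $\widehat\Theta(T)=T$. (b) We have $\widehat\Theta(\widehat{\mathfrak A}_0)\subseteq\widehat{\mathfrak A}_0$ and $\widehat\Theta(\widehat{\mathfrak A}_1)\subseteq\widehat{\mathfrak A}_1$. Define the even and odd parts by $$\widehat{\mathfrak A}_\pm:=\{A\in\widehat{\mathfrak A}:\widehat\Theta(A)=\pm A\},\quad \widehat{\mathfrak A}_{0,\pm}:=\{A\in\widehat{\mathfrak A}_0:\widehat\Theta(A)=\pm A\},\quad \widehat{\mathfrak A}_{1,\pm}:=\{A\in\widehat{\mathfrak A}_1:\widehat\Theta(A)=\pm A\}.$$ The even parts $\widehat{\mathfrak A}_+$, $\widehat{\mathfrak A}_{0,+}$, $\widehat{\mathfrak A}_{1,+}$ are unital C*-subalgebras of $\widehat{\mathfrak A}$. The odd parts $\widehat{\mathfrak A}_-$, $\widehat{\mathfrak A}_{0,-}$, $\widehat{\mathfrak A}_{1,-}$ are invariant under the addition, the scalar multiplication, and the involution of $\widehat{\mathfrak A}$ and are closed with respect to the C*-norm of $\widehat{\mathfrak A}$. (c) We have $\widehat{\mathfrak A}=\widehat{\mathfrak A}_+\oplus\widehat{\mathfrak A}_-$, $\widehat{\mathfrak A}_0=\widehat{\mathfrak A}_{0,+}\oplus\widehat{\mathfrak A}_{0,-}$, and $\widehat{\mathfrak A}_1=\widehat{\mathfrak A}_{1,+}\oplus\widehat{\mathfrak A}_{1,-}$,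 and $$\widehat{\mathfrak A}_{1,+}=\widehat{\mathfrak A}_{0,+},\qquad \widehat{\mathfrak A}_{1,-}=\widehat{\mathfrak A}_{0,-}T.$$ Moreover, $\widehat{\mathfrak A}=\widehat{\mathfrak A}_1\oplus\widehat{\mathfrak A}_1T$.
   Context: Spin algebra. $\mathrm{Fin}(\mathbb Z)$ is the set of nonempty finite subsets of $\mathbb Z$, directed by inclusion. For each $x\in\mathbb Z$, $\mathfrak A_x$ is a unital C*-algebra with identity $1_{\{x\}}$ and a fixed *-isomorphism $\xi_x:\mathfrak A_x\to\mathbb C^{2\times2}$. For $\Lambda=\{x_1<\dots<x_n\}\in\mathrm{Fin}(\mathbb Z)$, $\mathfrak A_\Lambda=\mathfrak A_{x_1}\odot\cdots\odot\mathfrak A_{x_n}$ is the algebraic tensor product with factorwise multiplication and involution and its unique C*-norm (so $\mathfrak A_\Lambda\cong\mathbb C^{2^n\times2^n}$). For $\Lambda\subseteq\Lambda'$, $\varphi_{\Lambda',\Lambda}:\mathfrak A_\Lambda\to\mathfrak A_{\Lambda'}$ is the unital injective *-homomorphism inserting $1_{\{x\}}$ in the tensor slots $x\in\Lambda'\setminus\Lambda$. $\mathfrak A$ is the infinite tensor product, i.e., the C*-inductive limit of $(\mathfrak A_\Lambda,\varphi_{\Lambda',\Lambda})$: a unital C*-algebra with unital C*-subalgebras $\widetilde{\mathfrak A}_\Lambda$ and *-isomorphisms $\varphi_\Lambda:\mathfrak A_\Lambda\to\widetilde{\mathfrak A}_\Lambda$ such that $\varphi_{\Lambda'}\circ\varphi_{\Lambda',\Lambda}=\varphi_\Lambda$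 for $\Lambda\subseteq\Lambda'$ and $\bigcup_\Lambda\widetilde{\mathfrak A}_\Lambda$ is dense in $\mathfrak A$. Spins. $\sigma_1,\sigma_2,\sigma_3$ are the Pauli matrices, $\sigma_0=1_2$, and $\sigma_\kappa^{(x)}:=\varphi_{\{x\}}(\xi_x^{-1}(\sigma_\kappa))\in\mathfrak A$ for $x\in\mathbb Z$, $\kappa\in\{0,1,2,3\}$. $\sigma_\pm^{(x)}:=\frac12(\sigma_1^{(x)}\pm i\sigma_2^{(x)})$. $S_x:=\prod_{y=1}^{x-1}\sigma_3^{(y)}$ if $x\ge2$, $S_1:=1$, $S_x:=\prod_{y=x}^{0}\sigma_3^{(y)}$ if $x\le0$. With $\varepsilon_0=\varepsilon_3=1$, $\varepsilon_1=\varepsilon_2=-1$, $\Theta$ and $\Theta'$ are the *-automorphisms of $\mathfrak A$ with $\Theta(\sigma_\kappa^{(x)})=\varepsilon_\kappa\sigma_\kappa^{(x)}$ for all $x\in\mathbb Z$, and $\Theta'(\sigma_\kappa^{(x)})=\sigma_\kappa^{(x)}$ if $x\ge1$, $\Theta'(\sigma_\kappa^{(x)})=\varepsilon_\kappa\sigma_\kappa^{(x)}$ if $x\le0$; they satisfy $\Theta^2=\Theta'^2=1$. Extension. $\widehat{\mathfrak A}:=\left\{\begin{bmatrix}A&B\\\Theta'(B)&\Theta'(A)\end{bmatrix}:A,B\in\mathfrak A\right\}$, a unital C*-subalgebra of the C*-algebra $\mathfrak A^{2\times2}$ of $2\times2$ matrices over $\mathfrak A$; $\widehat{\mathfrak A}_0:=\left\{\begin{bmatrix}A&0\\0&\Theta'(A)\end{bmatrix}:A\in\mathfrak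 A\right\}$; $\psi:\mathfrak A\to\widehat{\mathfrak A}_0$ is the *-isomorphism $\psi(A):=\begin{bmatrix}A&0\\0&\Theta'(A)\end{bmatrix}$; $T:=\begin{bmatrix}0&1\\1&0\end{bmatrix}\in\widehat{\mathfrak A}$. For $x\in\mathbb Z$, $a_x:=T\psi(S_x\sigma_-^{(x)})\in\widehat{\mathfrak A}$. $\widehat{\mathfrak A}_1$ is the C*-subalgebra of $\widehat{\mathfrak A}$ generated by $\{a_x:x\in\mathbb Z\}$, i.e., the intersection of all C*-subalgebras (norm-closed *-subalgebras) of $\widehat{\mathfrak A}$ containing it. For a subset $\mathfrak C\subseteq\widehat{\mathfrak A}$, $\mathfrak CT:=\{AT:A\in\mathfrak C\}$. $\oplus$ denotes the internal direct sum of vector subspaces. *)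

theory Defs
  imports
    "HOL-Analysis.Analysis"
    "HOL-Algebra.AbelCoset"
    "HOL-Algebra.Module"
    "HOL-Library.Poly_Mapping"
begin

definition complex_ring :: "complex ring" where
  "complex_ring = \<lparr>carrier = UNIV, mult = (*), one = 1, zero = 0, add = (+)\<rparr>"

record 'a star_algebra = "(complex, 'a) module" +
  star :: "'a \<Rightarrow> 'a"

record 'a cstar = "'a star_algebra" +
  cnorm :: "'a \<Rightarrow> real"

text \<open>The theory of metric spaces requires a distance function that is nonnegative and
  symmetric on the whole type; therefore it is set to 0 outside the carrier.\<close>

definition cdist :: "('a, 'm) cstar_scheme \<Rightarrow> 'a \<Rightarrow> 'a \<Rightarrow> real" where
  "cdist A x y =
     (if x \<in> carrier A \<and> y \<in> carrier A then cnorm A (x \<ominus>\<^bsub>A\<^esub> y) else 0)"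

definition norm_topology :: "('a, 'm) cstar_scheme \<Rightarrow> 'a topology" where
  "norm_topology A = Metric_space.mtopology (carrier A) (cdist A)"

locale unital_cstar_algebra = ring A + Module.module complex_ring A for A (structure) +
  assumes smult_mult_left: "\<lbrakk>x \<in> carrier A; y \<in> carrier A\<rbrakk> \<Longrightarrow> (c \<odot> x) \<otimes> y = c \<odot> (x \<otimes> y)"
    and smult_mult_right: "\<lbrakk>x \<in> carrier A; y \<in> carrier A\<rbrakk> \<Longrightarrow> x \<otimes> (c \<odot> y) = c \<odot> (x \<otimes> y)"
    and star_closed: "x \<in> carrier A \<Longrightarrow> star A x \<in> carrier A"
    and star_star: "x \<in> carrier A \<Longrightarrow> star A (star A x) = x"
    and star_add: "\<lbrakk>x \<in> carrier A; y \<in> carrier A\<rbrakk> \<Longrightarrow> star A (x \<oplus> y) = star A x \<oplus> star A y"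
    and star_smult: "x \<in> carrier A \<Longrightarrow> star A (c \<odot> x) = cnj c \<odot> star A x"
    and star_mult: "\<lbrakk>x \<in> carrier A; y \<in> carrier A\<rbrakk> \<Longrightarrow> star A (x \<otimes> y) = star A y \<otimes> star A x"
    and cnorm_nonneg: "x \<in> carrier A \<Longrightarrow> 0 \<le> cnorm A x"
    and cnorm_eq_zero: "x \<in> carrier A \<Longrightarrow> cnorm A x = 0 \<longleftrightarrow> x = \<zero>"
    and cnorm_triangle: "\<lbrakk>x \<in> carrier A; y \<in> carrier A\<rbrakk> \<Longrightarrow> cnorm A (x \<oplus> y) \<le> cnorm A x + cnorm A y"
    and cnorm_smult: "x \<in> carrier A \<Longrightarrow> cnorm A (c \<odot> x) = cmod c * cnorm A x"
    and cnorm_mult: "\<lbrakk>x \<in> carrier A; y \<in> carrier A\<rbrakk> \<Longrightarrow> cnorm A (x \<otimes> y) \<le> cnorm A x * cnorm A y"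
    and cnorm_star_mult: "x \<in> carrier A \<Longrightarrow> cnorm A (star A x \<otimes> x) = (cnorm A x)\<^sup>2"
    and complete: "Metric_space.mcomplete (carrier A) (cdist A)"

definition cstar_subalgebra :: "('a, 'm) cstar_scheme \<Rightarrow> 'a set \<Rightarrow> bool" where
  "cstar_subalgebra A B \<longleftrightarrow>
     submodule B complex_ring A \<and>
     (\<forall>x\<in>B. \<forall>y\<in>B. x \<otimes>\<^bsub>A\<^esub> y \<in> B) \<and>
     (\<forall>x\<in>B. star A x \<in> B) \<and>
     closedin (norm_topology A) B"

definition unital_cstar_subalgebra :: "('a, 'm) cstar_scheme \<Rightarrow> 'a set \<Rightarrow> bool" where
  "unital_cstar_subalgebra A B \<longleftrightarrow> cstar_subalgebra A B \<and> \<one>\<^bsub>A\<^esub> \<in> B"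

definition cstar_generated :: "('a, 'm) cstar_scheme \<Rightarrow> 'a set \<Rightarrow> 'a set" where
  "cstar_generated A X = \<Inter>{B. cstar_subalgebra A B \<and> X \<subseteq> B}"

definition star_hom :: "('a, 'm) star_algebra_scheme \<Rightarrow> ('b, 'n) star_algebra_scheme \<Rightarrow> ('a \<Rightarrow> 'b) \<Rightarrow> bool" where
  "star_hom A B h \<longleftrightarrow>
     h \<in> carrier A \<rightarrow> carrier B \<and>
     (\<forall>x\<in>carrier A. \<forall>y\<in>carrier A. h (x \<oplus>\<^bsub>A\<^esub> y) = h x \<oplus>\<^bsub>B\<^esub> h y) \<and>
     (\<forall>c. \<forall>x\<in>carrier A. h (c \<odot>\<^bsub>A\<^esub> x) = c \<odot>\<^bsub>B\<^esub> h x) \<and>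
     (\<forall>x\<in>carrier A. \<forall>y\<in>carrier A. h (x \<otimes>\<^bsub>A\<^esub> y) = h x \<otimes>\<^bsub>B\<^esub> h y) \<and>
     (\<forall>x\<in>carrier A. h (star A x) = star B (h x))"

definition star_iso :: "('a, 'm) star_algebra_scheme \<Rightarrow> ('b, 'n) star_algebra_scheme \<Rightarrow> ('a \<Rightarrow> 'b) \<Rightarrow> bool" where
  "star_iso A B h \<longleftrightarrow> star_hom A B h \<and> bij_betw h (carrier A) (carrier B)"

abbreviation star_automorphism :: "('a, 'm) star_algebra_scheme \<Rightarrow> ('a \<Rightarrow> 'a) \<Rightarrow> bool" where
  "star_automorphism A h \<equiv> star_iso A A h"

definition internal_direct_sum ::
  "('a, 'm) star_algebra_scheme \<Rightarrow> 'a set \<Rightarrow> 'a set \<Rightarrow> 'a set \<Rightarrow> bool" where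
  "internal_direct_sum A V U W \<longleftrightarrow>
     submodule U complex_ring A \<and> submodule W complex_ring A \<and>
     V = U <+>\<^bsub>A\<^esub> W \<and> U \<inter> W = {\<zero>\<^bsub>A\<^esub>}"

definition mat2_complex :: "(complex^2^2) cstar" where
  "mat2_complex =
     \<lparr>carrier = UNIV, mult = (**), one = mat 1, zero = 0, add = (+),
      smult = (\<lambda>c M. \<chi> i j. c * M $ i $ j),
      star = (\<lambda>M. \<chi> i j. cnj (M $ j $ i)),
      cnorm = (\<lambda>M. onorm ((*v) M))\<rparr>"

definition mk_mat2 :: "'a \<Rightarrow> 'a \<Rightarrow> 'a \<Rightarrow> 'a \<Rightarrow> 'a^2^2" where
  "mk_mat2 a b c d =
     (\<chi> i j. if i = 1 then (if j = 1 then a else b) else (if j = 1 then c else d))"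

text \<open>The C*-norm on the 2 by 2 matrices over a C*-algebra is unique, but it has no simple
  closed form in terms of the entries. It is therefore a parameter \<open>N\<close>, which is constrained by
  requiring that \<open>mat2_algebra A N\<close> is a C*-algebra.\<close>

definition mat2_algebra :: "('a, 'm) cstar_scheme \<Rightarrow> ('a^2^2 \<Rightarrow> real) \<Rightarrow> ('a^2^2) cstar" where
  "mat2_algebra A N =
     \<lparr>carrier = {M. \<forall>i j. M $ i $ j \<in> carrier A},
      mult = (\<lambda>M M'. \<chi> i j. M $ i $ 1 \<otimes>\<^bsub>A\<^esub> M' $ 1 $ j \<oplus>\<^bsub>A\<^esub> M $ i $ 2 \<otimes>\<^bsub>A\<^esub> M' $ 2 $ j),
      one = mk_mat2 \<one>\<^bsub>A\<^esub> \<zero>\<^bsub>A\<^esub> \<zero>\<^bsub>A\<^esub> \<one>\<^bsub>A\<^esub>,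
      zero = mk_mat2 \<zero>\<^bsub>A\<^esub> \<zero>\<^bsub>A\<^esub> \<zero>\<^bsub>A\<^esub> \<zero>\<^bsub>A\<^esub>,
      add = (\<lambda>M M'. \<chi> i j. M $ i $ j \<oplus>\<^bsub>A\<^esub> M' $ i $ j),
      smult = (\<lambda>c M. \<chi> i j. c \<odot>\<^bsub>A\<^esub> M $ i $ j),
      star = (\<lambda>M. \<chi> i j. star A (M $ j $ i)),
      cnorm = N\<rparr>"

text \<open>The tensor product over \<open>x \<in> \<Lambda>\<close> of the algebras \<open>A x\<close> is the quotient of the free complex
  vector space over \<open>Pi\<^sub>E \<Lambda> (\<lambda>x. carrier (A x))\<close> by the subspace spanned by the multilinearity
  relations. Finitely supported functions represent formal linear combinations of elementary
  tensors.\<close>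

type_synonym 'b formal = "(int \<Rightarrow> 'b) \<Rightarrow>\<^sub>0 complex"

definition formal_scale :: "complex \<Rightarrow> 'b formal \<Rightarrow> 'b formal" where
  "formal_scale c f = Poly_Mapping.map ((*) c) f"

definition formal_space :: "(int \<Rightarrow> ('b, 'm) star_algebra_scheme) \<Rightarrow> int set \<Rightarrow> 'b formal set" where
  "formal_space A \<Lambda> = {f. Poly_Mapping.keys f \<subseteq> (\<Pi>\<^sub>E x\<in>\<Lambda>. carrier (A x))}"

definition multilinear_relators ::
  "(int \<Rightarrow> ('b, 'm) star_algebra_scheme) \<Rightarrow> int set \<Rightarrow> 'b formal set" where
  "multilinear_relators A \<Lambda> =
     {Poly_Mapping.single (u(x := a \<oplus>\<^bsub>A x\<^esub> b)) 1
        - Poly_Mapping.single (u(x := a)) 1 - Poly_Mapping.single (u(x := b)) 1 | u x a b.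
        u \<in> (\<Pi>\<^sub>E x\<in>\<Lambda>. carrier (A x)) \<and> x \<in> \<Lambda> \<and> a \<in> carrier (A x) \<and> b \<in> carrier (A x)} \<union>
     {Poly_Mapping.single (u(x := c \<odot>\<^bsub>A x\<^esub> a)) 1 - Poly_Mapping.single (u(x := a)) c | u x a c.
        u \<in> (\<Pi>\<^sub>E x\<in>\<Lambda>. carrier (A x)) \<and> x \<in> \<Lambda> \<and> a \<in> carrier (A x)}"

definition tensor_rel ::
  "(int \<Rightarrow> ('b, 'm) star_algebra_scheme) \<Rightarrow> int set \<Rightarrow> ('b formal \<times> 'b formal) set" where
  "tensor_rel A \<Lambda> =
     {(f, g). f \<in> formal_space A \<Lambda> \<and> g \<in> formal_space A \<Lambda> \<and>
              f - g \<in> Modules.module.span formal_scale (multilinear_relators A \<Lambda>)}"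

definition formal_mult ::
  "(int \<Rightarrow> ('b, 'm) star_algebra_scheme) \<Rightarrow> int set \<Rightarrow> 'b formal \<Rightarrow> 'b formal \<Rightarrow> 'b formal" where
  "formal_mult A \<Lambda> f g =
     (\<Sum>u\<in>Poly_Mapping.keys f. \<Sum>v\<in>Poly_Mapping.keys g.
        Poly_Mapping.single (\<lambda>x\<in>\<Lambda>. u x \<otimes>\<^bsub>A x\<^esub> v x)
          (Poly_Mapping.lookup f u * Poly_Mapping.lookup g v))"

definition formal_star ::
  "(int \<Rightarrow> ('b, 'm) star_algebra_scheme) \<Rightarrow> int set \<Rightarrow> 'b formal \<Rightarrow> 'b formal" where
  "formal_star A \<Lambda> f =
     (\<Sum>u\<in>Poly_Mapping.keys f.
        Poly_Mapping.single (\<lambda>x\<in>\<Lambda>. star (A x) (u x)) (cnj (Poly_Mapping.lookup f u)))"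

definition elementary_tensor ::
  "(int \<Rightarrow> ('b, 'm) star_algebra_scheme) \<Rightarrow> int set \<Rightarrow> (int \<Rightarrow> 'b) \<Rightarrow> 'b formal set" where
  "elementary_tensor A \<Lambda> u = tensor_rel A \<Lambda> `` {Poly_Mapping.single (restrict u \<Lambda>) 1}"

definition tensor_algebra ::
  "(int \<Rightarrow> ('b, 'm) star_algebra_scheme) \<Rightarrow> int set \<Rightarrow> ('b formal set \<Rightarrow> real) \<Rightarrow>
   ('b formal set) cstar" where
  "tensor_algebra A \<Lambda> N =
     \<lparr>carrier = formal_space A \<Lambda> // tensor_rel A \<Lambda>,
      mult = (\<lambda>X Y. \<Union>f\<in>X. \<Union>g\<in>Y. tensor_rel A \<Lambda> `` {formal_mult A \<Lambda> f g}),
      one = elementary_tensor A \<Lambda> (\<lambda>x. \<one>\<^bsub>A x\<^esub>),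
      zero = tensor_rel A \<Lambda> `` {0},
      add = (\<lambda>X Y. \<Union>f\<in>X. \<Union>g\<in>Y. tensor_rel A \<Lambda> `` {f + g}),
      smult = (\<lambda>c X. \<Union>f\<in>X. tensor_rel A \<Lambda> `` {formal_scale c f}),
      star = (\<lambda>X. \<Union>f\<in>X. tensor_rel A \<Lambda> `` {formal_star A \<Lambda> f}),
      cnorm = N\<rparr>"

definition tensor_insertion ::
  "(int \<Rightarrow> ('b, 'm) star_algebra_scheme) \<Rightarrow> int set \<Rightarrow> int set \<Rightarrow> 'b formal set \<Rightarrow> 'b formal set" where
  "tensor_insertion A \<Lambda>' \<Lambda> X =
     (\<Union>f\<in>X. tensor_rel A \<Lambda>' ``
        {\<Sum>u\<in>Poly_Mapping.keys f.
           Poly_Mapping.single (\<lambda>x\<in>\<Lambda>'. if x \<in> \<Lambda> then u x else \<one>\<^bsub>A x\<^esub>) (Poly_Mapping.lookup f u)})"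

text \<open>\<open>\<AA>\<close> is the C*-inductive limit of the local algebras, equipped with their C*-norms \<open>\<nu> \<Lambda>\<close>, along
  the insertions of units.\<close>

locale spin_algebra =
  fixes A :: "int \<Rightarrow> 'b cstar"
    and \<xi> :: "int \<Rightarrow> 'b \<Rightarrow> complex^2^2"
    and \<nu> :: "int set \<Rightarrow> 'b formal set \<Rightarrow> real"
    and \<AA> :: "'a cstar"
    and \<phi> :: "int set \<Rightarrow> 'b formal set \<Rightarrow> 'a"
  assumes site_algebra: "unital_cstar_algebra (A x)"
    and site_iso: "star_iso (A x) mat2_complex (\<xi> x)"
    and local_algebra:
      "\<lbrakk>finite \<Lambda>; \<Lambda> \<noteq> {}\<rbrakk> \<Longrightarrow> unital_cstar_algebra (tensor_algebra A \<Lambda> (\<nu> \<Lambda>))"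
    and limit_algebra: "unital_cstar_algebra \<AA>"
    and local_subalgebra:
      "\<lbrakk>finite \<Lambda>; \<Lambda> \<noteq> {}\<rbrakk> \<Longrightarrow>
         unital_cstar_subalgebra \<AA> (\<phi> \<Lambda> ` carrier (tensor_algebra A \<Lambda> (\<nu> \<Lambda>)))"
    and local_iso:
      "\<lbrakk>finite \<Lambda>; \<Lambda> \<noteq> {}\<rbrakk> \<Longrightarrow>
         star_iso (tensor_algebra A \<Lambda> (\<nu> \<Lambda>))
           (\<AA>\<lparr>carrier := \<phi> \<Lambda> ` carrier (tensor_algebra A \<Lambda> (\<nu> \<Lambda>))\<rparr>) (\<phi> \<Lambda>)"
    and local_compatible:
      "\<lbrakk>finite \<Lambda>'; \<Lambda> \<noteq> {}; \<Lambda> \<subseteq> \<Lambda>'; X \<in> carrier (tensor_algebra A \<Lambda> (\<nu> \<Lambda>))\<rbrakk> \<Longrightarrow>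
         \<phi> \<Lambda>' (tensor_insertion A \<Lambda>' \<Lambda> X) = \<phi> \<Lambda> X"
    and local_dense:
      "norm_topology \<AA> closure_of
         (\<Union>\<Lambda>\<in>{\<Lambda>. finite \<Lambda> \<and> \<Lambda> \<noteq> {}}. \<phi> \<Lambda> ` carrier (tensor_algebra A \<Lambda> (\<nu> \<Lambda>))) = carrier \<AA>"

definition pauli :: "nat \<Rightarrow> complex^2^2" where
  "pauli \<kappa> =
     (if \<kappa> = 0 then mat 1
      else if \<kappa> = 1 then mk_mat2 0 1 1 0
      else if \<kappa> = 2 then mk_mat2 0 (- \<i>) \<i> 0
      else mk_mat2 1 0 0 (- 1))"

definition pauli_sign :: "nat \<Rightarrow> complex" where
  "pauli_sign \<kappa> = (if \<kappa> = 0 \<or> \<kappa> = 3 then 1 else - 1)"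

definition spin ::
  "(int \<Rightarrow> ('b, 'm) cstar_scheme) \<Rightarrow> (int \<Rightarrow> 'b \<Rightarrow> complex^2^2) \<Rightarrow> (int set \<Rightarrow> 'b formal set \<Rightarrow> 'a) \<Rightarrow>
   nat \<Rightarrow> int \<Rightarrow> 'a" where
  "spin A \<xi> \<phi> \<kappa> x =
     \<phi> {x} (elementary_tensor A {x} (\<lambda>y. inv_into (carrier (A y)) (\<xi> y) (pauli \<kappa>)))"

definition spin_minus :: "('a, 'm) cstar_scheme \<Rightarrow> (nat \<Rightarrow> int \<Rightarrow> 'a) \<Rightarrow> int \<Rightarrow> 'a" where
  "spin_minus \<AA> \<sigma> x = (1/2) \<odot>\<^bsub>\<AA>\<^esub> (\<sigma> 1 x \<ominus>\<^bsub>\<AA>\<^esub> \<i> \<odot>\<^bsub>\<AA>\<^esub> \<sigma> 2 x)"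

definition spin_string :: "('a, 'm) cstar_scheme \<Rightarrow> (nat \<Rightarrow> int \<Rightarrow> 'a) \<Rightarrow> int \<Rightarrow> 'a" where
  "spin_string \<AA> \<sigma> x =
     foldr (\<lambda>y s. \<sigma> 3 y \<otimes>\<^bsub>\<AA>\<^esub> s) (if 1 \<le> x then [1..x - 1] else [x..0]) \<one>\<^bsub>\<AA>\<^esub>"

definition ext_algebra ::
  "('a, 'm) cstar_scheme \<Rightarrow> ('a^2^2 \<Rightarrow> real) \<Rightarrow> ('a \<Rightarrow> 'a) \<Rightarrow> ('a^2^2) cstar" where
  "ext_algebra \<AA> N \<Theta>' =
     (mat2_algebra \<AA> N)
       \<lparr>carrier := {mk_mat2 a b (\<Theta>' b) (\<Theta>' a) | a b. a \<in> carrier \<AA> \<and> b \<in> carrier \<AA>}\<rparr>"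

definition ext_embed :: "('a, 'm) cstar_scheme \<Rightarrow> ('a \<Rightarrow> 'a) \<Rightarrow> 'a \<Rightarrow> 'a^2^2" where
  "ext_embed \<AA> \<Theta>' a = mk_mat2 a \<zero>\<^bsub>\<AA>\<^esub> \<zero>\<^bsub>\<AA>\<^esub> (\<Theta>' a)"

definition ext_flip :: "('a, 'm) cstar_scheme \<Rightarrow> 'a^2^2" where
  "ext_flip \<AA> = mk_mat2 \<zero>\<^bsub>\<AA>\<^esub> \<one>\<^bsub>\<AA>\<^esub> \<one>\<^bsub>\<AA>\<^esub> \<zero>\<^bsub>\<AA>\<^esub>"

definition diag_part :: "('a, 'm) cstar_scheme \<Rightarrow> ('a \<Rightarrow> 'a) \<Rightarrow> ('a^2^2) set" where
  "diag_part \<AA> \<Theta>' = {mk_mat2 a \<zero>\<^bsub>\<AA>\<^esub> \<zero>\<^bsub>\<AA>\<^esub> (\<Theta>' a) | a. a \<in> carrier \<AA>}"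

definition annihilator ::
  "('a, 'm) cstar_scheme \<Rightarrow> ('a^2^2 \<Rightarrow> real) \<Rightarrow> ('a \<Rightarrow> 'a) \<Rightarrow> (nat \<Rightarrow> int \<Rightarrow> 'a) \<Rightarrow> int \<Rightarrow> 'a^2^2" where
  "annihilator \<AA> N \<Theta>' \<sigma> x =
     ext_flip \<AA> \<otimes>\<^bsub>ext_algebra \<AA> N \<Theta>'\<^esub>
       ext_embed \<AA> \<Theta>' (spin_string \<AA> \<sigma> x \<otimes>\<^bsub>\<AA>\<^esub> spin_minus \<AA> \<sigma> x)"

definition car_part ::
  "('a, 'm) cstar_scheme \<Rightarrow> ('a^2^2 \<Rightarrow> real) \<Rightarrow> ('a \<Rightarrow> 'a) \<Rightarrow> (nat \<Rightarrow> int \<Rightarrow> 'a) \<Rightarrow> ('a^2^2) set" where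
  "car_part \<AA> N \<Theta>' \<sigma> =
     cstar_generated (ext_algebra \<AA> N \<Theta>') (range (annihilator \<AA> N \<Theta>' \<sigma>))"

definition even_part ::
  "('a \<Rightarrow> 'a) \<Rightarrow> 'a set \<Rightarrow> 'a set" where
  "even_part \<theta> V = {X \<in> V. \<theta> X = X}"

definition odd_part ::
  "('a, 'm) star_algebra_scheme \<Rightarrow> ('a \<Rightarrow> 'a) \<Rightarrow> 'a set \<Rightarrow> 'a set" where
  "odd_part A \<theta> V = {X \<in> V. \<theta> X = \<ominus>\<^bsub>A\<^esub> X}"

definition closed_linear_star_invariant :: "('a, 'm) cstar_scheme \<Rightarrow> 'a set \<Rightarrow> bool" where
  "closed_linear_star_invariant A V \<longleftrightarrow>
     (\<forall>X\<in>V. \<forall>Y\<in>V. X \<oplus>\<^bsub>A\<^esub> Y \<in> V) \<and>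
     (\<forall>c. \<forall>X\<in>V. c \<odot>\<^bsub>A\<^esub> X \<in> V) \<and>
     (\<forall>X\<in>V. star A X \<in> V) \<and>
     closedin (norm_topology A) V"

definition right_translate :: "('a, 'm) star_algebra_scheme \<Rightarrow> 'a set \<Rightarrow> 'a \<Rightarrow> 'a set" where
  "right_translate A V t = (\<lambda>X. X \<otimes>\<^bsub>A\<^esub> t) ` V"

definition extends_theta ::
  "('a, 'm) cstar_scheme \<Rightarrow> ('a^2^2 \<Rightarrow> real) \<Rightarrow> ('a \<Rightarrow> 'a) \<Rightarrow> ('a \<Rightarrow> 'a) \<Rightarrow> ('a^2^2 \<Rightarrow> 'a^2^2) \<Rightarrow> bool" where
  "extends_theta \<AA> N \<Theta> \<Theta>' \<theta> \<longleftrightarrow>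
     star_automorphism (ext_algebra \<AA> N \<Theta>') \<theta> \<and>
     (\<forall>a\<in>carrier \<AA>. \<theta> (ext_embed \<AA> \<Theta>' a) = ext_embed \<AA> \<Theta>' (\<Theta> a)) \<and>
     \<theta> (ext_flip \<AA>) = ext_flip \<AA>"

end

theory Submission
  imports Defs
begin

text \<open>The analytic input is that *-homomorphisms of C*-algebras are contractive: a self-adjoint
  element of norm less than 1 is the mean of a unitary and its adjoint. Hence subalgebras that are
  cut out by equations between *-homomorphisms are closed, and two *-homomorphisms on \<open>\<AA>\<close> that agree
  on the spins are equal. In particular \<open>\<Theta>\<close> and \<open>\<Theta>'\<close> are commuting involutions, so \<open>\<Theta>\<close> extends to
  the elements \<open>\<psi>(a) + \<psi>(b) T\<close> coefficientwise.

  Let \<open>K\<close> consist of the elements \<open>\<psi>(a) + \<psi>(b) T\<close> with \<open>a\<close> even and \<open>b\<close> odd. It is a C*-subalgebra and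
  contains the \<open>a\<^sub>x\<close>, so it contains \<open>H1\<close>. Since \<open>T\<close> normalizes \<open>H1\<close>, the sum \<open>H1 + H1 T\<close> is an algebra;
  it is closed since its two summands are separated by the projections onto \<open>K\<close> and \<open>K T\<close>. The
  operators \<open>a\<^sub>x* a\<^sub>x\<close> give \<open>\<psi>(\<sigma>\<^sub>3)\<close>, hence the strings and finally \<open>\<psi>(\<sigma>\<^sub>-)\<close> in \<open>H1 + H1 T\<close>, which is
  therefore everything. Comparing with \<open>K \<oplus> K T\<close> gives \<open>H1 = K\<close>, and all claims can be read off.\<close>

section \<open>Norm-continuity of homomorphisms of C*-algebras\<close>

text \<open>The norm on the matrix algebra is known only through the C*-axioms, so closedness is
  never read off a formula for it: apart from \<open>H1\<close> itself, the closed sets needed in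
  the extension appear as equalizers or preimages under maps built from *-homomorphisms. The
  obstacle is \<open>H1 + H1 T\<close>, since a sum of two closed subspaces need not be closed. The
  way around it is the automorphism \<open>\<alpha>\<close> sending \<psi>(b) + \<psi>(c) T to
  \<psi>(\<Theta> b) - \<psi>(\<Theta> c) T. It fixes every annihilator and negates T, so it is 1 on
  \<open>H1\<close> and -1 on \<open>H1 T\<close>, and half of X + \<alpha> X and half of X -
  \<alpha> X recover the two summands continuously. The same map settles the comparison with K, its
  fixed point algebra: an element fixed by \<open>\<alpha>\<close> has no component in
  \<open>H1 T\<close>.\<close>

context unital_cstar_algebra
begin

text \<open>The ring of scalars shadows the unqualified names of the ring laws of the algebra.\<close>

lemma algebra_ring: "ring A" ..

lemmas alg_a_ac = ring.ring_simprules(7,10,22)[OF algebra_ring]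
  and alg_m_assoc = ring.ring_simprules(11)[OF algebra_ring]
  and alg_distr = ring.ring_simprules(13,23)[OF algebra_ring]
  and alg_minus = ring.ring_simprules(19,20,26,27)[OF algebra_ring]
  and alg_neg = ring.ring_simprules(9,16)[OF algebra_ring]
  and alg_minus_equality = abelian_group.minus_equality[OF ring.is_abelian_group[OF algebra_ring]]

lemma smult_in_carrier [simp, intro]: "x \<in> carrier A \<Longrightarrow> c \<odot> x \<in> carrier A"
  using smult_closed by (simp add: complex_ring_def)

lemma smult_add_left: "x \<in> carrier A \<Longrightarrow> (c + d) \<odot> x = c \<odot> x \<oplus> d \<odot> x"
  using smult_l_distr[of c d x] by (simp add: complex_ring_def)

lemma smult_add_right: "\<lbrakk>x \<in> carrier A; y \<in> carrier A\<rbrakk> \<Longrightarrow> c \<odot> (x \<oplus> y) = c \<odot> x \<oplus> c \<odot> y"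
  using smult_r_distr[of c x y] by (simp add: complex_ring_def)

lemma smult_smult: "x \<in> carrier A \<Longrightarrow> c \<odot> (d \<odot> x) = (c * d) \<odot> x"
  using smult_assoc1[of c d x] by (simp add: complex_ring_def)

lemma smult_1 [simp]: "x \<in> carrier A \<Longrightarrow> 1 \<odot> x = x"
  using smult_one[of x] by (simp add: complex_ring_def)

lemma smult_0 [simp]: "x \<in> carrier A \<Longrightarrow> 0 \<odot> x = \<zero>"
  using smult_l_null[of x] by (simp add: complex_ring_def)

lemma smult_zero [simp]: "c \<odot> \<zero> = \<zero>"
  using smult_r_null[of c] by (simp add: complex_ring_def)

lemma minus_eq_smult:
  assumes "x \<in> carrier A"
  shows "\<ominus> x = (-1) \<odot> x"
proof (rule alg_minus_equality)
  show "(-1) \<odot> x \<oplus> x = \<zero>"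
    using smult_add_left[of x "-1" 1] assms by simp
qed (use assms in auto)

lemma lincomb_add:
  "\<lbrakk>x \<in> carrier A; y \<in> carrier A\<rbrakk> \<Longrightarrow>
    (a \<odot> x \<oplus> b \<odot> y) \<oplus> (c \<odot> x \<oplus> d \<odot> y) = (a + c) \<odot> x \<oplus> (b + d) \<odot> y"
  by (simp add: smult_add_left alg_a_ac)

lemma smult_minus_right: "x \<in> carrier A \<Longrightarrow> c \<odot> (\<ominus> x) = \<ominus> (c \<odot> x)"
  by (simp add: minus_eq_smult smult_smult)

lemma half_double: "x \<in> carrier A \<Longrightarrow> (1/2) \<odot> (x \<oplus> x) = x"
  using smult_add_left[of x "1/2" "1/2"] by (simp add: smult_add_right)

text \<open>The scalar 1/2 forces this. It is the reason why an element that is both even and odd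
  vanishes, hence why the sums below are direct.\<close>

lemma eq_minus_self_iff:
  assumes "x \<in> carrier A"
  shows "x = \<ominus> x \<longleftrightarrow> x = \<zero>"
proof
  assume "x = \<ominus> x"
  then have "x \<oplus> x = \<zero>"
    using alg_neg(2)[OF assms] by simp
  then show "x = \<zero>"
    using half_double[OF assms] by simp
qed (simp add: alg_minus)

lemma star_zero [simp]: "star A \<zero> = \<zero>"
  using star_smult[of \<zero> 0] star_closed[of \<zero>] by simp

lemma star_minus: "x \<in> carrier A \<Longrightarrow> star A (\<ominus> x) = \<ominus> star A x"
  by (simp add: minus_eq_smult star_smult star_closed)

lemma star_diff: "\<lbrakk>x \<in> carrier A; y \<in> carrier A\<rbrakk> \<Longrightarrow> star A (x \<ominus> y) = star A x \<ominus> star A y"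
  by (simp add: a_minus_def star_add star_minus)

lemma star_one [simp]: "star A \<one> = \<one>"
  using star_mult[of "star A \<one>" \<one>] by (simp add: star_closed star_star)

lemma cnorm_zero [simp]: "cnorm A \<zero> = 0"
  using cnorm_eq_zero by blast

lemma cnorm_uminus [simp]: "x \<in> carrier A \<Longrightarrow> cnorm A (\<ominus> x) = cnorm A x"
  by (simp add: minus_eq_smult cnorm_smult)

lemma cnorm_diff_le: "\<lbrakk>x \<in> carrier A; y \<in> carrier A\<rbrakk> \<Longrightarrow> cnorm A (x \<ominus> y) \<le> cnorm A x + cnorm A y"
  using cnorm_triangle[of x "\<ominus> y"] by (simp add: a_minus_def)

text \<open>The C*-identity and submultiplicativity bound the square of the norm of \<open>x\<close>
  by the product of the norms of \<open>star A x\<close> and \<open>x\<close>. Applied to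
  \<open>x\<close> and to its adjoint this makes the involution isometric.\<close>

lemma cnorm_le_cnorm_star:
  assumes "x \<in> carrier A"
  shows "cnorm A x \<le> cnorm A (star A x)"
proof (cases "cnorm A x = 0")
  case False
  have "cnorm A x * cnorm A x \<le> cnorm A (star A x) * cnorm A x"
    using cnorm_star_mult[OF assms] cnorm_mult[of "star A x" x] assms star_closed
    by (simp add: power2_eq_square)
  then show ?thesis
    using False cnorm_nonneg[OF assms] by (simp add: mult_le_cancel_right)
qed (use assms cnorm_nonneg star_closed in auto)

lemma cnorm_star [simp]: "x \<in> carrier A \<Longrightarrow> cnorm A (star A x) = cnorm A x"
  using cnorm_le_cnorm_star[of x] cnorm_le_cnorm_star[of "star A x"]
  by (simp add: star_closed star_star)

text \<open>By the C*-identity the norm of \<open>p\<close> equals its own square. The bound serves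
  for the image of the unit under a *-homomorphism, which is only a projection because
  \<open>star_hom\<close> does not include unitality.\<close>

lemma cnorm_projection_le_1:
  assumes "p \<in> carrier A" "star A p \<otimes> p = p"
  shows "cnorm A p \<le> 1"
  using cnorm_star_mult[OF assms(1)] assms(2) by (auto simp: power2_eq_square)

lemma Metric_space_cdist: "Metric_space (carrier A) (cdist A)"
proof
  show "0 \<le> cdist A x y" for x y
    by (simp add: cdist_def cnorm_nonneg)
  show "cdist A x y = cdist A y x" for x y
  proof (cases "x \<in> carrier A \<and> y \<in> carrier A")
    case True
    then have "y \<ominus> x = \<ominus> (x \<ominus> y)"
      by (simp add: a_minus_def alg_minus alg_a_ac)
    with True show ?thesis
      by (simp add: cdist_def)
  qed (auto simp: cdist_def)
  show "cdist A x y = 0 \<longleftrightarrow> x = y" if "x \<in> carrier A" "y \<in> carrier A" for x y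
  proof -
    have "x = (x \<ominus> y) \<oplus> y" "x \<ominus> x = \<zero>"
      using that by algebra+
    then have "x \<ominus> y = \<zero> \<longleftrightarrow> x = y"
      using that by auto
    then show ?thesis
      using that by (simp add: cdist_def cnorm_eq_zero)
  qed
  show "cdist A x z \<le> cdist A x y + cdist A y z"
    if "x \<in> carrier A" "y \<in> carrier A" "z \<in> carrier A" for x y z
  proof -
    have "x \<ominus> z = (x \<ominus> y) \<oplus> (y \<ominus> z)"
      using that by algebra
    then show ?thesis
      using that cnorm_triangle[of "x \<ominus> y" "y \<ominus> z"] by (simp add: cdist_def)
  qed
qed

sublocale metric: Metric_space "carrier A" "cdist A"
  by (rule Metric_space_cdist)

lemma norm_topology_eq: "norm_topology A = metric.mtopology"
  by (simp add: norm_topology_def)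

lemma topspace_norm_topology [simp]: "topspace (norm_topology A) = carrier A"
  by (simp add: norm_topology_eq)

lemma Hausdorff_norm_topology: "Hausdorff_space (norm_topology A)"
  by (simp add: norm_topology_eq metric.Hausdorff_space_mtopology)

end

text \<open>Only differences and a bound enter, so that the criterion also covers maps that are not
  *-homomorphisms: the conjugate-linear involution, negation, multiplication by a fixed element, and
  \<open>X \<mapsto> X \<plusminus> \<alpha> X\<close>.\<close>

lemma additive_bounded_continuous:
  assumes "unital_cstar_algebra A" "unital_cstar_algebra B"
    and f: "f \<in> carrier A \<rightarrow> carrier B"
    and diff: "\<And>x y. \<lbrakk>x \<in> carrier A; y \<in> carrier A\<rbrakk> \<Longrightarrow> f (x \<ominus>\<^bsub>A\<^esub> y) = f x \<ominus>\<^bsub>B\<^esub> f y"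
    and bound: "\<And>x. x \<in> carrier A \<Longrightarrow> cnorm B (f x) \<le> C * cnorm A x"
  shows "continuous_map (norm_topology A) (norm_topology B) f"
proof -
  interpret A: unital_cstar_algebra A by fact
  interpret B: unital_cstar_algebra B by fact
  have *: "cdist B (f x) (f y) \<le> C * cdist A x y" if "x \<in> carrier A" "y \<in> carrier A" for x y
    using that f bound[of "x \<ominus>\<^bsub>A\<^esub> y"] by (auto simp: cdist_def diff Pi_iff)
  have "Lipschitz_continuous_map (metric (carrier A, cdist A)) (metric (carrier B, cdist B)) f"
    unfolding Lipschitz_continuous_map_def using f * by auto
  then show ?thesis
    using Lipschitz_continuous_imp_continuous_map
    by (fastforce simp: A.norm_topology_eq B.norm_topology_eq)
qed

context unital_cstar_algebra
begin

lemma continuous_map_star: "continuous_map (norm_topology A) (norm_topology A) (star A)"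
  by (rule additive_bounded_continuous[where C = 1])
    (auto simp: unital_cstar_algebra_axioms star_closed star_diff)

lemma continuous_map_mult_left:
  assumes "a \<in> carrier A"
  shows "continuous_map (norm_topology A) (norm_topology A) (\<lambda>x. a \<otimes> x)"
proof (rule additive_bounded_continuous[where C = "cnorm A a"])
  show "a \<otimes> (x \<ominus> y) = a \<otimes> x \<ominus> a \<otimes> y" if "x \<in> carrier A" "y \<in> carrier A" for x y
    using that assms by algebra
qed (use assms in \<open>auto simp: unital_cstar_algebra_axioms cnorm_mult\<close>)

lemma continuous_map_mult_right:
  assumes "a \<in> carrier A"
  shows "continuous_map (norm_topology A) (norm_topology A) (\<lambda>x. x \<otimes> a)"
proof (rule additive_bounded_continuous[where C = "cnorm A a"])
  show "(x \<ominus> y) \<otimes> a = x \<otimes> a \<ominus> y \<otimes> a" if "x \<in> carrier A" "y \<in> carrier A" for x y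
    using that assms by algebra
qed (use assms in \<open>auto simp: unital_cstar_algebra_axioms cnorm_mult mult.commute[of "cnorm A a"]\<close>)

lemma continuous_map_uminus: "continuous_map (norm_topology A) (norm_topology A) (\<lambda>x. \<ominus> x)"
proof (rule additive_bounded_continuous[where C = 1])
  show "\<ominus> (x \<ominus> y) = \<ominus> x \<ominus> (\<ominus> y)" if "x \<in> carrier A" "y \<in> carrier A" for x y
    using that by algebra
qed (auto simp: unital_cstar_algebra_axioms)

lemma closedin_equalizer:
  assumes "continuous_map X (norm_topology A) f" "continuous_map X (norm_topology A) g"
  shows "closedin X {x \<in> topspace X. f x = g x}"
  using closedin_continuous_maps_eq[OF Hausdorff_norm_topology assms] .

end

section \<open>Self-adjoint elements of norm below 1 as means of isometries and their
  adjoints\<close>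

context unital_cstar_algebra
begin
text \<open>With $y = \sqrt{1 - h^2}$ the element $h + iy$ is unitary. Writing $y = 1 - z$, the element $z$
  is a fixed point of the contraction $z \mapsto \frac12(h^2 + z^2)$ on a small ball.\<close>

lemma self_adjoint_half_sum_isometry:
  assumes h: "h \<in> carrier A" "star A h = h" "cnorm A h < 1"
  obtains u where "u \<in> carrier A" "star A u \<otimes> u = \<one>" "h = (1/2) \<odot> (u \<oplus> star A u)"
proof -
  define w where "w = h \<otimes> h"
  define t where "t = cnorm A w"
  \<comment> \<open>\<open>r\<close> is the smaller root of \<open>r = (t + r * r) / 2\<close>: with
    this radius the norm estimate sends the ball into itself, and \<open>r < 1\<close> serves as the
    Lipschitz constant on it.\<close>
  define r where "r = 1 - sqrt (1 - t)"
  have w: "w \<in> carrier A" "star A w = w" "h \<otimes> w = w \<otimes> h"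
    using h by (auto simp: w_def star_mult alg_m_assoc)
  have "t = (cnorm A h)\<^sup>2"
    using cnorm_star_mult[of h] h by (simp add: t_def w_def)
  then have t: "0 \<le> t" "t < 1"
    using h cnorm_nonneg[of h] by (auto simp: power_less_one_iff abs_square_less_1)
  then have r: "0 \<le> r" "r < 1"
    by (auto simp: r_def)
  have rt: "(t + r * r) / 2 = r"
    using t by (simp add: r_def field_simps)
  \<comment> \<open>Self-adjointness and commutation with \<open>h\<close> are closed conditions
    preserved by the iteration. Putting them into the domain hands them to the fixed point, where
    they make \<open>h + i y\<close> an isometry.\<close>
  define S where "S = {z \<in> carrier A. star A z = z} \<inter> {z \<in> carrier A. h \<otimes> z = z \<otimes> h}
    \<inter> metric.mcball \<zero> r"
  have S_iff: "z \<in> S \<longleftrightarrow> z \<in> carrier A \<and> star A z = z \<and> h \<otimes> z = z \<otimes> h \<and> cnorm A z \<le> r" for z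
    by (auto simp: S_def cdist_def a_minus_def)
  have closed: "closedin (norm_topology A) S"
    unfolding S_def norm_topology_eq[symmetric]
  proof (intro closedin_Int)
    show "closedin (norm_topology A) {z \<in> carrier A. star A z = z}"
      using closedin_equalizer[OF continuous_map_star, of id] by simp
    show "closedin (norm_topology A) {z \<in> carrier A. h \<otimes> z = z \<otimes> h}"
      using closedin_equalizer[OF continuous_map_mult_left continuous_map_mult_right, of h h] h
      by simp
    show "closedin (norm_topology A) (metric.mcball \<zero> r)"
      by (simp add: norm_topology_eq metric.closedin_mcball)
  qed
  interpret S: Submetric "carrier A" "cdist A" S
    by unfold_locales (auto simp: S_iff)
  have "S.sub.mcomplete"
    using closed S.closedin_mcomplete_imp_mcomplete complete by (simp add: norm_topology_eq)
  moreover have "S \<noteq> {}"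
    using S_iff[of \<zero>] h r by auto
  moreover define f where "f = (\<lambda>z. (1/2) \<odot> (w \<oplus> z \<otimes> z))"
  have "f \<in> S \<rightarrow> S"
  proof
    fix z assume "z \<in> S"
    then have z: "z \<in> carrier A" "star A z = z" "h \<otimes> z = z \<otimes> h" "cnorm A z \<le> r"
      by (auto simp: S_iff)
    have hzz: "h \<otimes> (z \<otimes> z) = z \<otimes> z \<otimes> h"
      using h z by (metis alg_m_assoc)
    have "cnorm A (z \<otimes> z) \<le> r * r"
      using z r cnorm_mult[of z z] cnorm_nonneg[of z] mult_mono[of "cnorm A z" r "cnorm A z" r]
      by auto
    then have "cnorm A (w \<oplus> z \<otimes> z) \<le> t + r * r"
      using cnorm_triangle[of w "z \<otimes> z"] w z by (simp add: t_def)
    then have "cnorm A (f z) \<le> r"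
      using w z rt by (simp add: f_def cnorm_smult)
    moreover have "h \<otimes> f z = f z \<otimes> h"
      using w z h hzz by (simp add: f_def smult_mult_left smult_mult_right alg_distr)
    moreover have "star A (f z) = f z"
      using w z h by (simp add: f_def star_smult star_add star_mult)
    ultimately show "f z \<in> S"
      using w z by (simp add: S_iff f_def)
  qed
  moreover have "cdist A (f z) (f z') \<le> r * cdist A z z'" if "z \<in> S" "z' \<in> S" for z z'
  proof -
    have z: "z \<in> carrier A" "cnorm A z \<le> r" "z' \<in> carrier A" "cnorm A z' \<le> r"
      using that by (auto simp: S_iff)
    define e where "e = z \<ominus> z'"
    have e: "e \<in> carrier A"
      using z by (simp add: e_def)
    have "f z \<ominus> f z' = (1/2) \<odot> ((w \<oplus> z \<otimes> z) \<ominus> (w \<oplus> z' \<otimes> z'))"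
      using z w by (simp add: f_def a_minus_def smult_add_right[of _ "\<ominus> _"] smult_minus_right)
    \<comment> \<open>\<open>z\<close> and \<open>z'\<close> need not commute, so the difference of
      squares is split as \<open>z \<otimes> e \<oplus> e \<otimes> z'\<close>.\<close>
    also have "(w \<oplus> z \<otimes> z) \<ominus> (w \<oplus> z' \<otimes> z') = z \<otimes> e \<oplus> e \<otimes> z'"
      using z w unfolding e_def by algebra
    finally have "cnorm A (f z \<ominus> f z') = cnorm A (z \<otimes> e \<oplus> e \<otimes> z') / 2"
      using z e by (simp add: cnorm_smult)
    also have "\<dots> \<le> (cnorm A z * cnorm A e + cnorm A e * cnorm A z') / 2"
      using z e cnorm_triangle[of "z \<otimes> e" "e \<otimes> z'"] cnorm_mult[of z e] cnorm_mult[of e z']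
      by simp
    also have "\<dots> \<le> r * cnorm A e"
      using z e cnorm_nonneg[of e] mult_right_mono[of "cnorm A z" r "cnorm A e"]
        mult_left_mono[of "cnorm A z'" r "cnorm A e"] by (simp add: mult.commute)
    finally show ?thesis
      using z w by (simp add: cdist_def e_def f_def)
  qed
  ultimately obtain z where z: "z \<in> S" "f z = z"
    using S.sub.Banach_fixedpoint_thm r(2) by metis
  then have z': "z \<in> carrier A" "star A z = z" "h \<otimes> z = z \<otimes> h"
    by (auto simp: S_iff)
  have "z \<oplus> z = f z \<oplus> f z"
    using z by simp
  also have "\<dots> = w \<oplus> z \<otimes> z"
    unfolding f_def using smult_add_left[of "w \<oplus> z \<otimes> z" "1/2" "1/2"] w z' by simp
  finally have zz: "z \<oplus> z = w \<oplus> z \<otimes> z" .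
  define y where "y = \<one> \<ominus> z"
  have y: "y \<in> carrier A" "star A y = y"
    using z' by (auto simp: y_def star_diff)
  have hy: "h \<otimes> y = y \<otimes> h"
    unfolding y_def a_minus_def using h z' by (simp add: alg_distr alg_minus)
  have "y \<otimes> y = \<one> \<ominus> (z \<oplus> z) \<oplus> z \<otimes> z"
    unfolding y_def a_minus_def using z' by (simp add: alg_distr alg_minus alg_a_ac)
  also have "\<dots> = \<one> \<ominus> w"
    unfolding zz using w z' by algebra
  finally have yy: "h \<otimes> h \<oplus> y \<otimes> y = \<one>"
    unfolding w_def using h by algebra
  define u where "u = h \<oplus> \<i> \<odot> y"
  have su: "star A u = h \<oplus> (-\<i>) \<odot> y"
    using h y by (simp add: u_def star_add star_smult)
  show thesis
  proof
    show u: "u \<in> carrier A"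
      using h y by (simp add: u_def)
    have "star A u \<otimes> u = (h \<oplus> (-\<i>) \<odot> y) \<otimes> (h \<oplus> \<i> \<odot> y)"
      by (simp only: su) (simp only: u_def)
    also have "\<dots> = (h \<otimes> h \<oplus> y \<otimes> y) \<oplus> (\<i> \<odot> (y \<otimes> h) \<oplus> (-\<i>) \<odot> (y \<otimes> h))"
      using h y
      by (simp add: alg_distr smult_mult_left smult_mult_right smult_smult smult_add_right hy alg_a_ac)
    finally show "star A u \<otimes> u = \<one>"
      using smult_add_left[of "y \<otimes> h" \<i> "-\<i>"] h y yy by simp
    have "u \<oplus> star A u = (1 \<odot> h \<oplus> \<i> \<odot> y) \<oplus> (1 \<odot> h \<oplus> (-\<i>) \<odot> y)"
      by (simp only: su) (simp add: u_def h(1))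
    then show "h = (1/2) \<odot> (u \<oplus> star A u)"
      using h y by (simp only: lincomb_add) (simp add: smult_smult)
  qed
qed

end

section \<open>Contractivity and continuity of *-homomorphisms\<close>

lemma star_homD:
  assumes "star_hom A B f"
  shows "x \<in> carrier A \<Longrightarrow> f x \<in> carrier B"
    and "\<lbrakk>x \<in> carrier A; y \<in> carrier A\<rbrakk> \<Longrightarrow> f (x \<oplus>\<^bsub>A\<^esub> y) = f x \<oplus>\<^bsub>B\<^esub> f y"
    and "x \<in> carrier A \<Longrightarrow> f (c \<odot>\<^bsub>A\<^esub> x) = c \<odot>\<^bsub>B\<^esub> f x"
    and "\<lbrakk>x \<in> carrier A; y \<in> carrier A\<rbrakk> \<Longrightarrow> f (x \<otimes>\<^bsub>A\<^esub> y) = f x \<otimes>\<^bsub>B\<^esub> f y"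
    and "x \<in> carrier A \<Longrightarrow> f (star A x) = star B (f x)"
  using assms by (auto simp: star_hom_def)

lemma star_hom_minus:
  assumes "unital_cstar_algebra A" "unital_cstar_algebra B" "star_hom A B f"
  shows "x \<in> carrier A \<Longrightarrow> f (\<ominus>\<^bsub>A\<^esub> x) = \<ominus>\<^bsub>B\<^esub> f x"
    and "\<lbrakk>x \<in> carrier A; y \<in> carrier A\<rbrakk> \<Longrightarrow> f (x \<ominus>\<^bsub>A\<^esub> y) = f x \<ominus>\<^bsub>B\<^esub> f y"
    and "f \<zero>\<^bsub>A\<^esub> = \<zero>\<^bsub>B\<^esub>"
proof -
  interpret A: unital_cstar_algebra A by fact
  interpret B: unital_cstar_algebra B by fact
  note f = star_homD[OF assms(3)]
  show *: "f (\<ominus>\<^bsub>A\<^esub> x) = \<ominus>\<^bsub>B\<^esub> f x" if "x \<in> carrier A" for x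
    using that by (simp add: A.minus_eq_smult B.minus_eq_smult f)
  show "f (x \<ominus>\<^bsub>A\<^esub> y) = f x \<ominus>\<^bsub>B\<^esub> f y" if "x \<in> carrier A" "y \<in> carrier A" for x y
    using that by (simp add: a_minus_def * f)
  show "f \<zero>\<^bsub>A\<^esub> = \<zero>\<^bsub>B\<^esub>"
    using f(3)[of "\<zero>\<^bsub>A\<^esub>" 0] f(1)[of "\<zero>\<^bsub>A\<^esub>"] by simp
qed

text \<open>A self-adjoint element of norm below 1 goes to the mean of two elements of norm at most
  1; scaling gives all self-adjoint elements, and the C*-identity at
  \<open>star A x \<otimes> x\<close> gives the rest. This takes the place of the usual comparison
  of spectral radii.\<close>

theorem star_hom_contractive:
  assumes "unital_cstar_algebra A" "unital_cstar_algebra B" "star_hom A B f" "x \<in> carrier A"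
  shows "cnorm B (f x) \<le> cnorm A x"
proof -
  interpret A: unital_cstar_algebra A by fact
  interpret B: unital_cstar_algebra B by fact
  note f = star_homD[OF assms(3)]
  have unit_ball: "cnorm B (f h) \<le> 1" if h: "h \<in> carrier A" "star A h = h" "cnorm A h < 1" for h
  proof -
    obtain u where u: "u \<in> carrier A" "star A u \<otimes>\<^bsub>A\<^esub> u = \<one>\<^bsub>A\<^esub>"
      and hu: "h = (1/2) \<odot>\<^bsub>A\<^esub> (u \<oplus>\<^bsub>A\<^esub> star A u)"
      using A.self_adjoint_half_sum_isometry[OF h] by blast
    \<comment> \<open>\<open>f\<close> need not be unital, but the image of the unit is a
      projection, and \<open>f u\<close> is bounded through it.\<close>
    have "star B (f \<one>\<^bsub>A\<^esub>) \<otimes>\<^bsub>B\<^esub> f \<one>\<^bsub>A\<^esub> = f \<one>\<^bsub>A\<^esub>"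
      using f(4)[of "star A \<one>\<^bsub>A\<^esub>" "\<one>\<^bsub>A\<^esub>"] f(5)[of "\<one>\<^bsub>A\<^esub>"] by simp
    then have "cnorm B (f \<one>\<^bsub>A\<^esub>) \<le> 1"
      by (intro B.cnorm_projection_le_1) (auto simp: f)
    moreover have "(cnorm B (f u))\<^sup>2 = cnorm B (f \<one>\<^bsub>A\<^esub>)"
      using u B.cnorm_star_mult[of "f u"] f(4)[of "star A u" u] f(5)[of u] f(1)[of u]
      by (simp add: A.star_closed)
    ultimately have fu: "cnorm B (f u) \<le> 1"
      by (metis abs_le_D1 abs_square_le_1)
    have "f h = (1/2) \<odot>\<^bsub>B\<^esub> (f u \<oplus>\<^bsub>B\<^esub> star B (f u))"
      unfolding hu using u by (simp add: f A.star_closed)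
    then have "cnorm B (f h) = cnorm B (f u \<oplus>\<^bsub>B\<^esub> star B (f u)) / 2"
      using u by (simp add: f B.star_closed B.cnorm_smult)
    then show ?thesis
      using fu B.cnorm_triangle[of "f u" "star B (f u)"] u by (simp add: f B.star_closed)
  qed
  have self_adjoint: "cnorm B (f h) \<le> cnorm A h" if h: "h \<in> carrier A" "star A h = h" for h
  proof (rule dense_ge)
    \<comment> \<open>The bound is available only for norms strictly below 1, so \<open>h\<close> is
      scaled by every \<open>c\<close> above its norm.\<close>
    fix c assume c: "cnorm A h < c"
    then have "0 < c"
      using A.cnorm_nonneg[OF h(1)] by simp
    then have "cnorm B (f (complex_of_real (1 / c) \<odot>\<^bsub>A\<^esub> h)) \<le> 1"
      using h c by (intro unit_ball) (auto simp: A.star_smult A.cnorm_smult norm_divide)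
    then show "cnorm B (f h) \<le> c"
      using h \<open>0 < c\<close> by (simp add: f B.cnorm_smult norm_divide)
  qed
  have "(cnorm B (f x))\<^sup>2 = cnorm B (f (star A x \<otimes>\<^bsub>A\<^esub> x))"
    using assms(4) by (simp add: f A.star_closed B.cnorm_star_mult)
  also have "\<dots> \<le> (cnorm A x)\<^sup>2"
    using self_adjoint[of "star A x \<otimes>\<^bsub>A\<^esub> x"] assms(4)
    by (simp add: A.star_closed A.star_mult A.star_star A.cnorm_star_mult)
  finally show ?thesis
    using A.cnorm_nonneg[OF assms(4)] by (rule power2_le_imp_le)
qed

corollary star_hom_continuous:
  assumes "unital_cstar_algebra A" "unital_cstar_algebra B" "star_hom A B f"
  shows "continuous_map (norm_topology A) (norm_topology B) f"
  using assms by (intro additive_bounded_continuous[where C = 1])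
    (auto simp: star_hom_minus star_hom_contractive star_homD)

section \<open>C*-subalgebras\<close>

text \<open>The distance \<open>cdist\<close> of an algebra with restricted carrier is 0 off the
  smaller carrier, so it agrees with the ambient distance on that carrier only. Completeness has to
  be carried over from agreement there.\<close>

lemma mcomplete_cong:
  assumes "Metric_space M d" "Metric_space M d'" "\<And>x y. \<lbrakk>x \<in> M; y \<in> M\<rbrakk> \<Longrightarrow> d x y = d' x y"
    and complete: "Metric_space.mcomplete M d"
  shows "Metric_space.mcomplete M d'"
proof -
  interpret d: Metric_space M d by fact
  interpret d': Metric_space M d' by fact
  have Cauchy: "d'.MCauchy s \<Longrightarrow> d.MCauchy s" for s
    unfolding d.MCauchy_def d'.MCauchy_def by (simp add: assms(3) range_subsetD)
  have "limitin d'.mtopology s l F" if "limitin d.mtopology s l F" for s :: "nat \<Rightarrow> 'a" and l F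
    using that unfolding d.limitin_metric d'.limitin_metric
    by (auto simp: assms(3) elim!: eventually_mono)
  then show ?thesis
    using complete Cauchy unfolding d.mcomplete_def d'.mcomplete_def by blast
qed

context unital_cstar_algebra
begin

lemma cstar_subalgebraI:
  assumes "S \<subseteq> carrier A" "\<zero> \<in> S"
    and "\<And>x y. \<lbrakk>x \<in> S; y \<in> S\<rbrakk> \<Longrightarrow> x \<oplus> y \<in> S"
    and "\<And>c x. x \<in> S \<Longrightarrow> c \<odot> x \<in> S"
    and "\<And>x y. \<lbrakk>x \<in> S; y \<in> S\<rbrakk> \<Longrightarrow> x \<otimes> y \<in> S"
    and "\<And>x. x \<in> S \<Longrightarrow> star A x \<in> S"
    and "closedin (norm_topology A) S"
  shows "cstar_subalgebra A S"
proof -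
  have "\<ominus> x \<in> S" if "x \<in> S" for x
    using that assms(1,4) minus_eq_smult by auto
  then have "submodule S complex_ring A"
    using assms(1-4) by (intro submoduleI) auto
  then show ?thesis
    using assms by (auto simp: cstar_subalgebra_def)
qed

lemma cstar_subalgebraD:
  assumes "cstar_subalgebra A S"
  shows "S \<subseteq> carrier A" "\<zero> \<in> S"
    and "\<lbrakk>x \<in> S; y \<in> S\<rbrakk> \<Longrightarrow> x \<oplus> y \<in> S"
    and "x \<in> S \<Longrightarrow> c \<odot> x \<in> S"
    and "\<lbrakk>x \<in> S; y \<in> S\<rbrakk> \<Longrightarrow> x \<otimes> y \<in> S"
    and "x \<in> S \<Longrightarrow> star A x \<in> S"
    and "closedin (norm_topology A) S"
    and "x \<in> S \<Longrightarrow> \<ominus> x \<in> S"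
    and "\<lbrakk>x \<in> S; y \<in> S\<rbrakk> \<Longrightarrow> x \<ominus> y \<in> S"
proof -
  have S: "submodule S complex_ring A"
    using assms by (simp add: cstar_subalgebra_def)
  note E = submoduleE[OF S]
  show sub: "S \<subseteq> carrier A" and add: "\<lbrakk>x \<in> S; y \<in> S\<rbrakk> \<Longrightarrow> x \<oplus> y \<in> S" for x y
    using E by auto
  show neg: "x \<in> S \<Longrightarrow> \<ominus> x \<in> S" for x
    using E by auto
  show sm: "x \<in> S \<Longrightarrow> c \<odot> x \<in> S" for c x
    using E by (auto simp: complex_ring_def)
  obtain x where "x \<in> S"
    using E by auto
  then show "\<zero> \<in> S"
    using sm[of x 0] sub by auto
  show "\<lbrakk>x \<in> S; y \<in> S\<rbrakk> \<Longrightarrow> x \<ominus> y \<in> S" for x y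
    by (simp add: a_minus_def add neg)
qed (use assms in \<open>auto simp: cstar_subalgebra_def\<close>)

lemma cstar_subalgebra_carrier: "cstar_subalgebra A (carrier A)"
  by (intro cstar_subalgebraI) (auto simp: star_closed closedin_topspace[of "norm_topology A", simplified])

lemma cstar_subalgebra_Inter:
  assumes "\<S> \<noteq> {}" "\<And>S. S \<in> \<S> \<Longrightarrow> cstar_subalgebra A S"
  shows "cstar_subalgebra A (\<Inter>\<S>)"
proof (rule cstar_subalgebraI)
  show "closedin (norm_topology A) (\<Inter>\<S>)"
    using assms cstar_subalgebraD(7) by (intro closedin_Inter) auto
  show "\<Inter>\<S> \<subseteq> carrier A"
    using assms cstar_subalgebraD(1) by fastforce
qed (auto intro: assms(2) cstar_subalgebraD(2-6))

lemma cstar_subalgebra_Int: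
  "\<lbrakk>cstar_subalgebra A S; cstar_subalgebra A S'\<rbrakk> \<Longrightarrow> cstar_subalgebra A (S \<inter> S')"
  using cstar_subalgebra_Inter[of "{S, S'}"] by auto

lemma cstar_generated:
  assumes "X \<subseteq> carrier A"
  shows "cstar_subalgebra A (cstar_generated A X)" "X \<subseteq> cstar_generated A X"
proof -
  have "{S. cstar_subalgebra A S \<and> X \<subseteq> S} \<noteq> {}"
    using cstar_subalgebra_carrier assms by auto
  then show "cstar_subalgebra A (cstar_generated A X)"
    unfolding cstar_generated_def by (rule cstar_subalgebra_Inter) auto
  show "X \<subseteq> cstar_generated A X"
    by (auto simp: cstar_generated_def)
qed

lemma cstar_generated_minimal:
  "\<lbrakk>cstar_subalgebra A S; X \<subseteq> S\<rbrakk> \<Longrightarrow> cstar_generated A X \<subseteq> S"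
  by (auto simp: cstar_generated_def)

theorem unital_cstar_algebra_restrict:
  assumes "unital_cstar_subalgebra A S"
  shows "unital_cstar_algebra (A\<lparr>carrier := S\<rparr>)"
proof -
  have S: "cstar_subalgebra A S" "\<one> \<in> S"
    using assms by (auto simp: unital_cstar_subalgebra_def)
  note D = cstar_subalgebraD[OF S(1)]
  let ?B = "A\<lparr>carrier := S\<rparr>"
  have mod: "Module.module complex_ring ?B"
    using S(1) submodule.submodule_is_module[of S complex_ring A] module_axioms
    by (auto simp: cstar_subalgebra_def)
  interpret B: Module.module complex_ring ?B by fact
  have "ring ?B"
  proof (rule ringI)
    show "abelian_group ?B" ..
    show "monoid ?B"
      by (rule monoidI) (use D S(2) in \<open>auto simp: alg_m_assoc subset_iff\<close>)
  qed (use D in \<open>auto simp: alg_distr subset_iff\<close>)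
  \<comment> \<open>Negation is the inverse in the additive monoid and so depends on the carrier;
    the two negations must be identified before the two distances can be.\<close>
  have uminus: "\<ominus>\<^bsub>?B\<^esub> x = \<ominus> x" if "x \<in> S" for x
  proof -
    have "\<ominus> x \<oplus>\<^bsub>?B\<^esub> x = \<zero>\<^bsub>?B\<^esub>"
      using that D by (auto simp: alg_neg)
    then show ?thesis
      using that D abelian_group.minus_equality[OF ring.is_abelian_group[OF \<open>ring ?B\<close>]] by auto
  qed
  then have cdist_eq: "cdist A x y = cdist ?B x y" if "x \<in> S" "y \<in> S" for x y
    using that D(1) by (auto simp: cdist_def a_minus_def)
  have dist: "Metric_space S (cdist ?B)"
  proof
    show "0 \<le> cdist ?B x y" for x y
      by (cases "x \<in> S \<and> y \<in> S") (auto simp flip: cdist_eq, auto simp: cdist_def)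
    show "cdist ?B x y = cdist ?B y x" for x y
      by (cases "x \<in> S \<and> y \<in> S")
        (auto simp: metric.commute simp flip: cdist_eq, auto simp: cdist_def)
    show "cdist ?B x y = 0 \<longleftrightarrow> x = y" if "x \<in> S" "y \<in> S" for x y
      using that D(1) metric.zero[of x y] by (simp flip: cdist_eq add: subset_iff)
    show "cdist ?B x z \<le> cdist ?B x y + cdist ?B y z" if "x \<in> S" "y \<in> S" "z \<in> S" for x y z
      using that D(1) metric.triangle[of x y z] by (auto simp flip: cdist_eq)
  qed
  interpret S: Submetric "carrier A" "cdist A" S
    using D(1) by unfold_locales
  have "S.sub.mcomplete"
    using D(7) S.closedin_mcomplete_imp_mcomplete complete by (simp add: norm_topology_eq)
  then have "Metric_space.mcomplete S (cdist ?B)"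
    using mcomplete_cong[OF S.sub.Metric_space_axioms dist cdist_eq] by blast
  moreover have sub: "x \<in> carrier A" if "x \<in> S" for x
    using that D(1) by blast
  ultimately show ?thesis
    by (intro unital_cstar_algebra.intro unital_cstar_algebra_axioms.intro \<open>ring ?B\<close> mod)
      (simp_all add: D(3-6) smult_mult_left smult_mult_right star_star star_add star_smult
        star_mult cnorm_nonneg cnorm_eq_zero cnorm_triangle cnorm_smult cnorm_mult cnorm_star_mult)
qed

end

section \<open>Isomorphisms, equalizers and preimages\<close>

lemma star_hom_comp: "\<lbrakk>star_hom A B f; star_hom B C g\<rbrakk> \<Longrightarrow> star_hom A C (g \<circ> f)"
  by (auto simp: star_hom_def Pi_iff)

text \<open>Multiplicativity alone makes the image of the unit an idempotent; multiplying it by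
  \<open>f e\<close>, where \<open>f e\<close> is the unit of \<open>B\<close>, shows that it is
  that unit.\<close>

lemma star_iso_one:
  assumes "monoid A" "monoid B" "star_iso A B f"
  shows "f \<one>\<^bsub>A\<^esub> = \<one>\<^bsub>B\<^esub>"
proof -
  interpret A: monoid A by fact
  interpret B: monoid B by fact
  have f: "star_hom A B f" "f ` carrier A = carrier B"
    using assms(3) by (auto simp: star_iso_def bij_betw_def)
  then obtain e where e: "e \<in> carrier A" "f e = \<one>\<^bsub>B\<^esub>"
    by (metis B.one_closed imageE)
  have "f \<one>\<^bsub>A\<^esub> \<otimes>\<^bsub>B\<^esub> f e = f e"
    using star_homD(4)[OF f(1), of "\<one>\<^bsub>A\<^esub>" e] e(1) by simp
  then show ?thesis
    using e star_homD(1)[OF f(1), of "\<one>\<^bsub>A\<^esub>"] by simp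
qed

lemma star_iso_inv_into:
  assumes "unital_cstar_algebra A" "star_iso A B f"
  shows "star_iso B A (inv_into (carrier A) f)"
proof -
  interpret A: unital_cstar_algebra A by fact
  note closed = ring.ring_simprules(1,5)[OF A.algebra_ring] A.smult_in_carrier A.star_closed
  let ?g = "inv_into (carrier A) f"
  have f: "star_hom A B f" and bij: "bij_betw f (carrier A) (carrier B)"
    using assms(2) by (auto simp: star_iso_def)
  have g: "?g y \<in> carrier A" "f (?g y) = y" if "y \<in> carrier B" for y
    using that bij by (auto simp: bij_betw_def inv_into_into f_inv_into_f)
  have gf: "?g (f x) = x" if "x \<in> carrier A" for x
    using that bij by (simp add: bij_betw_def)
  have "?g (y \<oplus>\<^bsub>B\<^esub> z) = ?g y \<oplus>\<^bsub>A\<^esub> ?g z" "?g (y \<otimes>\<^bsub>B\<^esub> z) = ?g y \<otimes>\<^bsub>A\<^esub> ?g z"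
    if "y \<in> carrier B" "z \<in> carrier B" for y z
    using gf[OF closed(1)[OF g(1)[OF that(1)] g(1)[OF that(2)]]]
      gf[OF closed(2)[OF g(1)[OF that(1)] g(1)[OF that(2)]]] that
    by (simp_all add: star_homD[OF f] g)
  moreover have "?g (c \<odot>\<^bsub>B\<^esub> y) = c \<odot>\<^bsub>A\<^esub> ?g y" "?g (star B y) = star A (?g y)" if "y \<in> carrier B" for c y
    using gf[OF closed(3)[OF g(1)[OF that]], of c] gf[OF closed(4)[OF g(1)[OF that]]] that
    by (simp_all add: star_homD[OF f] g)
  ultimately show ?thesis
    using g bij_betw_inv_into[OF bij] by (auto simp: star_iso_def star_hom_def)
qed

lemma cstar_subalgebra_equalizer:
  assumes "unital_cstar_algebra A" "unital_cstar_algebra B" "star_hom A B f" "star_hom A B g"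
  shows "cstar_subalgebra A {x \<in> carrier A. f x = g x}"
proof -
  interpret A: unital_cstar_algebra A by fact
  interpret B: unital_cstar_algebra B by fact
  show ?thesis
  proof (rule A.cstar_subalgebraI)
    show "closedin (norm_topology A) {x \<in> carrier A. f x = g x}"
      using B.closedin_equalizer[OF star_hom_continuous star_hom_continuous] assms by fastforce
    show "\<zero>\<^bsub>A\<^esub> \<in> {x \<in> carrier A. f x = g x}"
      using star_hom_minus(3)[OF assms(1,2,3)] star_hom_minus(3)[OF assms(1,2,4)] by auto
  qed (auto simp: star_homD[OF assms(3)] star_homD[OF assms(4)] A.star_closed)
qed

text \<open>This replaces induction over generated C*-algebras: a *-homomorphism maps a generated
  C*-algebra into \<open>S\<close> as soon as it maps the generators there.\<close>

lemma cstar_subalgebra_preimage: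
  assumes "unital_cstar_algebra A" "unital_cstar_algebra B" "star_hom A B f" "cstar_subalgebra B S"
  shows "cstar_subalgebra A {x \<in> carrier A. f x \<in> S}"
proof -
  interpret A: unital_cstar_algebra A by fact
  interpret B: unital_cstar_algebra B by fact
  note D = B.cstar_subalgebraD[OF assms(4)]
  show ?thesis
  proof (rule A.cstar_subalgebraI)
    show "closedin (norm_topology A) {x \<in> carrier A. f x \<in> S}"
      using closedin_continuous_map_preimage[OF star_hom_continuous D(7)] assms by fastforce
    show "\<zero>\<^bsub>A\<^esub> \<in> {x \<in> carrier A. f x \<in> S}"
      using star_hom_minus(3)[of A B f] assms D(2) by auto
  qed (auto simp: star_homD[OF assms(3)] A.star_closed D)
qed

section \<open>Tensor products of the site algebras\<close>

lemma lookup_formal_scale [simp]: "Poly_Mapping.lookup (formal_scale c f) u = c * Poly_Mapping.lookup f u"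
  by (simp add: formal_scale_def Poly_Mapping.map.rep_eq when_def)

interpretation formal: Modules.module formal_scale
  by standard (auto intro!: poly_mapping_eqI simp: lookup_add algebra_simps)

lemma formal_scale_single: "formal_scale c (Poly_Mapping.single u d) = Poly_Mapping.single u (c * d)"
  by (rule poly_mapping_eqI) (simp add: lookup_single when_def)

lemma formal_space_add: "\<lbrakk>f \<in> formal_space A \<Lambda>; g \<in> formal_space A \<Lambda>\<rbrakk> \<Longrightarrow> f + g \<in> formal_space A \<Lambda>"
  using keys_add[of f g] by (auto simp: formal_space_def)

lemma formal_space_scale: "f \<in> formal_space A \<Lambda> \<Longrightarrow> formal_scale c f \<in> formal_space A \<Lambda>"
  by (auto simp: formal_space_def in_keys_iff subset_iff)

lemma formal_space_single:
  "u \<in> (\<Pi>\<^sub>E x\<in>\<Lambda>. carrier (A x)) \<Longrightarrow> Poly_Mapping.single u c \<in> formal_space A \<Lambda>"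
  by (auto simp: formal_space_def)

lemma equiv_tensor_rel: "equiv (formal_space A \<Lambda>) (tensor_rel A \<Lambda>)"
proof (rule equivI)
  show "sym (tensor_rel A \<Lambda>)"
  proof (rule symI)
    fix f g assume "(f, g) \<in> tensor_rel A \<Lambda>"
    then show "(g, f) \<in> tensor_rel A \<Lambda>"
      using formal.span_neg[of "f - g" "multilinear_relators A \<Lambda>"] by (simp add: tensor_rel_def)
  qed
  show "trans (tensor_rel A \<Lambda>)"
  proof (rule transI)
    fix f g h assume "(f, g) \<in> tensor_rel A \<Lambda>" "(g, h) \<in> tensor_rel A \<Lambda>"
    then show "(f, h) \<in> tensor_rel A \<Lambda>"
      using formal.span_add[of "f - g" "multilinear_relators A \<Lambda>" "g - h"]
      by (simp add: tensor_rel_def)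
  qed
qed (auto simp: tensor_rel_def refl_on_def formal.span_zero)

lemma tensor_class_eq:
  assumes "X \<in> formal_space A \<Lambda> // tensor_rel A \<Lambda>" "f \<in> X"
  shows "X = tensor_rel A \<Lambda> `` {f}"
proof -
  obtain g where g: "X = tensor_rel A \<Lambda> `` {g}"
    using assms(1) by (rule quotientE)
  then have "(g, f) \<in> tensor_rel A \<Lambda>"
    using assms(2) by simp
  with g show ?thesis
    using equiv_class_eq[OF equiv_tensor_rel] by simp
qed

lemma tensor_class_self: "f \<in> formal_space A \<Lambda> \<Longrightarrow> f \<in> tensor_rel A \<Lambda> `` {f}"
  using equiv_tensor_rel by (rule equiv_class_self)

lemma tensor_class_in_carrier:
  "f \<in> formal_space A \<Lambda> \<Longrightarrow> tensor_rel A \<Lambda> `` {f} \<in> carrier (tensor_algebra A \<Lambda> N)"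
  by (simp add: tensor_algebra_def quotientI)

lemma tensor_class_cong:
  "\<lbrakk>f \<in> formal_space A \<Lambda>; g \<in> formal_space A \<Lambda>; f - g \<in> formal.span (multilinear_relators A \<Lambda>)\<rbrakk> \<Longrightarrow>
    tensor_rel A \<Lambda> `` {f} = tensor_rel A \<Lambda> `` {g}"
  by (rule equiv_class_eq[OF equiv_tensor_rel]) (simp add: tensor_rel_def)

lemma elementary_tensor_cong: "(\<And>x. x \<in> \<Lambda> \<Longrightarrow> u x = v x) \<Longrightarrow> elementary_tensor A \<Lambda> u = elementary_tensor A \<Lambda> v"
  by (simp add: elementary_tensor_def cong: restrict_cong)

text \<open>The formal sum inside \<open>tensor_insertion\<close>, named so that linearity and
  compatibility with the relators can be proved on representatives.\<close>

definition formal_insertion ::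
  "(int \<Rightarrow> ('b, 'm) star_algebra_scheme) \<Rightarrow> int set \<Rightarrow> int set \<Rightarrow> 'b formal \<Rightarrow> 'b formal" where
  "formal_insertion A \<Lambda>' \<Lambda> f = (\<Sum>u\<in>Poly_Mapping.keys f.
     Poly_Mapping.single (\<lambda>x\<in>\<Lambda>'. if x \<in> \<Lambda> then u x else \<one>\<^bsub>A x\<^esub>) (Poly_Mapping.lookup f u))"

text \<open>Cancellation may leave \<open>f + g\<close> with fewer keys than \<open>f\<close> and
  \<open>g\<close>; summing over a common finite superset makes linearity provable termwise.\<close>

lemma formal_insertion_superset:
  assumes "finite K" "Poly_Mapping.keys f \<subseteq> K"
  shows "formal_insertion A \<Lambda>' \<Lambda> f = (\<Sum>u\<in>K.
     Poly_Mapping.single (\<lambda>x\<in>\<Lambda>'. if x \<in> \<Lambda> then u x else \<one>\<^bsub>A x\<^esub>) (Poly_Mapping.lookup f u))"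
  unfolding formal_insertion_def using assms
  by (intro sum.mono_neutral_left) (auto simp: in_keys_iff)

lemma formal_insertion_add:
  "formal_insertion A \<Lambda>' \<Lambda> (f + g) = formal_insertion A \<Lambda>' \<Lambda> f + formal_insertion A \<Lambda>' \<Lambda> g"
  using keys_add[of f g]
  by (simp add: formal_insertion_superset[of "Poly_Mapping.keys f \<union> Poly_Mapping.keys g"]
      lookup_add single_add sum.distrib)

lemma formal_insertion_scale:
  "formal_insertion A \<Lambda>' \<Lambda> (formal_scale c f) = formal_scale c (formal_insertion A \<Lambda>' \<Lambda> f)"
proof -
  have "Poly_Mapping.keys (formal_scale c f) \<subseteq> Poly_Mapping.keys f"
    by (auto simp: in_keys_iff)
  then show ?thesis
    by (simp add: formal_insertion_superset[of "Poly_Mapping.keys f"] formal.scale_sum_right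
        formal_scale_single)
qed

lemma formal_insertion_diff:
  "formal_insertion A \<Lambda>' \<Lambda> (f - g) = formal_insertion A \<Lambda>' \<Lambda> f - formal_insertion A \<Lambda>' \<Lambda> g"
  using formal_insertion_add[of A \<Lambda>' \<Lambda> f "- g"] formal_insertion_scale[of A \<Lambda>' \<Lambda> "-1" g]
  by simp

lemma formal_insertion_single:
  "formal_insertion A \<Lambda>' \<Lambda> (Poly_Mapping.single u c) =
    Poly_Mapping.single (\<lambda>x\<in>\<Lambda>'. if x \<in> \<Lambda> then u x else \<one>\<^bsub>A x\<^esub>) c"
  by (subst formal_insertion_superset[of "{u}"]) simp_all

text \<open>Filling the slots outside \<Lambda> with units commutes with changing a slot inside
  \<Lambda>, so each relator goes to a relator of the same kind. This is what makes the insertion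
  well defined on classes.\<close>

lemma formal_insertion_relators:
  assumes "\<Lambda> \<subseteq> \<Lambda>'" "\<And>x. \<one>\<^bsub>A x\<^esub> \<in> carrier (A x)" "r \<in> multilinear_relators A \<Lambda>"
  shows "formal_insertion A \<Lambda>' \<Lambda> r \<in> multilinear_relators A \<Lambda>'"
proof -
  define ins where "ins u = (\<lambda>x\<in>\<Lambda>'. if x \<in> \<Lambda> then u x else \<one>\<^bsub>A x\<^esub>)" for u
  have upd: "ins (u(x := a)) = (ins u)(x := a)" if "x \<in> \<Lambda>" for u x a
    using that assms(1) by (auto simp: ins_def restrict_def fun_eq_iff)
  have L: "formal_insertion A \<Lambda>' \<Lambda> (Poly_Mapping.single u c) = Poly_Mapping.single (ins u) c" for u c
    by (simp add: formal_insertion_single ins_def)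
  have ins: "ins u \<in> (\<Pi>\<^sub>E x\<in>\<Lambda>'. carrier (A x))" if "u \<in> (\<Pi>\<^sub>E x\<in>\<Lambda>. carrier (A x))" for u
    using that assms(2) by (auto simp: ins_def PiE_iff)
  show ?thesis
    using assms(3) unfolding multilinear_relators_def[of A \<Lambda>]
  proof (elim UnE CollectE exE conjE, goal_cases)
    case (1 u x a b)
    then have "formal_insertion A \<Lambda>' \<Lambda> r = Poly_Mapping.single ((ins u)(x := a \<oplus>\<^bsub>A x\<^esub> b)) 1
      - Poly_Mapping.single ((ins u)(x := a)) 1 - Poly_Mapping.single ((ins u)(x := b)) 1"
      by (simp add: formal_insertion_diff L upd)
    moreover have "x \<in> \<Lambda>'" using 1 assms(1) by blast
    ultimately show ?case
      using 1 ins[of u] unfolding multilinear_relators_def by blast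
  next
    case (2 u x a c)
    then have "formal_insertion A \<Lambda>' \<Lambda> r = Poly_Mapping.single ((ins u)(x := c \<odot>\<^bsub>A x\<^esub> a)) 1
      - Poly_Mapping.single ((ins u)(x := a)) c"
      by (simp add: formal_insertion_diff L upd)
    moreover have "x \<in> \<Lambda>'" using 2 assms(1) by blast
    ultimately show ?case
      using 2 ins[of u] unfolding multilinear_relators_def by blast
  qed
qed

lemma formal_insertion_span:
  assumes "\<Lambda> \<subseteq> \<Lambda>'" "\<And>x. \<one>\<^bsub>A x\<^esub> \<in> carrier (A x)" "f \<in> formal.span (multilinear_relators A \<Lambda>)"
  shows "formal_insertion A \<Lambda>' \<Lambda> f \<in> formal.span (multilinear_relators A \<Lambda>')"
proof (rule formal.span_induct[OF assms(3)])
  show "formal.subspace {f. formal_insertion A \<Lambda>' \<Lambda> f \<in> formal.span (multilinear_relators A \<Lambda>')}"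
  proof (rule formal.subspaceI)
    show "0 \<in> {f. formal_insertion A \<Lambda>' \<Lambda> f \<in> formal.span (multilinear_relators A \<Lambda>')}"
      by (simp add: formal_insertion_def formal.span_zero)
  qed (auto simp: formal_insertion_add formal_insertion_scale intro: formal.span_add formal.span_scale)
qed (use formal_insertion_relators[OF assms(1,2)] in \<open>auto intro: formal.span_base\<close>)

lemma formal_insertion_space:
  assumes "\<And>x. \<one>\<^bsub>A x\<^esub> \<in> carrier (A x)" "f \<in> formal_space A \<Lambda>"
  shows "formal_insertion A \<Lambda>' \<Lambda> f \<in> formal_space A \<Lambda>'"
proof -
  have "(\<Sum>u\<in>K. Poly_Mapping.single (\<lambda>x\<in>\<Lambda>'. if x \<in> \<Lambda> then u x else \<one>\<^bsub>A x\<^esub>) (c u)) \<in> formal_space A \<Lambda>'"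
    if "finite K" "K \<subseteq> (\<Pi>\<^sub>E x\<in>\<Lambda>. carrier (A x))" for K c
    using that
  proof (induction K)
    case (insert u K)
    have "(\<lambda>x\<in>\<Lambda>'. if x \<in> \<Lambda> then u x else \<one>\<^bsub>A x\<^esub>) \<in> (\<Pi>\<^sub>E x\<in>\<Lambda>'. carrier (A x))"
      using insert.prems assms(1) by (auto simp: PiE_iff)
    moreover have "K \<subseteq> (\<Pi>\<^sub>E x\<in>\<Lambda>. carrier (A x))"
      using insert.prems by blast
    ultimately show ?case
      unfolding sum.insert[OF insert.hyps]
      by (intro formal_space_add formal_space_single insert.IH)
  qed (simp add: formal_space_def)
  then show ?thesis
    using assms(2) by (simp add: formal_insertion_def formal_space_def)
qed

lemma tensor_insertion_class:
  assumes "\<Lambda> \<subseteq> \<Lambda>'" "\<And>x. \<one>\<^bsub>A x\<^esub> \<in> carrier (A x)" "f \<in> formal_space A \<Lambda>"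
  shows "tensor_insertion A \<Lambda>' \<Lambda> (tensor_rel A \<Lambda> `` {f}) =
    tensor_rel A \<Lambda>' `` {formal_insertion A \<Lambda>' \<Lambda> f}"
proof -
  have "tensor_rel A \<Lambda>' `` {formal_insertion A \<Lambda>' \<Lambda> g} = tensor_rel A \<Lambda>' `` {formal_insertion A \<Lambda>' \<Lambda> f}"
    if "g \<in> tensor_rel A \<Lambda> `` {f}" for g
  proof -
    have "g \<in> formal_space A \<Lambda>" "f - g \<in> formal.span (multilinear_relators A \<Lambda>)"
      using that by (auto simp: tensor_rel_def)
    then show ?thesis
      using formal_insertion_span[OF assms(1,2), of "f - g"] formal_insertion_space[OF assms(2)] assms(3)
      by (intro tensor_class_cong[symmetric]) (simp_all add: formal_insertion_diff)
  qed
  then show ?thesis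
    using tensor_class_self[OF assms(3)]
    unfolding tensor_insertion_def formal_insertion_def[symmetric] by blast
qed

lemma tensor_insertion_elementary:
  assumes "\<Lambda> \<subseteq> \<Lambda>'" "\<And>x. \<one>\<^bsub>A x\<^esub> \<in> carrier (A x)" "\<And>x. x \<in> \<Lambda> \<Longrightarrow> u x \<in> carrier (A x)"
  shows "tensor_insertion A \<Lambda>' \<Lambda> (elementary_tensor A \<Lambda> u) =
    elementary_tensor A \<Lambda>' (\<lambda>x. if x \<in> \<Lambda> then u x else \<one>\<^bsub>A x\<^esub>)"
proof -
  have "restrict u \<Lambda> \<in> (\<Pi>\<^sub>E x\<in>\<Lambda>. carrier (A x))"
    using assms(3) by auto
  then show ?thesis
    unfolding elementary_tensor_def
    by (simp add: tensor_insertion_class[OF assms(1,2)] formal_space_single formal_insertion_single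
        cong: restrict_cong if_cong)
qed

section \<open>Elementary tensors and the embeddings of the local algebras\<close>

context spin_algebra
begin

abbreviation tensors :: "int set \<Rightarrow> ('b formal set) cstar" where
  "tensors \<Lambda> \<equiv> tensor_algebra A \<Lambda> (\<nu> \<Lambda>)"

lemma site_one_closed: "\<one>\<^bsub>A x\<^esub> \<in> carrier (A x)"
proof -
  interpret unital_cstar_algebra "A x" by (rule site_algebra)
  show ?thesis by (rule ring.ring_simprules(6)[OF algebra_ring])
qed

lemma elementary_tensor_closed:
  "(\<And>x. x \<in> \<Lambda> \<Longrightarrow> u x \<in> carrier (A x)) \<Longrightarrow> elementary_tensor A \<Lambda> u \<in> carrier (tensors \<Lambda>)"
  unfolding elementary_tensor_def by (intro tensor_class_in_carrier formal_space_single) auto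

text \<open>The operations on tensors are unions over representatives. They respect the tensor relation
  since the local algebras are assumed to be closed under them.\<close>

lemma tensor_add_class:
  assumes "finite \<Lambda>" "\<Lambda> \<noteq> {}" "f \<in> formal_space A \<Lambda>" "g \<in> formal_space A \<Lambda>"
  shows "tensor_rel A \<Lambda> `` {f} \<oplus>\<^bsub>tensors \<Lambda>\<^esub> tensor_rel A \<Lambda> `` {g} = tensor_rel A \<Lambda> `` {f + g}"
proof (rule tensor_class_eq)
  interpret T: unital_cstar_algebra "tensors \<Lambda>" by (rule local_algebra[OF assms(1,2)])
  show "tensor_rel A \<Lambda> `` {f} \<oplus>\<^bsub>tensors \<Lambda>\<^esub> tensor_rel A \<Lambda> `` {g} \<in> formal_space A \<Lambda> // tensor_rel A \<Lambda>"
    using ring.ring_simprules(1)[OF T.algebra_ring, OF tensor_class_in_carrier tensor_class_in_carrier]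
      assms by (simp add: tensor_algebra_def)
  show "f + g \<in> tensor_rel A \<Lambda> `` {f} \<oplus>\<^bsub>tensors \<Lambda>\<^esub> tensor_rel A \<Lambda> `` {g}"
    using tensor_class_self[OF assms(3)] tensor_class_self[OF assms(4)]
      tensor_class_self[OF formal_space_add[OF assms(3,4)]]
    by (auto simp: tensor_algebra_def)
qed

lemma tensor_smult_class:
  assumes "finite \<Lambda>" "\<Lambda> \<noteq> {}" "f \<in> formal_space A \<Lambda>"
  shows "c \<odot>\<^bsub>tensors \<Lambda>\<^esub> tensor_rel A \<Lambda> `` {f} = tensor_rel A \<Lambda> `` {formal_scale c f}"
proof (rule tensor_class_eq)
  interpret T: unital_cstar_algebra "tensors \<Lambda>" by (rule local_algebra[OF assms(1,2)])
  show "c \<odot>\<^bsub>tensors \<Lambda>\<^esub> tensor_rel A \<Lambda> `` {f} \<in> formal_space A \<Lambda> // tensor_rel A \<Lambda>"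
    using T.smult_in_carrier[OF tensor_class_in_carrier[OF assms(3)], of c]
    by (simp add: tensor_algebra_def)
  show "formal_scale c f \<in> c \<odot>\<^bsub>tensors \<Lambda>\<^esub> tensor_rel A \<Lambda> `` {f}"
    using tensor_class_self[OF assms(3)] tensor_class_self[OF formal_space_scale[OF assms(3)]]
    by (auto simp: tensor_algebra_def)
qed

lemma elementary_tensor_mult:
  assumes "finite \<Lambda>" "\<Lambda> \<noteq> {}"
    and u: "\<And>x. x \<in> \<Lambda> \<Longrightarrow> u x \<in> carrier (A x)" and v: "\<And>x. x \<in> \<Lambda> \<Longrightarrow> v x \<in> carrier (A x)"
  shows "elementary_tensor A \<Lambda> u \<otimes>\<^bsub>tensors \<Lambda>\<^esub> elementary_tensor A \<Lambda> v =
    elementary_tensor A \<Lambda> (\<lambda>x. u x \<otimes>\<^bsub>A x\<^esub> v x)"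
  unfolding elementary_tensor_def[of A \<Lambda> "\<lambda>x. u x \<otimes>\<^bsub>A x\<^esub> v x"]
proof (rule tensor_class_eq)
  interpret T: unital_cstar_algebra "tensors \<Lambda>" by (rule local_algebra[OF assms(1,2)])
  interpret S: unital_cstar_algebra "A x" for x by (rule site_algebra)
  let ?s = "\<lambda>w. Poly_Mapping.single (restrict w \<Lambda>) (1::complex)"
  have s: "?s w \<in> formal_space A \<Lambda>" if "\<And>x. x \<in> \<Lambda> \<Longrightarrow> w x \<in> carrier (A x)" for w
    using that by (intro formal_space_single) auto
  have uv: "u x \<otimes>\<^bsub>A x\<^esub> v x \<in> carrier (A x)" if "x \<in> \<Lambda>" for x
    using that u v ring.ring_simprules(5)[OF S.algebra_ring] by blast
  have eq: "formal_mult A \<Lambda> (?s u) (?s v) = ?s (\<lambda>x. u x \<otimes>\<^bsub>A x\<^esub> v x)"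
    by (simp add: formal_mult_def cong: restrict_cong)
  have "X \<otimes>\<^bsub>tensors \<Lambda>\<^esub> Y = (\<Union>f\<in>X. \<Union>g\<in>Y. tensor_rel A \<Lambda> `` {formal_mult A \<Lambda> f g})" for X Y
    by (simp add: tensor_algebra_def)
  moreover have "?s (\<lambda>x. u x \<otimes>\<^bsub>A x\<^esub> v x) \<in> tensor_rel A \<Lambda> `` {formal_mult A \<Lambda> (?s u) (?s v)}"
    unfolding eq using uv by (intro tensor_class_self s)
  ultimately show "?s (\<lambda>x. u x \<otimes>\<^bsub>A x\<^esub> v x) \<in> elementary_tensor A \<Lambda> u \<otimes>\<^bsub>tensors \<Lambda>\<^esub> elementary_tensor A \<Lambda> v"
    unfolding elementary_tensor_def using tensor_class_self[OF s, of u] tensor_class_self[OF s, of v] u v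
    by blast
  show "elementary_tensor A \<Lambda> u \<otimes>\<^bsub>tensors \<Lambda>\<^esub> elementary_tensor A \<Lambda> v \<in> formal_space A \<Lambda> // tensor_rel A \<Lambda>"
    using ring.ring_simprules(5)[OF T.algebra_ring, OF elementary_tensor_closed elementary_tensor_closed]
      u v by (simp add: tensor_algebra_def)
qed

lemma elementary_tensor_star:
  assumes "finite \<Lambda>" "\<Lambda> \<noteq> {}" and u: "\<And>x. x \<in> \<Lambda> \<Longrightarrow> u x \<in> carrier (A x)"
  shows "star (tensors \<Lambda>) (elementary_tensor A \<Lambda> u) = elementary_tensor A \<Lambda> (\<lambda>x. star (A x) (u x))"
  unfolding elementary_tensor_def[of A \<Lambda> "\<lambda>x. star (A x) (u x)"]
proof (rule tensor_class_eq)
  interpret T: unital_cstar_algebra "tensors \<Lambda>" by (rule local_algebra[OF assms(1,2)])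
  interpret S: unital_cstar_algebra "A x" for x by (rule site_algebra)
  let ?s = "\<lambda>w. Poly_Mapping.single (restrict w \<Lambda>) (1::complex)"
  have s: "?s w \<in> formal_space A \<Lambda>" if "\<And>x. x \<in> \<Lambda> \<Longrightarrow> w x \<in> carrier (A x)" for w
    using that by (intro formal_space_single) auto
  have eq: "formal_star A \<Lambda> (?s u) = ?s (\<lambda>x. star (A x) (u x))"
    by (simp add: formal_star_def cong: restrict_cong)
  have "star (tensors \<Lambda>) X = (\<Union>f\<in>X. tensor_rel A \<Lambda> `` {formal_star A \<Lambda> f})" for X
    by (simp add: tensor_algebra_def)
  moreover have "?s (\<lambda>x. star (A x) (u x)) \<in> tensor_rel A \<Lambda> `` {formal_star A \<Lambda> (?s u)}"
    unfolding eq using u S.star_closed by (intro tensor_class_self s) auto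
  ultimately show "?s (\<lambda>x. star (A x) (u x)) \<in> star (tensors \<Lambda>) (elementary_tensor A \<Lambda> u)"
    unfolding elementary_tensor_def using tensor_class_self[OF s, of u] u by blast
  show "star (tensors \<Lambda>) (elementary_tensor A \<Lambda> u) \<in> formal_space A \<Lambda> // tensor_rel A \<Lambda>"
    using T.star_closed[OF elementary_tensor_closed] u by (simp add: tensor_algebra_def)
qed

text \<open>With a single slot the multilinearity relators express that the class depends linearly
  on its entry; product and involution act factorwise.\<close>

lemma elementary_tensor_site_hom:
  "star_hom (A x) (tensors {x}) (\<lambda>a. elementary_tensor A {x} (\<lambda>_. a))"
proof -
  interpret T: unital_cstar_algebra "tensors {x}" by (rule local_algebra) auto
  interpret S: unital_cstar_algebra "A x" by (rule site_algebra)
  let ?s = "\<lambda>a. Poly_Mapping.single (restrict (\<lambda>_. a) {x}) :: complex \<Rightarrow> 'b formal"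
  have u: "restrict (\<lambda>_. a) {x} \<in> (\<Pi>\<^sub>E x\<in>{x}. carrier (A x))" if "a \<in> carrier (A x)" for a
    using that by auto
  have upd: "(restrict (\<lambda>_. a) {x})(x := b) = restrict (\<lambda>_. b) {x}" for a b :: 'b
    by (auto simp: fun_eq_iff)
  have s: "?s a c \<in> formal_space A {x}" if "a \<in> carrier (A x)" for a c
    using formal_space_single[OF u[OF that]] .
  note closed = ring.ring_simprules(1,5)[OF S.algebra_ring]
  have add: "elementary_tensor A {x} (\<lambda>_. a \<oplus>\<^bsub>A x\<^esub> b) =
      elementary_tensor A {x} (\<lambda>_. a) \<oplus>\<^bsub>tensors {x}\<^esub> elementary_tensor A {x} (\<lambda>_. b)"
    if "a \<in> carrier (A x)" "b \<in> carrier (A x)" for a b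
  proof -
    have "?s (a \<oplus>\<^bsub>A x\<^esub> b) 1 - ?s a 1 - ?s b 1 \<in> multilinear_relators A {x}"
      unfolding multilinear_relators_def using u[OF that(1)] that upd[of a]
      by (intro UnI1 CollectI exI[of _ "restrict (\<lambda>_. a) {x}"] exI[of _ x] exI[of _ a] exI[of _ b]) auto
    then have "?s (a \<oplus>\<^bsub>A x\<^esub> b) 1 - (?s a 1 + ?s b 1) \<in> formal.span (multilinear_relators A {x})"
      by (metis diff_diff_eq formal.span_base)
    then show ?thesis
      unfolding elementary_tensor_def using that
      by (simp add: tensor_add_class s) (intro tensor_class_cong formal_space_add s closed)
  qed
  have smult: "elementary_tensor A {x} (\<lambda>_. c \<odot>\<^bsub>A x\<^esub> a) =
      c \<odot>\<^bsub>tensors {x}\<^esub> elementary_tensor A {x} (\<lambda>_. a)" if "a \<in> carrier (A x)" for a c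
  proof -
    have "?s (c \<odot>\<^bsub>A x\<^esub> a) 1 - ?s a c \<in> multilinear_relators A {x}"
      unfolding multilinear_relators_def using u[OF that] that upd[of a]
      by (intro UnI2 CollectI exI[of _ "restrict (\<lambda>_. a) {x}"] exI[of _ x] exI[of _ a] exI[of _ c]) auto
    then have "?s (c \<odot>\<^bsub>A x\<^esub> a) 1 - ?s a c \<in> formal.span (multilinear_relators A {x})"
      by (rule formal.span_base)
    then show ?thesis
      unfolding elementary_tensor_def using that
      by (simp add: tensor_smult_class s formal_scale_single)
        (intro tensor_class_cong s S.smult_in_carrier)
  qed
  \<comment> \<open>The factorwise operations give families that use the operation of
    \<open>A y\<close> in slot \<open>y\<close>; on \<open>{x}\<close> only the slot
    \<open>x\<close> counts.\<close>
  have cong: "elementary_tensor A {x} (\<lambda>y. F y) = elementary_tensor A {x} (\<lambda>_. F x)" for F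
    by (rule elementary_tensor_cong) simp
  show ?thesis
    unfolding star_hom_def
  proof (intro conjI ballI allI)
    show "(\<lambda>a. elementary_tensor A {x} (\<lambda>_. a)) \<in> carrier (A x) \<rightarrow> carrier (tensors {x})"
      by (auto intro: elementary_tensor_closed)
    fix a b assume a: "a \<in> carrier (A x)" and b: "b \<in> carrier (A x)"
    show "elementary_tensor A {x} (\<lambda>_. a \<otimes>\<^bsub>A x\<^esub> b) =
        elementary_tensor A {x} (\<lambda>_. a) \<otimes>\<^bsub>tensors {x}\<^esub> elementary_tensor A {x} (\<lambda>_. b)"
      using a b elementary_tensor_mult[of "{x}" "\<lambda>_. a" "\<lambda>_. b"] cong[of "\<lambda>y. a \<otimes>\<^bsub>A y\<^esub> b"]
      by simp
    show "elementary_tensor A {x} (\<lambda>_. star (A x) a) =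
        star (tensors {x}) (elementary_tensor A {x} (\<lambda>_. a))"
      using a elementary_tensor_star[of "{x}" "\<lambda>_. a"] cong[of "\<lambda>y. star (A y) a"] by simp
  qed (use add smult in auto)
qed

lemma local_embedding_hom:
  assumes "finite \<Lambda>" "\<Lambda> \<noteq> {}"
  shows "star_hom (tensors \<Lambda>) \<AA> (\<phi> \<Lambda>)"
proof -
  interpret L: unital_cstar_algebra \<AA> by (rule limit_algebra)
  have "\<phi> \<Lambda> ` carrier (tensors \<Lambda>) \<subseteq> carrier \<AA>"
    using local_subalgebra[OF assms] L.cstar_subalgebraD(1) by (auto simp: unital_cstar_subalgebra_def)
  then show ?thesis
    using local_iso[OF assms] by (auto simp: star_iso_def star_hom_def)
qed

lemma local_embedding_one:
  assumes "finite \<Lambda>" "\<Lambda> \<noteq> {}"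
  shows "\<phi> \<Lambda> \<one>\<^bsub>tensors \<Lambda>\<^esub> = \<one>\<^bsub>\<AA>\<^esub>"
proof -
  interpret L: unital_cstar_algebra \<AA> by (rule limit_algebra)
  show ?thesis
    using star_iso_one[OF _ _ local_iso[OF assms],
        OF ring.is_monoid[OF unital_cstar_algebra.algebra_ring[OF local_algebra[OF assms]]]
          ring.is_monoid[OF unital_cstar_algebra.algebra_ring[OF
            L.unital_cstar_algebra_restrict[OF local_subalgebra[OF assms]]]]]
    by simp
qed

end

section \<open>Generation by the spins\<close>

lemma monoid_mat2_complex: "monoid mat2_complex"
  by (rule monoidI) (auto simp: mat2_complex_def matrix_mul_assoc)

text \<open>The coefficient of \<open>pauli \<kappa>\<close> is half the trace of
  \<open>m ** pauli \<kappa>\<close>, the Pauli matrices being orthogonal for the trace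
  form.\<close>

lemma pauli_decomposition:
  "\<exists>c0 c1 c2 c3. m = (c0 \<odot>\<^bsub>mat2_complex\<^esub> pauli 0 \<oplus>\<^bsub>mat2_complex\<^esub> c1 \<odot>\<^bsub>mat2_complex\<^esub> pauli 1)
    \<oplus>\<^bsub>mat2_complex\<^esub> (c2 \<odot>\<^bsub>mat2_complex\<^esub> pauli 2 \<oplus>\<^bsub>mat2_complex\<^esub> c3 \<odot>\<^bsub>mat2_complex\<^esub> pauli 3)"
  by (rule exI[of _ "(m$1$1 + m$2$2) / 2"], rule exI[of _ "(m$1$2 + m$2$1) / 2"],
      rule exI[of _ "\<i> * (m$1$2 - m$2$1) / 2"], rule exI[of _ "(m$1$1 - m$2$2) / 2"])
    (simp add: mat2_complex_def pauli_def mk_mat2_def vec_eq_iff forall_2 mat_def field_simps)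

context spin_algebra
begin

text \<open>This extends \<open>spin\<close> from the Pauli matrices to all 2 by 2 matrices. As it
  turns out to be a unital *-homomorphism, identities between spins at one site become matrix
  computations.\<close>

definition site_embedding :: "int \<Rightarrow> complex^2^2 \<Rightarrow> 'a" where
  "site_embedding x m =
     \<phi> {x} (elementary_tensor A {x} (\<lambda>y. inv_into (carrier (A y)) (\<xi> y) m))"

lemma spin_eq: "spin A \<xi> \<phi> \<kappa> x = site_embedding x (pauli \<kappa>)"
  by (simp add: spin_def site_embedding_def)

lemma site_embedding_eq:
  "site_embedding x m = \<phi> {x} (elementary_tensor A {x} (\<lambda>_. inv_into (carrier (A x)) (\<xi> x) m))"
proof -
  have "elementary_tensor A {x} (\<lambda>y. inv_into (carrier (A y)) (\<xi> y) m) =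
      elementary_tensor A {x} (\<lambda>_. inv_into (carrier (A x)) (\<xi> x) m)"
    by (rule elementary_tensor_cong) simp
  then show ?thesis
    by (simp only: site_embedding_def)
qed

lemma site_embedding_hom: "star_hom mat2_complex \<AA> (site_embedding x)"
proof -
  have "star_hom mat2_complex (A x) (inv_into (carrier (A x)) (\<xi> x))"
    using star_iso_inv_into[OF site_algebra site_iso] by (simp add: star_iso_def)
  then have "star_hom mat2_complex \<AA> (\<phi> {x} \<circ> ((\<lambda>a. elementary_tensor A {x} (\<lambda>_. a)) \<circ>
      inv_into (carrier (A x)) (\<xi> x)))"
    using star_hom_comp[OF star_hom_comp[OF _ elementary_tensor_site_hom]] local_embedding_hom[of "{x}"]
    by blast
  then show ?thesis
    by (simp add: site_embedding_eq[abs_def] comp_def)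
qed

lemma site_embedding_one: "site_embedding x (mat 1) = \<one>\<^bsub>\<AA>\<^esub>"
proof -
  have "monoid (A x)"
    using site_algebra by (intro ring.is_monoid unital_cstar_algebra.algebra_ring)
  then have "inv_into (carrier (A x)) (\<xi> x) (mat 1) = \<one>\<^bsub>A x\<^esub>"
    using star_iso_one[OF monoid_mat2_complex _ star_iso_inv_into[OF site_algebra site_iso]]
    by (simp add: mat2_complex_def)
  then have "elementary_tensor A {x} (\<lambda>_. inv_into (carrier (A x)) (\<xi> x) (mat 1)) =
      elementary_tensor A {x} (\<lambda>y. \<one>\<^bsub>A y\<^esub>)"
    by (intro elementary_tensor_cong) simp
  then show ?thesis
    unfolding site_embedding_eq
    using local_embedding_one[of "{x}"] by (simp add: tensor_algebra_def)
qed

lemma site_embedding_mult: "site_embedding x m \<otimes>\<^bsub>\<AA>\<^esub> site_embedding x n = site_embedding x (m ** n)"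
  and site_embedding_add: "site_embedding x m \<oplus>\<^bsub>\<AA>\<^esub> site_embedding x n = site_embedding x (m + n)"
  and site_embedding_smult: "c \<odot>\<^bsub>\<AA>\<^esub> site_embedding x m = site_embedding x (\<chi> i j. c * m $ i $ j)"
  and site_embedding_star: "star \<AA> (site_embedding x m) = site_embedding x (\<chi> i j. cnj (m $ j $ i))"
  and site_embedding_closed: "site_embedding x m \<in> carrier \<AA>"
  using site_embedding_hom[of x] by (auto simp: star_hom_def mat2_complex_def)

text \<open>Pauli matrices span the algebra of a site, elementary tensors are products of one-site
  tensors and span each local algebra, and the local algebras are dense in \<AA>.\<close>

theorem spins_generate:
  assumes V: "cstar_subalgebra \<AA> V" and spin: "\<And>\<kappa> x. \<kappa> \<le> 3 \<Longrightarrow> spin A \<xi> \<phi> \<kappa> x \<in> V"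
  shows "V = carrier \<AA>"
proof
  interpret L: unital_cstar_algebra \<AA> by (rule limit_algebra)
  note D = L.cstar_subalgebraD[OF V]
  show "V \<subseteq> carrier \<AA>"
    by (rule D(1))
  have site: "site_embedding x m \<in> V" for x m
  proof -
    obtain c0 c1 c2 c3 where m: "m =
      (c0 \<odot>\<^bsub>mat2_complex\<^esub> pauli 0 \<oplus>\<^bsub>mat2_complex\<^esub> c1 \<odot>\<^bsub>mat2_complex\<^esub> pauli 1)
      \<oplus>\<^bsub>mat2_complex\<^esub> (c2 \<odot>\<^bsub>mat2_complex\<^esub> pauli 2 \<oplus>\<^bsub>mat2_complex\<^esub> c3 \<odot>\<^bsub>mat2_complex\<^esub> pauli 3)"
      using pauli_decomposition by blast
    have [simp]: "n \<in> carrier mat2_complex" for n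
      by (simp add: mat2_complex_def)
    have "site_embedding x m =
      (c0 \<odot>\<^bsub>\<AA>\<^esub> spin A \<xi> \<phi> 0 x \<oplus>\<^bsub>\<AA>\<^esub> c1 \<odot>\<^bsub>\<AA>\<^esub> spin A \<xi> \<phi> 1 x)
      \<oplus>\<^bsub>\<AA>\<^esub> (c2 \<odot>\<^bsub>\<AA>\<^esub> spin A \<xi> \<phi> 2 x \<oplus>\<^bsub>\<AA>\<^esub> c3 \<odot>\<^bsub>\<AA>\<^esub> spin A \<xi> \<phi> 3 x)"
      unfolding m spin_eq by (simp add: star_homD[OF site_embedding_hom])
    then show ?thesis
      using spin by (simp add: D(3,4))
  qed
  have one: "\<one>\<^bsub>\<AA>\<^esub> \<in> V"
    using site[of 0 "mat 1"] by (simp add: site_embedding_one)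
  have single: "\<phi> \<Lambda> (elementary_tensor A \<Lambda> (\<lambda>y. if y \<in> {x} then u y else \<one>\<^bsub>A y\<^esub>)) \<in> V"
    if "finite \<Lambda>" "x \<in> \<Lambda>" "u x \<in> carrier (A x)" for \<Lambda> x u
  proof -
    have "elementary_tensor A {x} u \<in> carrier (tensors {x})"
      using that by (intro elementary_tensor_closed) auto
    then have "\<phi> \<Lambda> (tensor_insertion A \<Lambda> {x} (elementary_tensor A {x} u)) = \<phi> {x} (elementary_tensor A {x} u)"
      using that by (intro local_compatible) auto
    moreover have "elementary_tensor A {x} u =
        elementary_tensor A {x} (\<lambda>_. inv_into (carrier (A x)) (\<xi> x) (\<xi> x (u x)))"
      using site_iso[of x] that by (intro elementary_tensor_cong) (simp add: star_iso_def bij_betw_def)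
    ultimately show ?thesis
      using site[of x "\<xi> x (u x)"] that tensor_insertion_elementary[of "{x}" \<Lambda> A u]
      by (simp add: site_embedding_eq site_one_closed)
  qed
  have elementary: "\<phi> \<Lambda> (elementary_tensor A \<Lambda> u) \<in> V"
    if \<Lambda>: "finite \<Lambda>" "\<Lambda> \<noteq> {}" and u: "\<And>x. x \<in> \<Lambda> \<Longrightarrow> u x \<in> carrier (A x)" for \<Lambda> u
  proof -
    \<comment> \<open>The sites of \<Lambda> are filled one by one, with units elsewhere: a new site
      \<open>x\<close> contributes the factor that is \<open>u x\<close> at \<open>x\<close> and a
      unit in all other slots.\<close>
    have partial: "\<phi> \<Lambda> (elementary_tensor A \<Lambda> (\<lambda>y. if y \<in> \<Delta> then u y else \<one>\<^bsub>A y\<^esub>)) \<in> V"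
      if "finite \<Delta>" "\<Delta> \<subseteq> \<Lambda>" for \<Delta>
      using that
    proof (induction \<Delta>)
      case empty
      show ?case
        using local_embedding_one[OF \<Lambda>] one by (simp add: tensor_algebra_def)
    next
      case (insert x \<Delta>)
      interpret S: unital_cstar_algebra "A y" for y by (rule site_algebra)
      let ?u = "\<lambda>y. if y \<in> \<Delta> then u y else \<one>\<^bsub>A y\<^esub>"
      let ?v = "\<lambda>y. if y \<in> {x} then u y else \<one>\<^bsub>A y\<^esub>"
      have closed: "?u y \<in> carrier (A y)" "?v y \<in> carrier (A y)" if "y \<in> \<Lambda>" for y
        using that u site_one_closed by auto
      have "elementary_tensor A \<Lambda> (\<lambda>y. if y \<in> insert x \<Delta> then u y else \<one>\<^bsub>A y\<^esub>) =
          elementary_tensor A \<Lambda> (\<lambda>y. ?u y \<otimes>\<^bsub>A y\<^esub> ?v y)"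
        using insert u ring.ring_simprules(6,12)[OF S.algebra_ring] monoid.r_one[OF ring.is_monoid[OF S.algebra_ring]]
        by (intro elementary_tensor_cong) auto
      also have "\<dots> = elementary_tensor A \<Lambda> ?u \<otimes>\<^bsub>tensors \<Lambda>\<^esub> elementary_tensor A \<Lambda> ?v"
        using closed by (intro elementary_tensor_mult[OF \<Lambda>, symmetric])
      also have "\<phi> \<Lambda> \<dots> = \<phi> \<Lambda> (elementary_tensor A \<Lambda> ?u) \<otimes>\<^bsub>\<AA>\<^esub> \<phi> \<Lambda> (elementary_tensor A \<Lambda> ?v)"
        using closed by (intro star_homD(4)[OF local_embedding_hom[OF \<Lambda>]] elementary_tensor_closed)
      also have "\<dots> \<in> V"
        using insert \<Lambda> u by (intro D(5) insert.IH single) auto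
      finally show ?case .
    qed
    have "elementary_tensor A \<Lambda> (\<lambda>y. if y \<in> \<Lambda> then u y else \<one>\<^bsub>A y\<^esub>) = elementary_tensor A \<Lambda> u"
      by (rule elementary_tensor_cong) simp
    then show ?thesis
      using partial[OF \<Lambda>(1) order_refl] by simp
  qed
  have "\<phi> \<Lambda> X \<in> V" if \<Lambda>: "finite \<Lambda>" "\<Lambda> \<noteq> {}" and X: "X \<in> carrier (tensors \<Lambda>)" for \<Lambda> X
  proof -
    note hom = star_homD[OF local_embedding_hom[OF \<Lambda>]]
    \<comment> \<open>Membership in \<open>formal_space\<close> is carried along because sums of
      classes are computed only for representatives in that space.\<close>
    have sum: "(\<Sum>u\<in>K. Poly_Mapping.single u (c u)) \<in> formal_space A \<Lambda> \<and>
        \<phi> \<Lambda> (tensor_rel A \<Lambda> `` {\<Sum>u\<in>K. Poly_Mapping.single u (c u)}) \<in> V"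
      if "finite K" "K \<subseteq> (\<Pi>\<^sub>E x\<in>\<Lambda>. carrier (A x))" for K and c :: "(int \<Rightarrow> 'b) \<Rightarrow> complex"
      using that
    proof (induction K)
      case empty
      have "\<zero>\<^bsub>tensors \<Lambda>\<^esub> = tensor_rel A \<Lambda> `` {0}"
        by (simp add: tensor_algebra_def)
      then have "\<phi> \<Lambda> (tensor_rel A \<Lambda> `` {0}) = \<zero>\<^bsub>\<AA>\<^esub>"
        using star_hom_minus(3)[OF local_algebra[OF \<Lambda>] limit_algebra local_embedding_hom[OF \<Lambda>]] by simp
      then show ?case
        using D(2) by (simp add: formal_space_def)
    next
      case (insert u K)
      let ?S = "\<Sum>u\<in>K. Poly_Mapping.single u (c u)"
      have IH: "?S \<in> formal_space A \<Lambda>" "\<phi> \<Lambda> (tensor_rel A \<Lambda> `` {?S}) \<in> V"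
        and u: "u \<in> (\<Pi>\<^sub>E x\<in>\<Lambda>. carrier (A x))"
        using insert by auto
      have s: "Poly_Mapping.single u d \<in> formal_space A \<Lambda>" for d
        by (rule formal_space_single[OF u])
      have "elementary_tensor A \<Lambda> u = tensor_rel A \<Lambda> `` {Poly_Mapping.single u 1}"
        using u by (simp add: elementary_tensor_def PiE_restrict)
      moreover have "\<phi> \<Lambda> (elementary_tensor A \<Lambda> u) \<in> V"
        using u by (intro elementary[OF \<Lambda>]) auto
      ultimately have "\<phi> \<Lambda> (tensor_rel A \<Lambda> `` {Poly_Mapping.single u 1}) \<in> V"
        by simp
      then have "\<phi> \<Lambda> (c u \<odot>\<^bsub>tensors \<Lambda>\<^esub> tensor_rel A \<Lambda> `` {Poly_Mapping.single u 1}) \<in> V"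
        by (simp add: hom tensor_class_in_carrier s D(4))
      then have "\<phi> \<Lambda> (tensor_rel A \<Lambda> `` {Poly_Mapping.single u (c u)}) \<in> V"
        by (simp add: tensor_smult_class[OF \<Lambda> s] formal_scale_single)
      then have "\<phi> \<Lambda> (tensor_rel A \<Lambda> `` {Poly_Mapping.single u (c u)} \<oplus>\<^bsub>tensors \<Lambda>\<^esub> tensor_rel A \<Lambda> `` {?S}) \<in> V"
        using IH by (simp add: hom tensor_class_in_carrier s D(3))
      then show ?case
        using IH s insert.hyps by (simp add: tensor_add_class[OF \<Lambda>] formal_space_add)
    qed
    obtain f where f: "f \<in> formal_space A \<Lambda>" "X = tensor_rel A \<Lambda> `` {f}"
      using X by (auto simp: tensor_algebra_def elim: quotientE)
    have "f = (\<Sum>u\<in>Poly_Mapping.keys f. Poly_Mapping.single u (Poly_Mapping.lookup f u))"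
      by (rule poly_mapping_eqI) (auto simp: lookup_sum lookup_single when_def in_keys_iff)
    then show ?thesis
      using sum[of "Poly_Mapping.keys f" "Poly_Mapping.lookup f"] f by (simp add: formal_space_def)
  qed
  then have "(\<Union>\<Lambda>\<in>{\<Lambda>. finite \<Lambda> \<and> \<Lambda> \<noteq> {}}. \<phi> \<Lambda> ` carrier (tensors \<Lambda>)) \<subseteq> V"
    by auto
  then show "carrier \<AA> \<subseteq> V"
    unfolding local_dense[symmetric] using D(7) by (rule closure_of_minimal)
qed

corollary star_hom_eq_of_spins:
  assumes "unital_cstar_algebra B" "star_hom \<AA> B f" "star_hom \<AA> B g"
    and "\<And>\<kappa> x. \<kappa> \<le> 3 \<Longrightarrow> f (spin A \<xi> \<phi> \<kappa> x) = g (spin A \<xi> \<phi> \<kappa> x)"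
    and "a \<in> carrier \<AA>"
  shows "f a = g a"
proof -
  have "{a \<in> carrier \<AA>. f a = g a} = carrier \<AA>"
    using assms(4) site_embedding_closed
    by (intro spins_generate cstar_subalgebra_equalizer[OF limit_algebra assms(1-3)])
      (simp add: spin_eq)
  then show ?thesis
    using assms(5) by blast
qed

end

section \<open>The extension by an involution\<close>

lemma star_hom_id: "star_hom A A (\<lambda>x. x)"
  by (simp add: star_hom_def)

lemma mk_mat2_nth [simp]:
  "mk_mat2 a b c d $ 1 $ 1 = a" "mk_mat2 a b c d $ 1 $ 2 = b"
  "mk_mat2 a b c d $ 2 $ 1 = c" "mk_mat2 a b c d $ 2 $ 2 = d"
  by (simp_all add: mk_mat2_def)

lemma mat2_eq_iff:
  "M = M' \<longleftrightarrow> M $ 1 $ 1 = M' $ 1 $ 1 \<and> M $ 1 $ 2 = M' $ 1 $ 2 \<and> M $ 2 $ 1 = M' $ 2 $ 1 \<and> M $ 2 $ 2 = M' $ 2 $ 2"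
  for M M' :: "'a^2^2"
  by (auto simp: vec_eq_iff forall_2)

section \<open>Even and odd parts\<close>

context unital_cstar_algebra
begin

lemma even_part_subalgebra:
  assumes \<theta>: "star_hom A A \<theta>" and V: "cstar_subalgebra A V"
  shows "cstar_subalgebra A (even_part \<theta> V)"
proof -
  have "even_part \<theta> V = V \<inter> {x \<in> carrier A. \<theta> x = x}"
    using cstar_subalgebraD(1)[OF V] by (auto simp: even_part_def)
  then show ?thesis
    using cstar_subalgebra_Int[OF V cstar_subalgebra_equalizer[OF unital_cstar_algebra_axioms
        unital_cstar_algebra_axioms \<theta> star_hom_id]] by simp
qed

text \<open>Negation is not multiplicative, so closedness comes from the equalizer of two continuous
  maps instead of the equalizer of two *-homomorphisms.\<close>

lemma odd_part_closed_linear_star_invariant: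
  assumes \<theta>: "star_hom A A \<theta>" and V: "cstar_subalgebra A V"
  shows "closed_linear_star_invariant A (odd_part A \<theta> V)"
proof -
  note D = cstar_subalgebraD[OF V] and \<theta>D = star_homD[OF \<theta>]
  have sub: "x \<in> carrier A" if "x \<in> V" for x
    using that D(1) by blast
  have "odd_part A \<theta> V = V \<inter> {x \<in> carrier A. \<theta> x = \<ominus> x}"
    using D(1) by (auto simp: odd_part_def)
  moreover have "closedin (norm_topology A) {x \<in> carrier A. \<theta> x = \<ominus> x}"
    using closedin_equalizer[OF star_hom_continuous continuous_map_uminus]
      unital_cstar_algebra_axioms \<theta> by fastforce
  ultimately have "closedin (norm_topology A) (odd_part A \<theta> V)"
    using D(7) by (simp add: closedin_Int)
  then show ?thesis
    unfolding closed_linear_star_invariant_def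
    by (auto simp: odd_part_def D \<theta>D sub alg_minus smult_minus_right star_minus)
qed

lemma closed_linear_star_invariant_submodule:
  assumes "closed_linear_star_invariant A V" "\<zero> \<in> V"
  shows "submodule V complex_ring A"
proof (rule submoduleI)
  show V: "V \<subseteq> carrier A"
    using assms closedin_subset[of "norm_topology A" V] by (auto simp: closed_linear_star_invariant_def)
  show "\<ominus> x \<in> V" if "x \<in> V" for x
    using that assms V minus_eq_smult[of x] by (auto simp: closed_linear_star_invariant_def)
qed (use assms in \<open>auto simp: closed_linear_star_invariant_def\<close>)

lemma even_odd_direct_sum:
  assumes \<theta>: "star_hom A A \<theta>" and V: "cstar_subalgebra A V"
    and inv: "\<And>x. x \<in> V \<Longrightarrow> \<theta> x \<in> V" "\<And>x. x \<in> V \<Longrightarrow> \<theta> (\<theta> x) = x"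
  shows "internal_direct_sum A V (even_part \<theta> V) (odd_part A \<theta> V)"
proof -
  note D = cstar_subalgebraD[OF V] and \<theta>D = star_homD[OF \<theta>]
  note \<theta>m = star_hom_minus[OF unital_cstar_algebra_axioms unital_cstar_algebra_axioms \<theta>]
  have sub: "x \<in> carrier A" if "x \<in> V" for x
    using that D(1) by blast
  have zero: "\<zero> \<in> odd_part A \<theta> V" "\<zero> \<in> even_part \<theta> V"
    using D(2) \<theta>m(3) by (auto simp: odd_part_def even_part_def alg_minus)
  have "V \<subseteq> even_part \<theta> V <+>\<^bsub>A\<^esub> odd_part A \<theta> V"
  proof
    fix x assume x: "x \<in> V"
    let ?e = "(1/2) \<odot> (x \<oplus> \<theta> x)" and ?o = "(1/2) \<odot> (x \<ominus> \<theta> x)"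
    have c: "x \<in> carrier A" "\<theta> x \<in> carrier A"
      using x inv(1) sub by auto
    have "?e \<in> even_part \<theta> V"
      using x inv c by (simp add: even_part_def D \<theta>D alg_a_ac)
    moreover have "\<theta> x \<ominus> x = \<ominus> (x \<ominus> \<theta> x)"
      using c by algebra
    then have "?o \<in> odd_part A \<theta> V"
      using x inv c by (simp add: odd_part_def D \<theta>D \<theta>m smult_minus_right)
    moreover have "(x \<oplus> \<theta> x) \<oplus> (x \<ominus> \<theta> x) = x \<oplus> x"
      using c by algebra
    then have "x = ?e \<oplus> ?o"
      using c half_double[of x] by (simp flip: smult_add_right)
    ultimately show "x \<in> even_part \<theta> V <+>\<^bsub>A\<^esub> odd_part A \<theta> V"
      unfolding set_add_def' by blast
  qed
  moreover have "even_part \<theta> V <+>\<^bsub>A\<^esub> odd_part A \<theta> V \<subseteq> V"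
    unfolding set_add_def' by (auto simp: even_part_def odd_part_def D(3))
  moreover have "x = \<zero>" if "x \<in> even_part \<theta> V" "x \<in> odd_part A \<theta> V" for x
    using that eq_minus_self_iff[of x] sub by (auto simp: even_part_def odd_part_def)
  moreover have "submodule (even_part \<theta> V) complex_ring A"
    using even_part_subalgebra[OF \<theta> V] by (simp add: cstar_subalgebra_def)
  moreover have "submodule (odd_part A \<theta> V) complex_ring A"
    using closed_linear_star_invariant_submodule[OF odd_part_closed_linear_star_invariant[OF \<theta> V]]
      zero by blast
  ultimately show ?thesis
    using zero unfolding internal_direct_sum_def by blast
qed

end

section \<open>The extension as a crossed product by the two-element group\<close>

locale involutive_extension =
  fixes \<AA> :: "'a cstar" (structure) and N :: "'a^2^2 \<Rightarrow> real" and \<Theta>' :: "'a \<Rightarrow> 'a"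
  assumes base: "unital_cstar_algebra \<AA>"
    and matrix: "unital_cstar_algebra (mat2_algebra \<AA> N)"
    and aut': "star_automorphism \<AA> \<Theta>'"
    and involution: "a \<in> carrier \<AA> \<Longrightarrow> \<Theta>' (\<Theta>' a) = a"
begin

sublocale base: unital_cstar_algebra \<AA>
  by (rule base)

sublocale matrix: unital_cstar_algebra "mat2_algebra \<AA> N"
  by (rule matrix)

abbreviation H :: "('a^2^2) cstar" where
  "H \<equiv> ext_algebra \<AA> N \<Theta>'"

text \<open>\<open>E a b\<close> is \<psi>(a) + \<psi>(b) T. In these coordinates T moves past
  \<psi>(c) at the price of \<Theta>', so the product is that of the crossed product of \<AA> by the
  two-element group acting through \<Theta>'.\<close>

definition E :: "'a \<Rightarrow> 'a \<Rightarrow> 'a^2^2" where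
  "E a b = mk_mat2 a b (\<Theta>' b) (\<Theta>' a)"

lemma hom': "star_hom \<AA> \<AA> \<Theta>'"
  using aut' by (simp add: star_iso_def)

lemmas theta'_simps [simp] = star_homD[OF hom'] star_hom_minus[OF base base hom']

lemma base_closed [simp]:
  "\<lbrakk>a \<in> carrier \<AA>; b \<in> carrier \<AA>\<rbrakk> \<Longrightarrow> a \<oplus> b \<in> carrier \<AA>"
  "\<lbrakk>a \<in> carrier \<AA>; b \<in> carrier \<AA>\<rbrakk> \<Longrightarrow> a \<otimes> b \<in> carrier \<AA>"
  "a \<in> carrier \<AA> \<Longrightarrow> star \<AA> a \<in> carrier \<AA>"
  "a \<in> carrier \<AA> \<Longrightarrow> c \<odot> a \<in> carrier \<AA>"
  "a \<in> carrier \<AA> \<Longrightarrow> \<ominus> a \<in> carrier \<AA>"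
  "\<one> \<in> carrier \<AA>" "\<zero> \<in> carrier \<AA>"
  using ring.ring_simprules(1-6)[OF base.algebra_ring] base.star_closed by auto

lemma base_units [simp]:
  assumes "a \<in> carrier \<AA>"
  shows "\<one> \<otimes> a = a" "a \<otimes> \<one> = a" "\<zero> \<otimes> a = \<zero>" "a \<otimes> \<zero> = \<zero>" "\<zero> \<oplus> a = a" "a \<oplus> \<zero> = a"
  using ring.ring_simprules[OF base.algebra_ring] monoid.r_one[OF ring.is_monoid[OF base.algebra_ring]] assms
  by auto

lemma theta'_one [simp]: "\<Theta>' \<one> = \<one>"
  using star_iso_one[OF _ _ aut'] ring.is_monoid[OF base.algebra_ring] by blast

lemma E_eq_iff [simp]: "E a b = E c d \<longleftrightarrow> a = c \<and> b = d"
  by (auto simp: E_def mat2_eq_iff)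

lemma E_closed [simp]: "\<lbrakk>a \<in> carrier \<AA>; b \<in> carrier \<AA>\<rbrakk> \<Longrightarrow> E a b \<in> carrier H"
  by (auto simp: E_def ext_algebra_def)

lemma E_cases:
  assumes "X \<in> carrier H"
  obtains a b where "a \<in> carrier \<AA>" "b \<in> carrier \<AA>" "X = E a b"
  using assms by (auto simp: E_def ext_algebra_def)

lemma E_add:
  "\<lbrakk>a \<in> carrier \<AA>; b \<in> carrier \<AA>; c \<in> carrier \<AA>; d \<in> carrier \<AA>\<rbrakk> \<Longrightarrow>
    E a b \<oplus>\<^bsub>H\<^esub> E c d = E (a \<oplus> c) (b \<oplus> d)"
  by (simp add: E_def ext_algebra_def mat2_algebra_def mat2_eq_iff)

lemma E_mult:
  "\<lbrakk>a \<in> carrier \<AA>; b \<in> carrier \<AA>; c \<in> carrier \<AA>; d \<in> carrier \<AA>\<rbrakk> \<Longrightarrow>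
    E a b \<otimes>\<^bsub>H\<^esub> E c d = E (a \<otimes> c \<oplus> b \<otimes> \<Theta>' d) (a \<otimes> d \<oplus> b \<otimes> \<Theta>' c)"
  by (simp add: E_def ext_algebra_def mat2_algebra_def mat2_eq_iff involution base.alg_a_ac)

lemma E_smult: "\<lbrakk>a \<in> carrier \<AA>; b \<in> carrier \<AA>\<rbrakk> \<Longrightarrow> c \<odot>\<^bsub>H\<^esub> E a b = E (c \<odot> a) (c \<odot> b)"
  by (simp add: E_def ext_algebra_def mat2_algebra_def mat2_eq_iff)

lemma E_star: "\<lbrakk>a \<in> carrier \<AA>; b \<in> carrier \<AA>\<rbrakk> \<Longrightarrow> star H (E a b) = E (star \<AA> a) (\<Theta>' (star \<AA> b))"
  by (simp add: E_def ext_algebra_def mat2_algebra_def mat2_eq_iff involution)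

lemma E_one: "\<one>\<^bsub>H\<^esub> = E \<one> \<zero>"
  by (simp add: E_def ext_algebra_def mat2_algebra_def mat2_eq_iff)

lemma E_zero: "\<zero>\<^bsub>H\<^esub> = E \<zero> \<zero>"
  by (simp add: E_def ext_algebra_def mat2_algebra_def mat2_eq_iff)

lemma ext_flip_eq: "ext_flip \<AA> = E \<zero> \<one>"
  by (simp add: E_def ext_flip_def)

lemma ext_embed_eq: "ext_embed \<AA> \<Theta>' a = E a \<zero>"
  by (simp add: E_def ext_embed_def)

text \<open>The extension is the fixed point algebra of \<open>\<Theta>'\<close> applied entrywise and conjugated by \<open>T\<close>.\<close>

sublocale ext: unital_cstar_algebra H
proof -
  let ?M = "mat2_algebra \<AA> N"
  define \<alpha> where "\<alpha> M = mk_mat2 (\<Theta>' (M $ 2 $ 2)) (\<Theta>' (M $ 2 $ 1)) (\<Theta>' (M $ 1 $ 2)) (\<Theta>' (M $ 1 $ 1))"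
    for M :: "'a^2^2"
  have carrier: "M \<in> carrier ?M \<longleftrightarrow> M $ 1 $ 1 \<in> carrier \<AA> \<and> M $ 1 $ 2 \<in> carrier \<AA> \<and>
      M $ 2 $ 1 \<in> carrier \<AA> \<and> M $ 2 $ 2 \<in> carrier \<AA>" for M
    by (auto simp: mat2_algebra_def forall_2)
  have "star_hom ?M ?M \<alpha>"
    unfolding star_hom_def
    by (auto simp: carrier \<alpha>_def) (auto simp: mat2_algebra_def mat2_eq_iff base.alg_a_ac)
  then have "cstar_subalgebra ?M {M \<in> carrier ?M. \<alpha> M = M}"
    using cstar_subalgebra_equalizer[OF matrix matrix _ star_hom_id] by blast
  moreover have "{M \<in> carrier ?M. \<alpha> M = M} = carrier H"
  proof (intro equalityI subsetI)
    fix M assume "M \<in> {M \<in> carrier ?M. \<alpha> M = M}"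
    then have "M = E (M $ 1 $ 1) (M $ 1 $ 2)" "M $ 1 $ 1 \<in> carrier \<AA>" "M $ 1 $ 2 \<in> carrier \<AA>"
      by (auto simp: \<alpha>_def carrier E_def mat2_eq_iff)
    then show "M \<in> carrier H"
      by (metis E_closed)
  next
    fix M assume "M \<in> carrier H"
    then show "M \<in> {M \<in> carrier ?M. \<alpha> M = M}"
      by (auto elim!: E_cases simp: E_def carrier \<alpha>_def involution)
  qed
  moreover have "\<one>\<^bsub>?M\<^esub> \<in> carrier H"
    using E_one E_closed[of \<one> \<zero>] by (simp add: ext_algebra_def)
  ultimately have "unital_cstar_subalgebra ?M (carrier H)"
    by (simp add: unital_cstar_subalgebra_def)
  then have "unital_cstar_algebra (?M\<lparr>carrier := carrier H\<rparr>)"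
    by (rule matrix.unital_cstar_algebra_restrict)
  then show "unital_cstar_algebra H"
    by (simp add: ext_algebra_def)
qed

lemma E_uminus: "\<lbrakk>a \<in> carrier \<AA>; b \<in> carrier \<AA>\<rbrakk> \<Longrightarrow> \<ominus>\<^bsub>H\<^esub> E a b = E (\<ominus> a) (\<ominus> b)"
  by (simp add: ext.minus_eq_smult E_smult base.minus_eq_smult)

lemma ext_embed_hom: "star_hom \<AA> H (\<lambda>a. E a \<zero>)"
  by (auto simp: star_hom_def E_add E_mult E_smult E_star)

text \<open>One construction yields four maps: \<open>\<Theta>\<close> with sign 1 is the
  automorphism sought, with sign -1 the grading \<open>\<alpha>\<close>; \<open>\<Theta>'\<close>
  with sign 1 is conjugation by T; the identity with sign -1 has \<open>diag_part\<close> as its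
  fixed points.\<close>

definition ext_map :: "('a \<Rightarrow> 'a) \<Rightarrow> complex \<Rightarrow> 'a^2^2 \<Rightarrow> 'a^2^2" where
  "ext_map f s M = E (f (M $ 1 $ 1)) (s \<odot> f (M $ 1 $ 2))"

lemma ext_map_E [simp]: "ext_map f s (E a b) = E (f a) (s \<odot> f b)"
  by (simp add: ext_map_def E_def)

text \<open>Two T-coefficients multiply into the diagonal and pick up \<open>s * s\<close>, and the
  involution conjugates \<open>s\<close>; hence the conditions on \<open>s\<close>. Commutation with
  \<Theta>' enters because products and adjoints twist coefficients by \<Theta>'.\<close>

lemma ext_map_hom:
  assumes f: "star_hom \<AA> \<AA> f" and comm: "\<And>a. a \<in> carrier \<AA> \<Longrightarrow> f (\<Theta>' a) = \<Theta>' (f a)"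
    and s: "s * s = 1" "cnj s = s"
  shows "star_hom H H (ext_map f s)"
proof -
  note f = star_homD[OF f]
  show ?thesis
    unfolding star_hom_def
    by (auto elim!: E_cases simp: E_add E_mult E_smult E_star f comm s base.smult_mult_left
        base.smult_mult_right base.smult_smult base.smult_add_right base.star_smult mult.commute)
qed

lemma ext_map_iso:
  assumes f: "star_automorphism \<AA> f" and comm: "\<And>a. a \<in> carrier \<AA> \<Longrightarrow> f (\<Theta>' a) = \<Theta>' (f a)"
  shows "star_automorphism H (ext_map f 1)"
proof -
  have bij: "bij_betw f (carrier \<AA>) (carrier \<AA>)" and hom: "star_hom \<AA> \<AA> f"
    using f by (auto simp: star_iso_def)
  have closed: "f a \<in> carrier \<AA>" if "a \<in> carrier \<AA>" for a
    using that star_homD(1)[OF hom] by blast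
  have "inj_on (ext_map f 1) (carrier H)"
    using bij by (auto simp: inj_on_def bij_betw_def closed elim!: E_cases)
  moreover have "X \<in> ext_map f 1 ` carrier H" if X: "X \<in> carrier H" for X
  proof -
    obtain a b where ab: "a \<in> carrier \<AA>" "b \<in> carrier \<AA>" "X = E a b"
      using X by (rule E_cases)
    then have "a \<in> f ` carrier \<AA>" "b \<in> f ` carrier \<AA>"
      using bij by (simp_all add: bij_betw_def)
    then obtain c d where "c \<in> carrier \<AA>" "d \<in> carrier \<AA>" "f c = a" "f d = b"
      by blast
    then have "X = ext_map f 1 (E c d)" "E c d \<in> carrier H"
      using ab by auto
    then show ?thesis
      by blast
  qed
  ultimately have "bij_betw (ext_map f 1) (carrier H) (carrier H)"
    using star_homD(1)[OF ext_map_hom[OF hom comm]] by (auto simp: bij_betw_def)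
  then show ?thesis
    using ext_map_hom[OF hom comm] by (simp add: star_iso_def)
qed

lemma ext_map_fixed_points:
  assumes "star_hom \<AA> \<AA> f" "\<And>a. a \<in> carrier \<AA> \<Longrightarrow> f (\<Theta>' a) = \<Theta>' (f a)" "s * s = 1" "cnj s = s"
  shows "cstar_subalgebra H {X \<in> carrier H. ext_map f s X = X}"
  using cstar_subalgebra_equalizer[OF _ _ ext_map_hom[OF assms] star_hom_id]
    ext.unital_cstar_algebra_axioms by blast

lemma diag_part_eq: "diag_part \<AA> \<Theta>' = (\<lambda>a. E a \<zero>) ` carrier \<AA>"
  by (auto simp: diag_part_def E_def)

text \<open>Describing the diagonal elements as the fixed points of
  \<open>E a b \<mapsto> E a (\<ominus> b)\<close> gives closedness without access to the norm
  \<open>N\<close>.\<close>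

lemma diag_part_subalgebra: "cstar_subalgebra H (diag_part \<AA> \<Theta>')"
proof -
  have "{X \<in> carrier H. ext_map (\<lambda>a. a) (-1) X = X} = diag_part \<AA> \<Theta>'"
  proof (intro equalityI subsetI)
    fix X assume X: "X \<in> {X \<in> carrier H. ext_map (\<lambda>a. a) (-1) X = X}"
    then obtain a b where ab: "a \<in> carrier \<AA>" "b \<in> carrier \<AA>" "X = E a b"
      by (auto elim: E_cases)
    with X have "b = \<zero>"
      using base.eq_minus_self_iff[of b] base.minus_eq_smult[of b] by simp
    with ab show "X \<in> diag_part \<AA> \<Theta>'"
      by (simp add: diag_part_eq)
  qed (auto simp: diag_part_eq)
  then show ?thesis
    using ext_map_fixed_points[OF star_hom_id, of "-1"] by simp
qed

end

section \<open>The algebra of the annihilators\<close>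

locale spin_extension = spin_algebra A \<xi> \<nu> \<AA> \<phi>
  for A :: "int \<Rightarrow> 'b cstar" and \<xi> \<nu> and \<AA> :: "'a cstar" (structure) and \<phi> +
  fixes N :: "'a^2^2 \<Rightarrow> real" and \<Theta> \<Theta>' :: "'a \<Rightarrow> 'a"
  assumes theta_aut: "star_automorphism \<AA> \<Theta>"
    and theta_spin: "\<kappa> \<le> 3 \<Longrightarrow> \<Theta> (spin A \<xi> \<phi> \<kappa> x) = pauli_sign \<kappa> \<odot> spin A \<xi> \<phi> \<kappa> x"
    and theta'_aut: "star_automorphism \<AA> \<Theta>'"
    and theta'_spin_pos: "\<lbrakk>\<kappa> \<le> 3; 1 \<le> x\<rbrakk> \<Longrightarrow> \<Theta>' (spin A \<xi> \<phi> \<kappa> x) = spin A \<xi> \<phi> \<kappa> x"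
    and theta'_spin_neg:
      "\<lbrakk>\<kappa> \<le> 3; x \<le> 0\<rbrakk> \<Longrightarrow> \<Theta>' (spin A \<xi> \<phi> \<kappa> x) = pauli_sign \<kappa> \<odot> spin A \<xi> \<phi> \<kappa> x"
    and matrix_algebra: "unital_cstar_algebra (mat2_algebra \<AA> N)"
begin

abbreviation \<sigma> :: "nat \<Rightarrow> int \<Rightarrow> 'a" where
  "\<sigma> \<equiv> spin A \<xi> \<phi>"

lemma theta_hom: "star_hom \<AA> \<AA> \<Theta>" and theta'_hom: "star_hom \<AA> \<AA> \<Theta>'"
  using theta_aut theta'_aut by (auto simp: star_iso_def)

lemma spin_closed: "\<sigma> \<kappa> x \<in> carrier \<AA>"
  by (simp add: spin_eq site_embedding_closed)

lemma pauli_sign_square: "pauli_sign \<kappa> * pauli_sign \<kappa> = 1"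
  by (simp add: pauli_sign_def)

lemma theta'_spin:
  "\<kappa> \<le> 3 \<Longrightarrow> \<Theta>' (\<sigma> \<kappa> x) = (if 1 \<le> x then 1 else pauli_sign \<kappa>) \<odot> \<sigma> \<kappa> x"
  using theta'_spin_pos theta'_spin_neg[of \<kappa> x] unital_cstar_algebra.smult_1[OF limit_algebra spin_closed]
  by auto

lemma spin_signs:
  assumes "\<kappa> \<le> 3"
  shows "\<Theta>' (\<Theta>' (\<sigma> \<kappa> x)) = \<sigma> \<kappa> x" "\<Theta> (\<Theta> (\<sigma> \<kappa> x)) = \<sigma> \<kappa> x"
    "\<Theta> (\<Theta>' (\<sigma> \<kappa> x)) = \<Theta>' (\<Theta> (\<sigma> \<kappa> x))"
proof -
  interpret L: unital_cstar_algebra \<AA> by (rule limit_algebra)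
  show "\<Theta>' (\<Theta>' (\<sigma> \<kappa> x)) = \<sigma> \<kappa> x" "\<Theta> (\<Theta> (\<sigma> \<kappa> x)) = \<sigma> \<kappa> x"
    "\<Theta> (\<Theta>' (\<sigma> \<kappa> x)) = \<Theta>' (\<Theta> (\<sigma> \<kappa> x))"
    using assms
    by (simp_all add: theta_spin theta'_spin spin_closed star_homD(3)[OF theta_hom]
        star_homD(3)[OF theta'_hom] L.smult_smult pauli_sign_square mult.commute)
qed

lemma theta'_involution: "a \<in> carrier \<AA> \<Longrightarrow> \<Theta>' (\<Theta>' a) = a"
  using star_hom_eq_of_spins[OF limit_algebra star_hom_comp[OF theta'_hom theta'_hom] star_hom_id]
  by (simp add: spin_signs)

lemma theta_involution: "a \<in> carrier \<AA> \<Longrightarrow> \<Theta> (\<Theta> a) = a"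
  using star_hom_eq_of_spins[OF limit_algebra star_hom_comp[OF theta_hom theta_hom] star_hom_id]
  by (simp add: spin_signs)

lemma theta_commute: "a \<in> carrier \<AA> \<Longrightarrow> \<Theta> (\<Theta>' a) = \<Theta>' (\<Theta> a)"
  using star_hom_eq_of_spins[OF limit_algebra star_hom_comp[OF theta'_hom theta_hom]
      star_hom_comp[OF theta_hom theta'_hom]]
  by (simp add: spin_signs)

sublocale involutive_extension \<AA> N \<Theta>'
  using limit_algebra matrix_algebra theta'_aut theta'_involution by (rule involutive_extension.intro)

lemmas theta_simps [simp] = star_homD[OF theta_hom] star_hom_minus[OF base base theta_hom]

lemma theta_one [simp]: "\<Theta> \<one> = \<one>"
  using star_iso_one[OF _ _ theta_aut] ring.is_monoid[OF base.algebra_ring] by blast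

section \<open>Strings of spins and lowering operators\<close>

abbreviation (input) S :: "int \<Rightarrow> 'a" where
  "S \<equiv> spin_string \<AA> \<sigma>"

abbreviation \<sigma>m :: "int \<Rightarrow> 'a" where
  "\<sigma>m \<equiv> spin_minus \<AA> \<sigma>"

lemma pauli_3: "pauli 3 = mk_mat2 1 0 0 (- 1)"
  by (simp add: pauli_def)

lemma spin_3_unitary: "star \<AA> (\<sigma> 3 x) \<otimes> \<sigma> 3 x = \<one>"
proof -
  have "(\<chi> i j. cnj (pauli 3 $ j $ i)) ** pauli 3 = mat 1"
    by (simp add: pauli_3 mat2_eq_iff matrix_matrix_mult_def sum_2 mat_def)
  then show ?thesis
    by (simp add: spin_eq site_embedding_star site_embedding_mult site_embedding_one)
qed

lemma theta_spin_3: "\<Theta> (\<sigma> 3 x) = \<sigma> 3 x" "\<Theta>' (\<sigma> 3 x) = \<sigma> 3 x"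
  using theta_spin[of 3 x] theta'_spin[of 3 x] spin_closed[of 3 x] by (auto simp: pauli_sign_def)

text \<open>Both branches of \<open>spin_string\<close> fold \<open>\<sigma> 3\<close> over a list
  of sites, so induction over an arbitrary list treats positive and nonpositive sites
  together.\<close>

lemma spin_string_induct:
  assumes "P \<one>" "\<And>x s. \<lbrakk>s \<in> carrier \<AA>; P s\<rbrakk> \<Longrightarrow> P (\<sigma> 3 x \<otimes> s)"
  shows "P (S x)"
proof -
  have "foldr (\<lambda>y s. \<sigma> 3 y \<otimes> s) ys \<one> \<in> carrier \<AA> \<and> P (foldr (\<lambda>y s. \<sigma> 3 y \<otimes> s) ys \<one>)" for ys
    by (induction ys) (auto simp: assms spin_closed)
  then show ?thesis
    by (simp add: spin_string_def)
qed

lemma spin_string_closed [simp]: "S x \<in> carrier \<AA>"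
  by (rule spin_string_induct) (auto simp: spin_closed)

lemma theta_spin_string: "\<Theta> (S x) = S x" "\<Theta>' (S x) = S x"
  by (rule spin_string_induct; simp add: spin_closed theta_spin_3)+

text \<open>The innermost pair of adjacent factors cancels, one site at a time. This is what later
  strips the string off \<open>S x \<otimes> \<sigma>m x\<close>.\<close>

lemma spin_string_isometry: "star \<AA> (S x) \<otimes> S x = \<one>"
proof (rule spin_string_induct)
  fix x s assume s: "s \<in> carrier \<AA>" "star \<AA> s \<otimes> s = \<one>"
  have "star \<AA> (\<sigma> 3 x \<otimes> s) \<otimes> (\<sigma> 3 x \<otimes> s) = star \<AA> s \<otimes> (star \<AA> (\<sigma> 3 x) \<otimes> \<sigma> 3 x \<otimes> s)"
    using s by (simp add: base.star_mult spin_closed base.alg_m_assoc)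
  then show "star \<AA> (\<sigma> 3 x \<otimes> s) \<otimes> (\<sigma> 3 x \<otimes> s) = \<one>"
    using s by (simp add: spin_3_unitary)
qed simp

lemma spin_minus_eq: "\<sigma>m x = site_embedding x (mk_mat2 0 0 1 0)"
proof -
  have "\<sigma>m x = (1/2) \<odot> (\<sigma> 1 x \<oplus> (-1) \<odot> (\<i> \<odot> \<sigma> 2 x))"
    by (simp add: spin_minus_def a_minus_def base.minus_eq_smult spin_closed)
  also have "\<dots> = site_embedding x (mk_mat2 0 0 1 0)"
    unfolding spin_eq site_embedding_smult site_embedding_add
    by (rule arg_cong[of _ _ "site_embedding x"]) (simp add: pauli_def mat2_eq_iff)
  finally show ?thesis .
qed

lemma spin_minus_closed [simp]: "\<sigma>m x \<in> carrier \<AA>"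
  by (simp add: spin_minus_eq site_embedding_closed)

lemma theta_spin_minus: "\<Theta> (\<sigma>m x) = \<ominus> \<sigma>m x"
  and theta'_spin_minus: "\<Theta>' (\<sigma>m x) = (if 1 \<le> x then \<sigma>m x else \<ominus> \<sigma>m x)"
proof -
  have m: "\<sigma>m x = (1/2) \<odot> (\<sigma> 1 x \<oplus> (-\<i>) \<odot> \<sigma> 2 x)"
    by (simp add: spin_minus_def a_minus_def base.minus_eq_smult spin_closed base.smult_smult)
  show "\<Theta> (\<sigma>m x) = \<ominus> \<sigma>m x"
    unfolding m using theta_spin[of 1 x] theta_spin[of 2 x]
    by (simp add: spin_closed base.minus_eq_smult base.smult_smult base.smult_add_right pauli_sign_def)
  show "\<Theta>' (\<sigma>m x) = (if 1 \<le> x then \<sigma>m x else \<ominus> \<sigma>m x)"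
    unfolding m using theta'_spin[of 1 x] theta'_spin[of 2 x]
    by (simp add: spin_closed base.minus_eq_smult base.smult_smult base.smult_add_right pauli_sign_def)
qed

lemma spin_minus_products:
  "star \<AA> (\<sigma>m x) \<otimes> \<sigma>m x = site_embedding x (mk_mat2 1 0 0 0)"
  "\<sigma>m x \<otimes> star \<AA> (\<sigma>m x) = site_embedding x (mk_mat2 0 0 0 1)"
  unfolding spin_minus_eq site_embedding_star site_embedding_mult
  by (rule arg_cong[of _ _ "site_embedding x"],
      simp add: mat2_eq_iff matrix_matrix_mult_def sum_2)+

section \<open>The annihilators and elements of the C*-algebra they generate\<close>

abbreviation a :: "int \<Rightarrow> 'a^2^2" where
  "a \<equiv> annihilator \<AA> N \<Theta>' \<sigma>"

abbreviation T :: "'a^2^2" where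
  "T \<equiv> E \<zero> \<one>"

abbreviation H0 :: "('a^2^2) set" where
  "H0 \<equiv> diag_part \<AA> \<Theta>'"

abbreviation H1 :: "('a^2^2) set" where
  "H1 \<equiv> car_part \<AA> N \<Theta>' \<sigma>"

lemma theta_string_minus: "\<Theta> (S x \<otimes> \<sigma>m x) = \<ominus> (S x \<otimes> \<sigma>m x)"
  and theta'_string_minus:
    "\<Theta>' (S x \<otimes> \<sigma>m x) = (if 1 \<le> x then S x \<otimes> \<sigma>m x else \<ominus> (S x \<otimes> \<sigma>m x))"
  by (simp_all add: theta_spin_string theta_spin_minus theta'_spin_minus base.alg_minus)

text \<open>T \<psi>(c) = \<psi>(\<Theta>' c) T, so an annihilator has only a T-coordinate.\<close>

lemma annihilator_eq: "a x = E \<zero> (\<Theta>' (S x \<otimes> \<sigma>m x))"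
  by (simp add: annihilator_def ext_flip_eq ext_embed_eq E_mult)

lemma annihilator_closed: "a x \<in> carrier H"
  by (simp add: annihilator_eq)

lemma car_part_subalgebra: "cstar_subalgebra H H1" and annihilator_in_car_part: "a x \<in> H1"
  using ext.cstar_generated[of "range a"] annihilator_closed by (auto simp: car_part_def)

lemmas carD = ext.cstar_subalgebraD[OF car_part_subalgebra]

lemma flip_closed [simp]: "T \<in> carrier H"
  by simp

lemma flip_flip [simp]: "T \<otimes>\<^bsub>H\<^esub> T = \<one>\<^bsub>H\<^esub>"
  by (simp add: E_mult E_one)

text \<open>Both the twist by \<Theta>' and the string cancel, leaving a one-site operator: the
  projection onto spin up at \<open>x\<close>.\<close>

lemma number_operator: "star H (a x) \<otimes>\<^bsub>H\<^esub> a x = E (star \<AA> (\<sigma>m x) \<otimes> \<sigma>m x) \<zero>"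
proof -
  let ?c = "S x \<otimes> \<sigma>m x"
  \<comment> \<open>Without the deletion, \<open>theta'_simps(4)\<close> would distribute \<Theta>'
    over the product and hide the double application that \<open>involution\<close> removes.\<close>
  have "star H (a x) \<otimes>\<^bsub>H\<^esub> a x = E (star \<AA> ?c \<otimes> ?c) \<zero>"
    by (simp add: annihilator_eq E_star E_mult involution del: theta'_simps(4))
  also have "star \<AA> ?c \<otimes> ?c = star \<AA> (\<sigma>m x) \<otimes> (star \<AA> (S x) \<otimes> S x \<otimes> \<sigma>m x)"
    by (simp add: base.star_mult base.alg_m_assoc)
  finally show ?thesis
    by (simp add: spin_string_isometry)
qed

text \<open>\<open>cstar_generated\<close> is not unital by definition, so the unit has to be
  produced. At site 1 the string is empty and \<Theta>' acts trivially, so the two products of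
  \<open>a 1\<close> with its adjoint are the two diagonal matrix units.\<close>

lemma one_in_car_part: "\<one>\<^bsub>H\<^esub> \<in> H1"
proof -
  have "spin_string \<AA> \<sigma> 1 = \<one>"
    by (simp add: spin_string_def)
  then have "a 1 = E \<zero> (\<sigma>m 1)"
    by (simp add: annihilator_eq theta'_spin_minus)
  then have "a 1 \<otimes>\<^bsub>H\<^esub> star H (a 1) = E (\<sigma>m 1 \<otimes> star \<AA> (\<sigma>m 1)) \<zero>"
    by (simp add: E_star E_mult involution)
  then have "star H (a 1) \<otimes>\<^bsub>H\<^esub> a 1 \<oplus>\<^bsub>H\<^esub> a 1 \<otimes>\<^bsub>H\<^esub> star H (a 1) =
      E (site_embedding 1 (mk_mat2 1 0 0 0 + mk_mat2 0 0 0 1)) \<zero>"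
    by (simp add: number_operator spin_minus_products E_add site_embedding_add site_embedding_closed)
  also have "mk_mat2 1 0 0 0 + mk_mat2 0 0 0 1 = (mat 1 :: complex^2^2)"
    by (simp add: mat2_eq_iff mat_def)
  finally have "star H (a 1) \<otimes>\<^bsub>H\<^esub> a 1 \<oplus>\<^bsub>H\<^esub> a 1 \<otimes>\<^bsub>H\<^esub> star H (a 1) = \<one>\<^bsub>H\<^esub>"
    by (simp add: site_embedding_one E_one)
  then show ?thesis
    using carD(3,5,6) annihilator_in_car_part by metis
qed

text \<open>\<open>\<sigma>\<^sub>3 = 2 \<sigma>\<^sub>+ \<sigma>\<^sub>- - 1\<close>, and the first
  term is twice the number operator.\<close>

lemma spin_3_in_car_part: "E (\<sigma> 3 x) \<zero> \<in> H1"
proof -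
  have "2 \<odot>\<^bsub>H\<^esub> (star H (a x) \<otimes>\<^bsub>H\<^esub> a x) \<oplus>\<^bsub>H\<^esub> (-1) \<odot>\<^bsub>H\<^esub> \<one>\<^bsub>H\<^esub> =
      E (2 \<odot> site_embedding x (mk_mat2 1 0 0 0) \<oplus> (-1) \<odot> site_embedding x (mat 1)) \<zero>"
    by (simp add: number_operator spin_minus_products E_one E_smult E_add site_embedding_closed
        site_embedding_one)
  also have "2 \<odot> site_embedding x (mk_mat2 1 0 0 0) \<oplus> (-1) \<odot> site_embedding x (mat 1) = \<sigma> 3 x"
    unfolding spin_eq site_embedding_smult site_embedding_add
    by (rule arg_cong[of _ _ "site_embedding x"]) (simp add: pauli_3 mat2_eq_iff mat_def)
  finally show ?thesis
    using carD(3-6) one_in_car_part annihilator_in_car_part by metis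
qed

lemma spin_string_in_car_part: "E (S x) \<zero> \<in> H1"
proof (rule spin_string_induct)
  show "E \<one> \<zero> \<in> H1"
    using one_in_car_part by (simp add: E_one)
  fix x s assume "s \<in> carrier \<AA>" "E s \<zero> \<in> H1"
  then show "E (\<sigma> 3 x \<otimes> s) \<zero> \<in> H1"
    using carD(5)[OF spin_3_in_car_part[of x], of "E s \<zero>"] by (simp add: E_mult spin_closed)
qed

lemma flip_conjugate:
  "\<lbrakk>b \<in> carrier \<AA>; c \<in> carrier \<AA>\<rbrakk> \<Longrightarrow> T \<otimes>\<^bsub>H\<^esub> E b c \<otimes>\<^bsub>H\<^esub> T = ext_map \<Theta>' 1 (E b c)"
  by (simp add: E_mult)

text \<open>Conjugation by T sends the generator \<open>a x\<close> to itself if x \<ge> 1 and to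
  its negative if x \<le> 0. The preimage of \<open>H1\<close> under it is a C*-subalgebra with all
  generators, hence contains \<open>H1\<close>.\<close>

lemma flip_conjugate_car_part:
  assumes X: "X \<in> H1"
  shows "T \<otimes>\<^bsub>H\<^esub> X \<otimes>\<^bsub>H\<^esub> T \<in> H1"
proof -
  have hom: "star_hom H H (ext_map \<Theta>' 1)"
    by (rule ext_map_hom[OF theta'_hom]) auto
  have "ext_map \<Theta>' 1 (a x) \<in> H1" for x
  proof -
    have "ext_map \<Theta>' 1 (a x) = (if 1 \<le> x then a x else \<ominus>\<^bsub>H\<^esub> a x)"
      using theta'_string_minus[of x]
      by (simp add: annihilator_eq E_uminus base.alg_minus del: theta'_simps(4))
    then show ?thesis
      using annihilator_in_car_part[of x] carD(8) by simp
  qed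
  then have "H1 \<subseteq> {X \<in> carrier H. ext_map \<Theta>' 1 X \<in> H1}"
    unfolding car_part_def
    using cstar_subalgebra_preimage[OF _ _ hom car_part_subalgebra] annihilator_closed
      ext.unital_cstar_algebra_axioms
    by (intro ext.cstar_generated_minimal) (auto simp: car_part_def)
  then have "X \<in> carrier H" "ext_map \<Theta>' 1 X \<in> H1"
    using X by auto
  then show ?thesis
    by (auto elim!: E_cases simp: flip_conjugate)
qed

section \<open>The algebra \<open>graded\<close>, called K in the overview, as an upper bound for
  \<open>H1\<close>\<close>

definition graded :: "('a^2^2) set" where
  "graded = {E b c | b c. b \<in> carrier \<AA> \<and> c \<in> carrier \<AA> \<and> \<Theta> b = b \<and> \<Theta> c = \<ominus> c}"

text \<open>The sum of the even diagonal part and the odd off-diagonal part is the fixed point algebra of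
  \<open>\<psi>(a) + \<psi>(b) T \<mapsto> \<psi>(\<Theta> a) - \<psi>(\<Theta> b) T\<close>.\<close>

abbreviation \<alpha> :: "'a^2^2 \<Rightarrow> 'a^2^2" where
  "\<alpha> \<equiv> ext_map \<Theta> (-1)"

lemma alpha_hom: "star_hom H H \<alpha>"
  by (rule ext_map_hom[OF theta_hom theta_commute]) auto

lemma graded_eq: "graded = {X \<in> carrier H. \<alpha> X = X}"
proof -
  have "(-1) \<odot> c = d \<longleftrightarrow> c = \<ominus> d" if "c \<in> carrier \<AA>" "d \<in> carrier \<AA>" for c d
    using that base.minus_eq_smult[of c] base.alg_minus(2)[of c] base.alg_minus(2)[of d] by auto
  then show ?thesis
    by (auto simp: graded_def elim!: E_cases)
qed

lemma car_part_subset_graded: "H1 \<subseteq> graded"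
proof -
  have "cstar_subalgebra H graded"
    unfolding graded_eq by (rule ext_map_fixed_points[OF theta_hom theta_commute]) auto
  moreover have "range a \<subseteq> graded"
    using theta_string_minus theta_commute
    by (auto simp: graded_def annihilator_eq simp del: theta_simps(4) theta'_simps(4))
  ultimately show ?thesis
    unfolding car_part_def by (rule ext.cstar_generated_minimal)
qed

text \<open>Since \<open>\<alpha>\<close> fixes \<open>H1\<close> pointwise, it negates
  \<open>H1 T\<close>, so (1 + \<alpha>)/2 and (1 - \<alpha>)/2 separate the two summands.\<close>

lemma alpha_flip: "\<alpha> T = \<ominus>\<^bsub>H\<^esub> T"
  by (simp add: E_uminus base.alg_minus base.minus_eq_smult)

lemma star_flip: "star H T = T"
  by (simp add: E_star)

lemma alpha_car_part: "X \<in> H1 \<Longrightarrow> \<alpha> X = X"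
  using car_part_subset_graded graded_eq by blast

lemma car_part_closed [intro]: "X \<in> H1 \<Longrightarrow> X \<in> carrier H"
  using carD(1) by blast

section \<open>The sum of \<open>H1\<close> and \<open>H1 T\<close>\<close>

lemmas ext_closed [simp] = ring.ring_simprules(1-6)[OF ext.algebra_ring] ext.star_closed

text \<open>The conditions test the components of \<open>X\<close> fixed and negated by
  \<open>\<alpha>\<close>, up to a factor 2 that is immaterial as \<open>H1\<close> is linear. The
  factor T moves the second component from \<open>H1 T\<close> to \<open>H1\<close>, because T
  squares to 1.\<close>

definition car_sum :: "('a^2^2) set" where
  "car_sum = {X \<in> carrier H. X \<oplus>\<^bsub>H\<^esub> \<alpha> X \<in> H1} \<inter> {X \<in> carrier H. (X \<ominus>\<^bsub>H\<^esub> \<alpha> X) \<otimes>\<^bsub>H\<^esub> T \<in> H1}"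

text \<open>By this description \<open>car_sum\<close> is a subalgebra, by its definition it is closed.\<close>

lemma car_sum_iff: "X \<in> car_sum \<longleftrightarrow> (\<exists>Y\<in>H1. \<exists>Z\<in>H1. X = Y \<oplus>\<^bsub>H\<^esub> Z \<otimes>\<^bsub>H\<^esub> T)"
proof
  assume X: "X \<in> car_sum"
  then have c: "X \<in> carrier H" "\<alpha> X \<in> carrier H"
    using star_homD(1)[OF alpha_hom] by (auto simp: car_sum_def)
  let ?Y = "(1/2) \<odot>\<^bsub>H\<^esub> (X \<oplus>\<^bsub>H\<^esub> \<alpha> X)"
  let ?Z = "(1/2) \<odot>\<^bsub>H\<^esub> ((X \<ominus>\<^bsub>H\<^esub> \<alpha> X) \<otimes>\<^bsub>H\<^esub> T)"
  have "?Y \<in> H1" "?Z \<in> H1"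
    using X by (auto simp: car_sum_def intro: carD(4))
  moreover have "X = ?Y \<oplus>\<^bsub>H\<^esub> ?Z \<otimes>\<^bsub>H\<^esub> T"
  proof -
    have "?Z \<otimes>\<^bsub>H\<^esub> T = (1/2) \<odot>\<^bsub>H\<^esub> (X \<ominus>\<^bsub>H\<^esub> \<alpha> X)"
      using c monoid.r_one[OF ring.is_monoid[OF ext.algebra_ring], of "X \<ominus>\<^bsub>H\<^esub> \<alpha> X"]
      by (simp add: ext.smult_mult_left ext.alg_m_assoc)
    then have "?Y \<oplus>\<^bsub>H\<^esub> ?Z \<otimes>\<^bsub>H\<^esub> T = (1/2) \<odot>\<^bsub>H\<^esub> ((X \<oplus>\<^bsub>H\<^esub> \<alpha> X) \<oplus>\<^bsub>H\<^esub> (X \<ominus>\<^bsub>H\<^esub> \<alpha> X))"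
      using c by (simp add: ext.smult_add_right)
    also have "(X \<oplus>\<^bsub>H\<^esub> \<alpha> X) \<oplus>\<^bsub>H\<^esub> (X \<ominus>\<^bsub>H\<^esub> \<alpha> X) = X \<oplus>\<^bsub>H\<^esub> X"
      using c by algebra
    finally show ?thesis
      using c ext.half_double by simp
  qed
  ultimately show "\<exists>Y\<in>H1. \<exists>Z\<in>H1. X = Y \<oplus>\<^bsub>H\<^esub> Z \<otimes>\<^bsub>H\<^esub> T"
    by blast
next
  assume "\<exists>Y\<in>H1. \<exists>Z\<in>H1. X = Y \<oplus>\<^bsub>H\<^esub> Z \<otimes>\<^bsub>H\<^esub> T"
  then obtain Y Z where YZ: "Y \<in> H1" "Z \<in> H1" and X: "X = Y \<oplus>\<^bsub>H\<^esub> Z \<otimes>\<^bsub>H\<^esub> T"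
    by blast
  \<comment> \<open>The name hides \<open>E \<zero> \<one>\<close>: T becomes an atom known only
    through its square and its image under \<open>\<alpha>\<close>.\<close>
  define t where "t = T"
  have c: "Y \<in> carrier H" "Z \<in> carrier H" "t \<in> carrier H"
    using YZ by (auto simp: t_def)
  have tt: "t \<otimes>\<^bsub>H\<^esub> t = \<one>\<^bsub>H\<^esub>" and \<alpha>t: "\<alpha> t = \<ominus>\<^bsub>H\<^esub> t"
    unfolding t_def by (rule flip_flip, rule alpha_flip)
  have \<alpha>X: "\<alpha> X = Y \<oplus>\<^bsub>H\<^esub> Z \<otimes>\<^bsub>H\<^esub> (\<ominus>\<^bsub>H\<^esub> t)"
    using YZ c \<alpha>t unfolding X t_def[symmetric]
    by (simp add: star_homD[OF alpha_hom] alpha_car_part)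
  have "X \<oplus>\<^bsub>H\<^esub> \<alpha> X = Y \<oplus>\<^bsub>H\<^esub> Y"
    using c unfolding \<alpha>X unfolding X t_def[symmetric] by algebra
  moreover have "(X \<ominus>\<^bsub>H\<^esub> \<alpha> X) \<otimes>\<^bsub>H\<^esub> t = Z \<otimes>\<^bsub>H\<^esub> (t \<otimes>\<^bsub>H\<^esub> t) \<oplus>\<^bsub>H\<^esub> Z \<otimes>\<^bsub>H\<^esub> (t \<otimes>\<^bsub>H\<^esub> t)"
    using c unfolding \<alpha>X unfolding X t_def[symmetric] by algebra
  then have "(X \<ominus>\<^bsub>H\<^esub> \<alpha> X) \<otimes>\<^bsub>H\<^esub> t = Z \<oplus>\<^bsub>H\<^esub> Z"
    using c monoid.r_one[OF ring.is_monoid[OF ext.algebra_ring]] by (simp add: tt)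
  moreover have "X \<in> carrier H"
    using c by (simp add: X t_def[symmetric])
  ultimately show "X \<in> car_sum"
    using YZ by (simp add: car_sum_def t_def carD(3))
qed

lemma car_sum_subalgebra: "cstar_subalgebra H car_sum"
proof (rule ext.cstar_subalgebraI)
  define t where "t = T"
  have t: "t \<in> carrier H" "t \<otimes>\<^bsub>H\<^esub> t = \<one>\<^bsub>H\<^esub>" "star H t = t"
    unfolding t_def by (rule flip_closed, rule flip_flip, rule star_flip)
  note r_one = monoid.r_one[OF ring.is_monoid[OF ext.algebra_ring]]
  have tXt: "t \<otimes>\<^bsub>H\<^esub> X \<otimes>\<^bsub>H\<^esub> t \<in> H1" if "X \<in> H1" for X
    unfolding t_def using that by (rule flip_conjugate_car_part)
  have iff: "X \<in> car_sum \<longleftrightarrow> (\<exists>Y\<in>H1. \<exists>Z\<in>H1. X = Y \<oplus>\<^bsub>H\<^esub> Z \<otimes>\<^bsub>H\<^esub> t)" for X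
    unfolding t_def by (rule car_sum_iff)
  have car_sumI: "Y \<oplus>\<^bsub>H\<^esub> Z \<otimes>\<^bsub>H\<^esub> t \<in> car_sum" if "Y \<in> H1" "Z \<in> H1" for Y Z
    using that iff by blast
  show "car_sum \<subseteq> carrier H"
    by (auto simp: car_sum_def)
  have "\<zero>\<^bsub>H\<^esub> = \<zero>\<^bsub>H\<^esub> \<oplus>\<^bsub>H\<^esub> \<zero>\<^bsub>H\<^esub> \<otimes>\<^bsub>H\<^esub> t"
    using t by algebra
  then show "\<zero>\<^bsub>H\<^esub> \<in> car_sum"
    using carD(2) iff by blast
  show "c \<odot>\<^bsub>H\<^esub> X \<in> car_sum" if X: "X \<in> car_sum" for c X
  proof -
    obtain Y Z where YZ: "Y \<in> H1" "Z \<in> H1" "X = Y \<oplus>\<^bsub>H\<^esub> Z \<otimes>\<^bsub>H\<^esub> t"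
      using X iff by blast
    then have "c \<odot>\<^bsub>H\<^esub> X = c \<odot>\<^bsub>H\<^esub> Y \<oplus>\<^bsub>H\<^esub> (c \<odot>\<^bsub>H\<^esub> Z) \<otimes>\<^bsub>H\<^esub> t"
      using t by (simp add: car_part_closed ext.smult_add_right ext.smult_mult_left)
    also have "\<dots> \<in> car_sum"
      by (intro car_sumI carD(4) YZ)
    finally show ?thesis .
  qed
  show "star H X \<in> car_sum" if X: "X \<in> car_sum" for X
  proof -
    obtain Y Z where YZ: "Y \<in> H1" "Z \<in> H1" "X = Y \<oplus>\<^bsub>H\<^esub> Z \<otimes>\<^bsub>H\<^esub> t"
      using X iff by blast
    \<comment> \<open>The adjoint of Z T is T Z* = (T Z* T) T, and the bracket lies in
      \<open>H1\<close>.\<close>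
    then have "star H X = star H Y \<oplus>\<^bsub>H\<^esub> (t \<otimes>\<^bsub>H\<^esub> star H Z \<otimes>\<^bsub>H\<^esub> t) \<otimes>\<^bsub>H\<^esub> t"
      using t by (simp add: car_part_closed ext.star_add ext.star_mult ext.alg_m_assoc r_one)
    also have "\<dots> \<in> car_sum"
      by (intro car_sumI carD(6) tXt YZ)
    finally show ?thesis .
  qed
  fix X X' assume "X \<in> car_sum" "X' \<in> car_sum"
  then obtain Y Z Y' Z' where YZ: "Y \<in> H1" "Z \<in> H1" "Y' \<in> H1" "Z' \<in> H1"
    and X: "X = Y \<oplus>\<^bsub>H\<^esub> Z \<otimes>\<^bsub>H\<^esub> t" and X': "X' = Y' \<oplus>\<^bsub>H\<^esub> Z' \<otimes>\<^bsub>H\<^esub> t"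
    using iff by blast
  have c: "Y \<in> carrier H" "Z \<in> carrier H" "Y' \<in> carrier H" "Z' \<in> carrier H"
    using YZ by auto
  have "X \<oplus>\<^bsub>H\<^esub> X' = (Y \<oplus>\<^bsub>H\<^esub> Y') \<oplus>\<^bsub>H\<^esub> (Z \<oplus>\<^bsub>H\<^esub> Z') \<otimes>\<^bsub>H\<^esub> t"
    using c t(1) unfolding X X' by algebra
  also have "\<dots> \<in> car_sum"
    by (intro car_sumI carD(3) YZ)
  finally show "X \<oplus>\<^bsub>H\<^esub> X' \<in> car_sum" .
  \<comment> \<open>Moving T to the right past \<open>Y'\<close> or \<open>Z'\<close> costs a
    conjugation by T, under which \<open>H1\<close> is invariant; two factors T cancel.\<close>
  have "X \<otimes>\<^bsub>H\<^esub> X' = (Y \<otimes>\<^bsub>H\<^esub> Y' \<oplus>\<^bsub>H\<^esub> Z \<otimes>\<^bsub>H\<^esub> (t \<otimes>\<^bsub>H\<^esub> Z' \<otimes>\<^bsub>H\<^esub> t))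
      \<oplus>\<^bsub>H\<^esub> (Y \<otimes>\<^bsub>H\<^esub> Z' \<oplus>\<^bsub>H\<^esub> Z \<otimes>\<^bsub>H\<^esub> (t \<otimes>\<^bsub>H\<^esub> Y' \<otimes>\<^bsub>H\<^esub> t)) \<otimes>\<^bsub>H\<^esub> t"
    using c t(1) unfolding X X'
    by (simp add: ext.alg_distr ext.alg_m_assoc t(2) r_one ext.alg_a_ac)
  also have "\<dots> \<in> car_sum"
    by (intro car_sumI carD(3,5) tXt YZ)
  finally show "X \<otimes>\<^bsub>H\<^esub> X' \<in> car_sum" .
next
  note hom = star_homD[OF alpha_hom]
    and homm = star_hom_minus[OF ext.unital_cstar_algebra_axioms ext.unital_cstar_algebra_axioms alpha_hom]
  have bound: "cnorm H (\<alpha> X) \<le> cnorm H X" if "X \<in> carrier H" for X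
    using star_hom_contractive[OF _ _ alpha_hom that] ext.unital_cstar_algebra_axioms by blast
  \<comment> \<open>\<open>\<alpha>\<close> is contractive, so
    \<open>X \<plusminus> \<alpha> X\<close> has at most twice the norm of \<open>X\<close>.\<close>
  have "continuous_map (norm_topology H) (norm_topology H) (\<lambda>X. X \<oplus>\<^bsub>H\<^esub> \<alpha> X)"
  proof (rule additive_bounded_continuous[where C = 2])
    fix X assume X: "X \<in> carrier H"
    then show "cnorm H (X \<oplus>\<^bsub>H\<^esub> \<alpha> X) \<le> 2 * cnorm H X"
      using ext.cnorm_triangle[of X "\<alpha> X"] bound[OF X] hom(1)[OF X] by simp
    fix Y assume Y: "Y \<in> carrier H"
    show "(X \<ominus>\<^bsub>H\<^esub> Y) \<oplus>\<^bsub>H\<^esub> \<alpha> (X \<ominus>\<^bsub>H\<^esub> Y) = (X \<oplus>\<^bsub>H\<^esub> \<alpha> X) \<ominus>\<^bsub>H\<^esub> (Y \<oplus>\<^bsub>H\<^esub> \<alpha> Y)"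
      unfolding homm(2)[OF X Y] using X Y hom(1)[OF X] hom(1)[OF Y] by algebra
  qed (auto simp: hom ext.unital_cstar_algebra_axioms)
  moreover have "continuous_map (norm_topology H) (norm_topology H) (\<lambda>X. X \<ominus>\<^bsub>H\<^esub> \<alpha> X)"
  proof (rule additive_bounded_continuous[where C = 2])
    fix X assume X: "X \<in> carrier H"
    then show "cnorm H (X \<ominus>\<^bsub>H\<^esub> \<alpha> X) \<le> 2 * cnorm H X"
      using ext.cnorm_diff_le[of X "\<alpha> X"] bound[OF X] hom(1)[OF X] by simp
    fix Y assume Y: "Y \<in> carrier H"
    show "(X \<ominus>\<^bsub>H\<^esub> Y) \<ominus>\<^bsub>H\<^esub> \<alpha> (X \<ominus>\<^bsub>H\<^esub> Y) = (X \<ominus>\<^bsub>H\<^esub> \<alpha> X) \<ominus>\<^bsub>H\<^esub> (Y \<ominus>\<^bsub>H\<^esub> \<alpha> Y)"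
      unfolding homm(2)[OF X Y] using X Y hom(1)[OF X] hom(1)[OF Y] by algebra
  qed (auto simp: hom ext.unital_cstar_algebra_axioms)
  then have "continuous_map (norm_topology H) (norm_topology H) (\<lambda>X. (X \<ominus>\<^bsub>H\<^esub> \<alpha> X) \<otimes>\<^bsub>H\<^esub> T)"
    using continuous_map_compose[OF _ ext.continuous_map_mult_right[OF flip_closed]]
    by (fastforce simp: comp_def)
  ultimately show "closedin (norm_topology H) car_sum"
    unfolding car_sum_def using closedin_continuous_map_preimage[OF _ carD(7)]
    by (intro closedin_Int) fastforce+
qed

lemmas car_sumD = ext.cstar_subalgebraD[OF car_sum_subalgebra]

lemma car_part_subset_car_sum: "H1 \<subseteq> car_sum" and flip_in_car_sum: "T \<in> car_sum"
proof -
  have "X = X \<oplus>\<^bsub>H\<^esub> \<zero>\<^bsub>H\<^esub> \<otimes>\<^bsub>H\<^esub> T" if "X \<in> carrier H" for X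
    using that flip_closed by algebra
  then show "H1 \<subseteq> car_sum"
    using carD(2) car_sum_iff by blast
  have "T = \<zero>\<^bsub>H\<^esub> \<oplus>\<^bsub>H\<^esub> \<one>\<^bsub>H\<^esub> \<otimes>\<^bsub>H\<^esub> T"
    using flip_closed by algebra
  then show "T \<in> car_sum"
    using carD(2) one_in_car_part car_sum_iff by blast
qed

lemma E_decomposition:
  "\<lbrakk>b \<in> carrier \<AA>; c \<in> carrier \<AA>\<rbrakk> \<Longrightarrow> E b c = E b \<zero> \<oplus>\<^bsub>H\<^esub> E c \<zero> \<otimes>\<^bsub>H\<^esub> T"
  by (simp add: E_mult E_add)

lemma car_sum_eq_carrier: "car_sum = carrier H"
proof
  \<comment> \<open>Pulling \<open>car_sum\<close> back along \<psi> turns the claim into one about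
    a C*-subalgebra of \<AA>, to which \<open>spins_generate\<close> applies.\<close>
  define W where "W = {b \<in> carrier \<AA>. E b \<zero> \<in> car_sum}"
  have W: "cstar_subalgebra \<AA> W"
    unfolding W_def using cstar_subalgebra_preimage[OF base _ ext_embed_hom car_sum_subalgebra]
      ext.unital_cstar_algebra_axioms by blast
  note WD = base.cstar_subalgebraD[OF W]
  have minus: "\<sigma>m x \<in> W" for x
  proof -
    have "E (star \<AA> (S x)) \<zero> \<in> car_sum"
      using carD(6)[OF spin_string_in_car_part[of x]] car_part_subset_car_sum by (auto simp: E_star)
    \<comment> \<open>The two factors T cancel in \<open>T a\<^sub>x\<close>; multiplying by the
      image of the adjoint string from the left then leaves the lowering operator.\<close>
    moreover have "T \<otimes>\<^bsub>H\<^esub> a x = E (S x \<otimes> \<sigma>m x) \<zero>"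
      by (simp add: annihilator_eq E_mult involution del: theta'_simps(4))
    then have "E (S x \<otimes> \<sigma>m x) \<zero> \<in> car_sum"
      using car_sumD(5)[OF flip_in_car_sum, of "a x"] annihilator_in_car_part[of x] car_part_subset_car_sum by auto
    ultimately have "E (star \<AA> (S x)) \<zero> \<otimes>\<^bsub>H\<^esub> E (S x \<otimes> \<sigma>m x) \<zero> \<in> car_sum"
      by (rule car_sumD(5))
    moreover have "E (star \<AA> (S x)) \<zero> \<otimes>\<^bsub>H\<^esub> E (S x \<otimes> \<sigma>m x) \<zero> = E (star \<AA> (S x) \<otimes> S x \<otimes> \<sigma>m x) \<zero>"
      by (simp add: E_mult base.alg_m_assoc)
    ultimately show ?thesis
      by (simp add: W_def spin_string_isometry)
  qed
  have one: "\<one> \<in> W"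
    using one_in_car_part car_part_subset_car_sum by (auto simp: W_def E_one)
  have three: "\<sigma> 3 x \<in> W" for x
    using spin_3_in_car_part car_part_subset_car_sum by (auto simp: W_def spin_closed)
  have m: "site_embedding x (mk_mat2 0 0 1 0) \<in> W" for x
    using minus[of x] by (simp add: spin_minus_eq)
  have p: "site_embedding x (mk_mat2 0 1 0 0) \<in> W" for x
  proof -
    have "star \<AA> (site_embedding x (mk_mat2 0 0 1 0)) = site_embedding x (mk_mat2 0 1 0 0)"
      unfolding site_embedding_star
      by (rule arg_cong[of _ _ "site_embedding x"]) (simp add: mat2_eq_iff)
    then show ?thesis
      using WD(6)[OF m[of x]] by simp
  qed
  \<comment> \<open>\<open>\<sigma>\<^sub>1 = \<sigma>\<^sub>- + \<sigma>\<^sub>+\<close> and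
    \<open>\<sigma>\<^sub>2 = i \<sigma>\<^sub>- - i \<sigma>\<^sub>+\<close>, where
    \<open>\<sigma>\<^sub>+\<close> is the adjoint of \<open>\<sigma>\<^sub>-\<close>.\<close>
  have "\<sigma> \<kappa> x \<in> W" if \<kappa>: "\<kappa> \<le> 3" for \<kappa> x
  proof -
    have "\<sigma> 0 x = \<one>"
      by (simp add: spin_eq pauli_def site_embedding_one)
    moreover have "\<sigma> 1 x = site_embedding x (mk_mat2 0 0 1 0) \<oplus> site_embedding x (mk_mat2 0 1 0 0)"
      unfolding spin_eq site_embedding_add
      by (rule arg_cong[of _ _ "site_embedding x"]) (simp add: pauli_def mat2_eq_iff)
    moreover have "\<sigma> 2 x =
        \<i> \<odot> site_embedding x (mk_mat2 0 0 1 0) \<oplus> (-\<i>) \<odot> site_embedding x (mk_mat2 0 1 0 0)"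
      unfolding spin_eq site_embedding_smult site_embedding_add
      by (rule arg_cong[of _ _ "site_embedding x"]) (simp add: pauli_def mat2_eq_iff)
    moreover have "\<kappa> = 0 \<or> \<kappa> = 1 \<or> \<kappa> = 2 \<or> \<kappa> = 3"
      using \<kappa> by linarith
    ultimately show ?thesis
      using one three WD(3)[OF m p] WD(3)[OF WD(4)[OF m] WD(4)[OF p]] by auto
  qed
  then have "W = carrier \<AA>"
    by (rule spins_generate[OF W])
  then have embed: "E b \<zero> \<in> car_sum" if "b \<in> carrier \<AA>" for b
    using that W_def by blast
  show "carrier H \<subseteq> car_sum"
  proof
    fix X assume "X \<in> carrier H"
    then obtain b c where "b \<in> carrier \<AA>" "c \<in> carrier \<AA>" "X = E b c"
      by (rule E_cases)
    then show "X \<in> car_sum"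
      using embed E_decomposition car_sumD(3,5) flip_in_car_sum by metis
  qed
qed (rule car_sumD(1))

text \<open>Every \<open>X\<close> lies in \<open>car_sum\<close>, whose first defining condition
  reads X + X \<in> H1 at a fixed point of \<open>\<alpha>\<close>.\<close>

theorem car_part_eq_graded: "H1 = graded"
proof
  show "graded \<subseteq> H1"
  proof
    fix X assume "X \<in> graded"
    then have X: "X \<in> carrier H" "\<alpha> X = X"
      by (auto simp: graded_eq)
    then have "X \<in> car_sum"
      using car_sum_eq_carrier by simp
    then have "X \<oplus>\<^bsub>H\<^esub> X \<in> H1"
      using X(2) by (simp add: car_sum_def)
    then show "X \<in> H1"
      using carD(4) ext.half_double[OF X(1)] by metis
  qed
qed (rule car_part_subset_graded)

section \<open>The extension of \<Theta>, parities and direct sums\<close>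

lemma car_part_direct_sum:
  "internal_direct_sum H (carrier H) H1 (right_translate H H1 T)"
proof -
  \<comment> \<open>Right multiplication by T exchanges the two coordinates and with them the
    parities: the diagonal coordinate is now odd, the other one even.\<close>
  have HT: "right_translate H H1 T = {E c b | b c. b \<in> carrier \<AA> \<and> c \<in> carrier \<AA> \<and> \<Theta> b = b \<and> \<Theta> c = \<ominus> c}"
  proof (intro equalityI subsetI)
    fix X assume "X \<in> right_translate H H1 T"
    then show "X \<in> {E c b | b c. b \<in> carrier \<AA> \<and> c \<in> carrier \<AA> \<and> \<Theta> b = b \<and> \<Theta> c = \<ominus> c}"
      unfolding right_translate_def car_part_eq_graded graded_def by (auto simp: E_mult)
  next
    fix X assume "X \<in> {E c b | b c. b \<in> carrier \<AA> \<and> c \<in> carrier \<AA> \<and> \<Theta> b = b \<and> \<Theta> c = \<ominus> c}"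
    then obtain b c where bc: "b \<in> carrier \<AA>" "c \<in> carrier \<AA>" "\<Theta> b = b" "\<Theta> c = \<ominus> c" "X = E c b"
      by blast
    then have "X = E b c \<otimes>\<^bsub>H\<^esub> T" "E b c \<in> graded"
      by (auto simp: E_mult graded_def)
    then show "X \<in> right_translate H H1 T"
      unfolding right_translate_def car_part_eq_graded by blast
  qed
  have "submodule (right_translate H H1 T) complex_ring H"
  proof (rule ext.submoduleI)
    show "right_translate H H1 T \<subseteq> carrier H"
      by (auto simp: HT)
    show "\<zero>\<^bsub>H\<^esub> \<in> right_translate H H1 T"
      using base_closed(7) by (auto simp: HT E_zero base.alg_minus intro!: exI[of _ \<zero>])
  next
    fix X assume "X \<in> right_translate H H1 T"
    then show "\<ominus>\<^bsub>H\<^esub> X \<in> right_translate H H1 T" "c \<odot>\<^bsub>H\<^esub> X \<in> right_translate H H1 T" for c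
      by (auto simp: HT E_uminus E_smult base.smult_minus_right)
  next
    fix X Y assume "X \<in> right_translate H H1 T" "Y \<in> right_translate H H1 T"
    then show "X \<oplus>\<^bsub>H\<^esub> Y \<in> right_translate H H1 T"
      by (auto simp: HT E_add base.alg_minus)
  qed
  moreover have "carrier H = H1 <+>\<^bsub>H\<^esub> right_translate H H1 T"
  proof (intro equalityI subsetI)
    fix X assume "X \<in> carrier H"
    then show "X \<in> H1 <+>\<^bsub>H\<^esub> right_translate H H1 T"
      using car_sum_iff[of X] unfolding car_sum_eq_carrier set_add_def' right_translate_def by blast
  next
    fix X assume "X \<in> H1 <+>\<^bsub>H\<^esub> right_translate H H1 T"
    then show "X \<in> carrier H"
      unfolding set_add_def' right_translate_def using flip_closed by (auto simp: car_part_closed)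
  qed
  moreover have "H1 \<inter> right_translate H H1 T = {\<zero>\<^bsub>H\<^esub>}"
  proof (intro equalityI subsetI)
    fix X assume "X \<in> H1 \<inter> right_translate H H1 T"
    \<comment> \<open>One membership makes a coordinate even, the other makes it odd; so both
      coordinates vanish.\<close>
    then obtain b c where bc: "b \<in> carrier \<AA>" "c \<in> carrier \<AA>" "X = E c b"
      "\<Theta> b = b" "\<Theta> c = \<ominus> c" "\<Theta> c = c" "\<Theta> b = \<ominus> b"
      unfolding HT unfolding car_part_eq_graded graded_def by auto
    then show "X \<in> {\<zero>\<^bsub>H\<^esub>}"
      using base.eq_minus_self_iff[of b] base.eq_minus_self_iff[of c] by (simp add: E_zero)
  next
    fix X assume "X \<in> {\<zero>\<^bsub>H\<^esub>}"
    then show "X \<in> H1 \<inter> right_translate H H1 T"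
      using carD(2) base_closed(7) by (auto simp: HT E_zero base.alg_minus intro!: exI[of _ \<zero>])
  qed
  ultimately show ?thesis
    using car_part_subalgebra by (simp add: internal_direct_sum_def cstar_subalgebra_def)
qed

text \<open>A homomorphism with prescribed values on \<psi>(\<AA>) and T has prescribed values on
  every \<psi>(b) + \<psi>(c) T; conversely the formula is that of
  \<open>ext_map \<Theta> 1\<close>. Existence, uniqueness and all computations with \<theta> rest
  on it.\<close>

lemma extends_theta_iff:
  "extends_theta \<AA> N \<Theta> \<Theta>' \<theta> \<longleftrightarrow>
    (\<forall>b\<in>carrier \<AA>. \<forall>c\<in>carrier \<AA>. \<theta> (E b c) = E (\<Theta> b) (\<Theta> c))"
proof
  assume ext: "extends_theta \<AA> N \<Theta> \<Theta>' \<theta>"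
  then have hom: "star_hom H H \<theta>"
    by (simp add: extends_theta_def star_iso_def)
  show "\<forall>b\<in>carrier \<AA>. \<forall>c\<in>carrier \<AA>. \<theta> (E b c) = E (\<Theta> b) (\<Theta> c)"
  proof (intro ballI)
    fix b c assume bc: "b \<in> carrier \<AA>" "c \<in> carrier \<AA>"
    then have "\<theta> (E b c) = \<theta> (E b \<zero>) \<oplus>\<^bsub>H\<^esub> \<theta> (E c \<zero>) \<otimes>\<^bsub>H\<^esub> \<theta> T"
      by (subst E_decomposition) (simp_all add: star_homD[OF hom])
    also have "\<dots> = E (\<Theta> b) (\<Theta> c)"
      using ext bc by (simp add: extends_theta_def ext_embed_eq ext_flip_eq E_mult E_add)
    finally show "\<theta> (E b c) = E (\<Theta> b) (\<Theta> c)" .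
  qed
next
  assume \<theta>: "\<forall>b\<in>carrier \<AA>. \<forall>c\<in>carrier \<AA>. \<theta> (E b c) = E (\<Theta> b) (\<Theta> c)"
  then have eq: "\<theta> X = ext_map \<Theta> 1 X" if "X \<in> carrier H" for X
    using that by (auto elim!: E_cases)
  have iso: "star_automorphism H (ext_map \<Theta> 1)"
    by (rule ext_map_iso[OF theta_aut theta_commute])
  have "star_hom H H \<theta>"
    using iso by (auto simp: star_iso_def star_hom_def eq Pi_iff)
  moreover have "bij_betw \<theta> (carrier H) (carrier H)"
    using iso bij_betw_cong[of "carrier H" \<theta> "ext_map \<Theta> 1"] eq by (simp add: star_iso_def)
  ultimately show "extends_theta \<AA> N \<Theta> \<Theta>' \<theta>"
    using \<theta> by (simp add: extends_theta_def star_iso_def ext_embed_eq ext_flip_eq)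
qed

text \<open>Functions are total, so uniqueness requires the values outside the carrier to be fixed;
  extensionality makes them \<open>undefined\<close>.\<close>

lemma ex1_extends_theta: "\<exists>!\<theta>. \<theta> \<in> extensional (carrier H) \<and> extends_theta \<AA> N \<Theta> \<Theta>' \<theta>"
proof (rule ex1I)
  show "restrict (ext_map \<Theta> 1) (carrier H) \<in> extensional (carrier H) \<and>
      extends_theta \<AA> N \<Theta> \<Theta>' (restrict (ext_map \<Theta> 1) (carrier H))"
    by (simp add: extends_theta_iff)
  fix \<theta> assume \<theta>: "\<theta> \<in> extensional (carrier H) \<and> extends_theta \<AA> N \<Theta> \<Theta>' \<theta>"
  show "\<theta> = restrict (ext_map \<Theta> 1) (carrier H)"
  proof (rule extensionalityI[of _ "carrier H"])
    fix X assume "X \<in> carrier H"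
    then show "\<theta> X = restrict (ext_map \<Theta> 1) (carrier H) X"
      using \<theta> by (auto simp: extends_theta_iff elim!: E_cases)
  qed (use \<theta> in auto)
qed

lemma even_odd_structure:
  assumes \<theta>: "extends_theta \<AA> N \<Theta> \<Theta>' \<theta>" and V: "V \<in> {carrier H, H0, H1}"
  shows "unital_cstar_subalgebra H (even_part \<theta> V)"
    and "closed_linear_star_invariant H (odd_part H \<theta> V)"
    and "internal_direct_sum H V (even_part \<theta> V) (odd_part H \<theta> V)"
    and "\<theta> ` V \<subseteq> V"
proof -
  have E: "\<theta> (E b c) = E (\<Theta> b) (\<Theta> c)" if "b \<in> carrier \<AA>" "c \<in> carrier \<AA>" for b c
    using \<theta> that by (simp add: extends_theta_iff)
  have hom: "star_hom H H \<theta>"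
    using \<theta> by (simp add: extends_theta_def star_iso_def)
  have sub: "cstar_subalgebra H V"
    using V ext.cstar_subalgebra_carrier diag_part_subalgebra car_part_subalgebra by auto
  have "\<one>\<^bsub>H\<^esub> \<in> V"
    using V one_in_car_part by (auto simp: E_one diag_part_eq)
  then show "unital_cstar_subalgebra H (even_part \<theta> V)"
    using ext.even_part_subalgebra[OF hom sub]
    by (simp add: unital_cstar_subalgebra_def even_part_def E_one E)
  show "closed_linear_star_invariant H (odd_part H \<theta> V)"
    by (rule ext.odd_part_closed_linear_star_invariant[OF hom sub])
  \<comment> \<open>For \<open>H1\<close> invariance is read off its description by parities, since
    \<Theta> preserves even and odd elements.\<close>
  have inv: "\<theta> X \<in> V" if "X \<in> V" for X
    using V that by (auto simp: E diag_part_eq car_part_eq_graded graded_def elim!: E_cases)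
  then show "\<theta> ` V \<subseteq> V"
    by blast
  have "\<theta> (\<theta> X) = X" if "X \<in> V" for X
    using that ext.cstar_subalgebraD(1)[OF sub]
    by (auto simp: E theta_involution elim!: E_cases dest!: subsetD)
  with inv show "internal_direct_sum H V (even_part \<theta> V) (odd_part H \<theta> V)"
    by (rule ext.even_odd_direct_sum[OF hom sub])
qed

text \<open>In \<open>H1\<close> the diagonal coordinate is even and the T-coordinate odd under
  \<Theta>. An even element thus has T-coordinate 0 and an odd one has diagonal coordinate
  0.\<close>

lemma car_part_even_odd:
  assumes \<theta>: "extends_theta \<AA> N \<Theta> \<Theta>' \<theta>"
  shows "even_part \<theta> H1 = even_part \<theta> H0"
    and "odd_part H \<theta> H1 = right_translate H (odd_part H \<theta> H0) T"
proof -
  have E: "\<theta> (E b c) = E (\<Theta> b) (\<Theta> c)" if "b \<in> carrier \<AA>" "c \<in> carrier \<AA>" for b c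
    using \<theta> that by (simp add: extends_theta_iff)
  have zero: "b = \<zero>" if "b \<in> carrier \<AA>" "\<Theta> b = b" "\<Theta> b = \<ominus> b" for b
    using that base.eq_minus_self_iff[of b] by simp
  show "even_part \<theta> H1 = even_part \<theta> H0"
  proof (intro equalityI subsetI)
    fix X assume X: "X \<in> even_part \<theta> H1"
    then obtain b c where bc: "b \<in> carrier \<AA>" "c \<in> carrier \<AA>" "\<Theta> c = \<ominus> c" "X = E b c"
      by (auto simp: even_part_def car_part_eq_graded graded_def)
    with X have "c = \<zero>"
      by (intro zero) (simp_all add: even_part_def E)
    with X bc show "X \<in> even_part \<theta> H0"
      by (auto simp: even_part_def diag_part_eq)
  qed (auto simp: even_part_def car_part_eq_graded graded_def diag_part_eq E base.alg_minus)
  have "odd_part H \<theta> H1 = (\<lambda>c. E \<zero> c) ` {c \<in> carrier \<AA>. \<Theta> c = \<ominus> c}"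
  proof (intro equalityI subsetI)
    fix X assume X: "X \<in> odd_part H \<theta> H1"
    then obtain b c where bc: "b \<in> carrier \<AA>" "c \<in> carrier \<AA>" "\<Theta> b = b" "\<Theta> c = \<ominus> c" "X = E b c"
      by (auto simp: odd_part_def car_part_eq_graded graded_def)
    with X have "b = \<zero>"
      by (intro zero) (simp_all add: odd_part_def E E_uminus)
    with bc show "X \<in> (\<lambda>c. E \<zero> c) ` {c \<in> carrier \<AA>. \<Theta> c = \<ominus> c}"
      by auto
  qed (auto simp: odd_part_def car_part_eq_graded graded_def E E_uminus base.alg_minus)
  moreover have "odd_part H \<theta> H0 = (\<lambda>c. E c \<zero>) ` {c \<in> carrier \<AA>. \<Theta> c = \<ominus> c}"
    by (auto simp: odd_part_def diag_part_eq E E_uminus base.alg_minus)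
  ultimately show "odd_part H \<theta> H1 = right_translate H (odd_part H \<theta> H0) T"
    by (auto simp: right_translate_def image_image E_mult intro!: image_cong)
qed

end

text \<open>Claims (b) and (c) are asserted for every \<theta> with \<open>extends_theta\<close>,
  the unique extensional one included, as they concern values on the carrier only.\<close>

theorem proposition39:
  fixes A :: "int \<Rightarrow> 'b cstar"
    and \<xi> :: "int \<Rightarrow> 'b \<Rightarrow> complex^2^2"
    and \<nu> :: "int set \<Rightarrow> 'b formal set \<Rightarrow> real"
    and \<AA> :: "'a cstar"
    and \<phi> :: "int set \<Rightarrow> 'b formal set \<Rightarrow> 'a"
    and N :: "'a^2^2 \<Rightarrow> real"
    and \<Theta> \<Theta>' :: "'a \<Rightarrow> 'a"
    and \<sigma> :: "nat \<Rightarrow> int \<Rightarrow> 'a"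
    and H :: "('a^2^2) cstar"
    and H0 H1 :: "('a^2^2) set"
    and T :: "'a^2^2"
  assumes spin_algebra: "spin_algebra A \<xi> \<nu> \<AA> \<phi>"
    and \<sigma>: "\<sigma> = spin A \<xi> \<phi>"
    and \<Theta>: "star_automorphism \<AA> \<Theta>"
      "\<And>x \<kappa>. \<kappa> \<le> 3 \<Longrightarrow> \<Theta> (\<sigma> \<kappa> x) = pauli_sign \<kappa> \<odot>\<^bsub>\<AA>\<^esub> \<sigma> \<kappa> x"
    and \<Theta>': "star_automorphism \<AA> \<Theta>'"
      "\<And>x \<kappa>. \<lbrakk>\<kappa> \<le> 3; 1 \<le> x\<rbrakk> \<Longrightarrow> \<Theta>' (\<sigma> \<kappa> x) = \<sigma> \<kappa> x"
      "\<And>x \<kappa>. \<lbrakk>\<kappa> \<le> 3; x \<le> 0\<rbrakk> \<Longrightarrow> \<Theta>' (\<sigma> \<kappa> x) = pauli_sign \<kappa> \<odot>\<^bsub>\<AA>\<^esub> \<sigma> \<kappa> x"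
    and matrix_algebra: "unital_cstar_algebra (mat2_algebra \<AA> N)"
    and H: "H = ext_algebra \<AA> N \<Theta>'"
    and H0: "H0 = diag_part \<AA> \<Theta>'"
    and H1: "H1 = car_part \<AA> N \<Theta>' \<sigma>"
    and T: "T = ext_flip \<AA>"
  shows
    "(\<exists>!\<theta>. \<theta> \<in> extensional (carrier H) \<and> extends_theta \<AA> N \<Theta> \<Theta>' \<theta>) \<and>
     (\<forall>\<theta>. extends_theta \<AA> N \<Theta> \<Theta>' \<theta> \<longrightarrow>
        (\<theta> ` H0 \<subseteq> H0 \<and> \<theta> ` H1 \<subseteq> H1 \<and>
         (\<forall>V \<in> {carrier H, H0, H1}.
            unital_cstar_subalgebra H (even_part \<theta> V) \<and>
            closed_linear_star_invariant H (odd_part H \<theta> V))) \<and>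
        ((\<forall>V \<in> {carrier H, H0, H1}.
            internal_direct_sum H V (even_part \<theta> V) (odd_part H \<theta> V)) \<and>
         even_part \<theta> H1 = even_part \<theta> H0 \<and>
         odd_part H \<theta> H1 = right_translate H (odd_part H \<theta> H0) T \<and>
         internal_direct_sum H (carrier H) H1 (right_translate H H1 T)))"
proof -
  interpret spin_extension A \<xi> \<nu> \<AA> \<phi> N \<Theta> \<Theta>'
    using assms(1,3-8) unfolding \<sigma> by (simp add: spin_extension_def spin_extension_axioms_def)
  show ?thesis
    unfolding H H0 H1 T \<sigma> ext_flip_eq
    using ex1_extends_theta even_odd_structure car_part_even_odd car_part_direct_sum by simp
qed

end
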